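(* (1) The set $\mathcal{P}^0_{\mathcal{A}_K}$ is a $K$-subalgebra of $\mathcal{A}_K$. (2) There are proper inclusions $$K\subsetneq\mathcal{P}^0_{\mathcal{A}_K}\subsetneq\mathcal{C}^{\mathrm{sep}}_{\mathcal{A}_K}\subsetneq\mathcal{C}^{\mathrm{alg}}_{\mathcal{A}_K}\subsetneq\mathcal{A}_K.$$
   Context: Let $q$ be a power of a prime number, $R=\mathbb{F}_q[\theta]$, $K=\mathbb{F}_q(\theta)$; $P$ always denotes a monic irreducible element of $R$. Put $\mathcal{A}_K=\big(\prod_P R/(P)\big)/\big(\bigoplus_P R/(P)\big)$, with $[(a_P)_P]$ the class of $(a_P)_P$. The diagonal map $x\mapsto[(x\bmod P)_P]$ (arbitrary entries at the finitely many $P$ dividing the denominator of $x$) embeds $K$ into $\mathcal{A}_K$, making $\mathcal{A}_K$ a $K$-algebra. For a finite Galois extension $L/K$ with $\Gamma=\mathrm{Gal}(L/K)$ and $R_L$ the integral closure of $R$ in $L$: for an unramified nonzero prime $\mathfrak p$ of $R_L$ over $(P)$, $\varphi_{\mathfrak p}\in\Gamma$ is the element with $\varphi_{\mathfrak p}(x)\equiv x^{q^{\deg P}}\bmod \mathfrak p$ for all $x\in R_L$. $A(L)$ is the set of maps $g:\Gamma\to L$ with $g(\sigma\tau\sigma^{-1})=\sigma(g(\tau))$ for all $\sigma,\tau\in\Gamma$. For $g\in A(L)$ and all but finitely many $P$, $g(\varphi_{\mathfrak p})\bmod\mathfrak p$ lies in the image of $R/(P)$ and is independent of $\mathfrak p\mid(P)$;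 denote the corresponding element $g(\varphi_P)\bmod P\in R/(P)$ and set $\mathrm{ev}_L(g)=[(g(\varphi_P)\bmod P)_P]\in\mathcal{A}_K$. The set of finite separable elements is $\mathcal{P}^0_{\mathcal{A}_K}=\bigcup_L \mathrm{ev}_L(A(L))$, the union over all finite Galois extensions $L/K$. $\mathcal{C}^{\mathrm{alg}}_{\mathcal{A}_K}$ is the set of $\alpha\in\mathcal{A}_K$ with $f(\alpha)=0$ for some nonzero $f\in K[x]$; $\mathcal{C}^{\mathrm{sep}}_{\mathcal{A}_K}$ is the set of $\alpha\in\mathcal{A}_K$ with $f(\alpha)=0$ for some nonzero $f\in K[x]$ that is a product of separable polynomials (polynomials without multiple roots). *)

theory Defs
  imports
    "HOL-Algebra.Algebraic_Closure_Type"
    "HOL-Algebra.Ideal_Product"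
    "HOL-Library.Cardinality"
    "HOL-Library.FuncSet"
    "HOL-Number_Theory.Cong"
begin

text \<open>
  The finite field is a type \<open>'k\<close> of sort \<open>{field, finite}\<close>, so that \<open>q = CARD('k)\<close>,
  \<open>R = 'k poly\<close>, \<open>K = 'k poly fract\<close>, and \<open>'k poly fract alg_closure\<close> is an algebraic
  closure of \<open>K\<close>.
\<close>

section \<open>The ring of residues modulo almost all primes\<close>

definition monic_irreducible :: "'k::field poly \<Rightarrow> bool" where
  "monic_irreducible P \<longleftrightarrow> Polynomial.lead_coeff P = 1 \<and> Factorial_Ring.irreducible P"

text \<open>
  An element of the product of the residue rings \<open>R/(P)\<close> is given by a family of
  representatives \<open>a P\<close>; two families define the same class modulo the direct sum iff
  \<open>a P\<close> and \<open>b P\<close> agree in \<open>R/(P)\<close> for all but finitely many \<open>P\<close>. The values of a family at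
  polynomials that are not monic irreducible are irrelevant.
\<close>

definition eq_almost_all :: "('k::field poly \<Rightarrow> 'k poly) \<Rightarrow> ('k poly \<Rightarrow> 'k poly) \<Rightarrow> bool" where
  "eq_almost_all a b \<longleftrightarrow> finite {P. monic_irreducible P \<and> \<not> [a P = b P] (mod P)}"

lemma eq_almost_all_combine:
  assumes "eq_almost_all a a'" and "eq_almost_all b b'"
    and "\<And>P. [a P = a' P] (mod P) \<Longrightarrow> [b P = b' P] (mod P) \<Longrightarrow> [c P = c' P] (mod P)"
  shows "eq_almost_all c c'"
  unfolding eq_almost_all_def
  by (rule finite_subset[OF _ finite_UnI[OF assms(1,2)[unfolded eq_almost_all_def]]])
     (use assms(3) in blast)

lemma eq_almost_all_refl [simp]: "eq_almost_all a a"
  by (simp add: eq_almost_all_def)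

lemma equivp_eq_almost_all: "equivp eq_almost_all"
proof (rule equivpI)
  show "reflp (eq_almost_all :: ('a poly \<Rightarrow> 'a poly) \<Rightarrow> _)"
    by (rule reflpI) simp
  show "symp (eq_almost_all :: ('a poly \<Rightarrow> 'a poly) \<Rightarrow> _)"
    by (rule sympI) (simp add: eq_almost_all_def cong_sym_eq)
  show "transp (eq_almost_all :: ('a poly \<Rightarrow> 'a poly) \<Rightarrow> _)"
    by (rule transpI) (erule (1) eq_almost_all_combine, blast intro: cong_trans)
qed

quotient_type (overloaded) 'k A\<^sub>K = "'k::field poly \<Rightarrow> 'k poly" / eq_almost_all
  by (rule equivp_eq_almost_all)

lemma monic_irreducible_divisor_exists:
  fixes f :: "'k::field poly"
  assumes "Polynomial.degree f > 0"
  shows "\<exists>P. monic_irreducible P \<and> P dvd f"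
proof -
  define Q where "Q = (\<lambda>n. \<exists>g. g dvd f \<and> Polynomial.degree g = n \<and> n > 0)"
  have "Q (Polynomial.degree f)"
    using assms unfolding Q_def by (intro exI[of _ f]) simp
  from LeastI[of Q, OF this] obtain g where g: "g dvd f"
    "Polynomial.degree g = Least Q" "Polynomial.degree g > 0"
    by (auto simp: Q_def)
  have g0: "g \<noteq> 0"
    using g(3) by auto
  define P where "P = Polynomial.smult (inverse (Polynomial.lead_coeff g)) g"
  have degP: "Polynomial.degree P = Polynomial.degree g" and Pg: "P dvd g"
    using g0 by (auto simp: P_def smult_dvd_iff)
  have "Factorial_Ring.irreducible P"
  proof (rule irreducibleI)
    show "P \<noteq> 0" using g0 by (simp add: P_def)
    thus "\<not> P dvd 1" using degP g(3) by (simp add: is_unit_iff_degree)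
    fix a b assume ab: "P = a * b"
    have nz: "a \<noteq> 0" "b \<noteq> 0" using ab \<open>P \<noteq> 0\<close> by auto
    have "a dvd f" using ab Pg g(1) by (metis dvd_trans dvd_triv_left)
    have "Polynomial.degree P = Polynomial.degree a + Polynomial.degree b"
      using ab nz by (simp add: degree_mult_eq)
    moreover have "Polynomial.degree a = 0 \<or> Polynomial.degree a \<ge> Least Q"
      using \<open>a dvd f\<close> by (auto simp: Q_def intro!: Least_le)
    ultimately have "Polynomial.degree a = 0 \<or> Polynomial.degree b = 0"
      using degP g(2) by auto
    thus "a dvd 1 \<or> b dvd 1"
      using nz by (simp add: is_unit_iff_degree)
  qed
  moreover have "Polynomial.lead_coeff P = 1"
    using g0 by (simp add: P_def)
  ultimately show ?thesis
    using dvd_trans[OF Pg g(1)] unfolding monic_irreducible_def by blast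
qed

lemma infinite_monic_irreducible: "infinite {P :: 'k::field poly. monic_irreducible P}"
proof
  assume fin: "finite {P :: 'k poly. monic_irreducible P}"
  define f :: "'k poly" where "f = [:0, 1:] * \<Prod>{P. monic_irreducible P}"
  have "\<Prod>{P :: 'k poly. monic_irreducible P} \<noteq> 0"
    using fin by (auto simp: prod_zero_iff monic_irreducible_def)
  hence "Polynomial.degree f > 0"
    unfolding f_def by (subst degree_mult_eq) auto
  hence "Polynomial.degree (f + 1) > 0"
    by (subst degree_add_eq_left) auto
  then obtain P where P: "monic_irreducible P" "P dvd f + 1"
    using monic_irreducible_divisor_exists by blast
  have "P dvd f"
    unfolding f_def using fin P(1) by (intro dvd_mult dvd_prodI) auto
  with P have "P dvd 1"
    by (simp add: dvd_add_right_iff)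
  thus False
    using P(1) by (auto simp: monic_irreducible_def irreducible_def)
qed

instantiation A\<^sub>K :: (field) comm_ring_1
begin

lift_definition zero_A\<^sub>K :: "'a A\<^sub>K" is "\<lambda>_. 0" .

lift_definition one_A\<^sub>K :: "'a A\<^sub>K" is "\<lambda>_. 1" .

lift_definition plus_A\<^sub>K :: "'a A\<^sub>K \<Rightarrow> 'a A\<^sub>K \<Rightarrow> 'a A\<^sub>K" is "\<lambda>a b P. a P + b P"
  by (erule (1) eq_almost_all_combine) (rule cong_add)

lift_definition times_A\<^sub>K :: "'a A\<^sub>K \<Rightarrow> 'a A\<^sub>K \<Rightarrow> 'a A\<^sub>K" is "\<lambda>a b P. a P * b P"
  by (erule (1) eq_almost_all_combine) (rule cong_mult)

lift_definition minus_A\<^sub>K :: "'a A\<^sub>K \<Rightarrow> 'a A\<^sub>K \<Rightarrow> 'a A\<^sub>K" is "\<lambda>a b P. a P - b P"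
  by (erule (1) eq_almost_all_combine) (rule cong_diff)

lift_definition uminus_A\<^sub>K :: "'a A\<^sub>K \<Rightarrow> 'a A\<^sub>K" is "\<lambda>a P. - a P"
  by (erule eq_almost_all_combine[OF _ eq_almost_all_refl]) (simp add: cong_minus_minus_iff)

instance
proof
  have "{P :: 'a poly. monic_irreducible P \<and> \<not> [0 = 1] (mod P)} = {P. monic_irreducible P}"
    by (auto simp: monic_irreducible_def cong_iff_dvd_diff irreducible_def)
  thus "(0 :: 'a A\<^sub>K) \<noteq> 1"
    by transfer (simp add: eq_almost_all_def infinite_monic_irreducible)
qed (transfer; simp add: algebra_simps)+

end

text \<open>The diagonal map; the entry at \<open>P\<close> is arbitrary if \<open>P\<close> divides the denominator.\<close>

definition of_K :: "'k::field poly fract \<Rightarrow> 'k A\<^sub>K" where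
  "of_K x = abs_A\<^sub>K (\<lambda>P. SOME a. \<exists>u v. x = Fraction_Field.Fract u v \<and> \<not> P dvd v \<and> [v * a = u] (mod P))"


section \<open>Finite Galois extensions and Frobenius elements\<close>

definition separable_poly :: "'a::field poly \<Rightarrow> bool" where
  "separable_poly f \<longleftrightarrow> rsquarefree (map_poly to_ac f)"

text \<open>
  Every finite Galois extension is isomorphic to a subfield of the algebraic closure, so the
  extensions \<open>L\<close> range over subfields of the algebraic closure.
\<close>

definition finite_galois :: "'a::field alg_closure set \<Rightarrow> bool" where
  "finite_galois L \<longleftrightarrow>
     subfield L ring_of_type_algebra \<and> range to_ac \<subseteq> L \<and>
     ring.finite_dimension ring_of_type_algebra (range to_ac) L \<and>
     (\<forall>f. Factorial_Ring.irreducible f \<and> (\<exists>x\<in>L. poly (map_poly to_ac f) x = 0) \<longrightarrow>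
        separable_poly f \<and> {x. poly (map_poly to_ac f) x = 0} \<subseteq> L)"

definition gal :: "'a::field alg_closure set \<Rightarrow> ('a alg_closure \<Rightarrow> 'a alg_closure) set" where
  "gal L = {\<sigma> \<in> extensional L.
     \<sigma> \<in> ring_iso (ring_of_type_algebra\<lparr>carrier := L\<rparr>) (ring_of_type_algebra\<lparr>carrier := L\<rparr>) \<and>
     (\<forall>c. \<sigma> (to_ac c) = to_ac c)}"

definition of_R :: "'k::field poly \<Rightarrow> 'k poly fract alg_closure" where
  "of_R r = to_ac (to_fract r)"

definition integers :: "'k::field poly fract alg_closure set \<Rightarrow> 'k poly fract alg_closure set" where
  "integers L = {x \<in> L. \<exists>f :: 'k poly poly. Polynomial.lead_coeff f = 1 \<and> poly (map_poly of_R f) x = 0}"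

definition integer_ring :: "'k::field poly fract alg_closure set \<Rightarrow> 'k poly fract alg_closure ring" where
  "integer_ring L = ring_of_type_algebra\<lparr>carrier := integers L\<rparr>"

definition prime_over ::
  "'k::field poly fract alg_closure set \<Rightarrow> 'k poly \<Rightarrow> 'k poly fract alg_closure set \<Rightarrow> bool" where
  "prime_over L P \<pp> \<longleftrightarrow> primeideal \<pp> (integer_ring L) \<and> {r. of_R r \<in> \<pp>} = {r. P dvd r}"

text \<open>
  The ramification index of \<open>\<pp>\<close> over \<open>P\<close> is the largest \<open>e\<close> such that the \<open>e\<close>-th power of \<open>\<pp>\<close>
  contains \<open>P\<close>. The residue field extensions are separable because the residue fields are finite.
\<close>

definition unramified_prime_over ::
  "'k::{field,finite} poly fract alg_closure set \<Rightarrow> 'k poly \<Rightarrow> 'k poly fract alg_closure set \<Rightarrow> bool" where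
  "unramified_prime_over L P \<pp> \<longleftrightarrow> prime_over L P \<pp> \<and> of_R P \<notin> ideal_prod (integer_ring L) \<pp> \<pp>"

definition frobenius ::
  "'k::{field,finite} poly fract alg_closure set \<Rightarrow> 'k poly \<Rightarrow> 'k poly fract alg_closure set
     \<Rightarrow> 'k poly fract alg_closure \<Rightarrow> 'k poly fract alg_closure" where
  "frobenius L P \<pp> = (THE \<phi>. \<phi> \<in> gal L \<and>
     (\<forall>x\<in>integers L. \<phi> x - x ^ (CARD('k) ^ Polynomial.degree P) \<in> \<pp>))"

text \<open>
  Congruence modulo the maximal ideal of the localization of the integers of \<open>L\<close> at \<open>\<pp>\<close>; for
  \<open>y\<close> in the localization it also forces \<open>x\<close> to lie in the localization.
\<close>

definition cong_at ::
  "'k::field poly fract alg_closure set \<Rightarrow> 'k poly fract alg_closure set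
     \<Rightarrow> 'k poly fract alg_closure \<Rightarrow> 'k poly fract alg_closure \<Rightarrow> bool" where
  "cong_at L \<pp> x y \<longleftrightarrow> (\<exists>u\<in>\<pp>. \<exists>s\<in>integers L - \<pp>. x - y = u / s)"


section \<open>Finite separable elements\<close>

text \<open>
  Elements of \<open>gal L\<close> are extensional functions on \<open>L\<close>, so the group operation is
  \<^const>\<open>compose\<close> \<open>L\<close> and the argument of \<open>g\<close> below is the conjugate of \<open>\<tau>\<close> by \<open>\<sigma>\<close>.
\<close>

definition equivariant_maps ::
  "'a::field alg_closure set \<Rightarrow> (('a alg_closure \<Rightarrow> 'a alg_closure) \<Rightarrow> 'a alg_closure) set" where
  "equivariant_maps L = {g \<in> gal L \<rightarrow>\<^sub>E L. \<forall>\<sigma>\<in>gal L. \<forall>\<tau>\<in>gal L.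
     g (compose L (compose L \<sigma> \<tau>) (inv_into L \<sigma>)) = \<sigma> (g \<tau>)}"

text \<open>
  The entry at \<open>P\<close> is determined modulo \<open>P\<close> for all but finitely many \<open>P\<close>, and arbitrary at the
  remaining ones.
\<close>

definition ev ::
  "'k::{field,finite} poly fract alg_closure set
     \<Rightarrow> (('k poly fract alg_closure \<Rightarrow> 'k poly fract alg_closure) \<Rightarrow> 'k poly fract alg_closure)
     \<Rightarrow> 'k A\<^sub>K" where
  "ev L g = abs_A\<^sub>K (\<lambda>P. SOME a. \<forall>\<pp>. unramified_prime_over L P \<pp> \<longrightarrow>
     cong_at L \<pp> (g (frobenius L P \<pp>)) (of_R a))"

definition finite_separable_elements :: "'k::{field,finite} A\<^sub>K set" where
  "finite_separable_elements = (\<Union>L\<in>{L. finite_galois L}. ev L ` equivariant_maps L)"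

definition algebraic_elements :: "'k::field A\<^sub>K set" where
  "algebraic_elements = {\<alpha>. \<exists>f. f \<noteq> 0 \<and> poly (map_poly of_K f) \<alpha> = 0}"

definition separably_algebraic_elements :: "'k::field A\<^sub>K set" where
  "separably_algebraic_elements = {\<alpha>. \<exists>f. f \<noteq> 0 \<and>
     (\<exists>fs. f = prod_list fs \<and> (\<forall>h\<in>set fs. separable_poly h)) \<and> poly (map_poly of_K f) \<alpha> = 0}"

end

theory Submission
  imports Defs "Jordan_Normal_Form.Char_Poly" "HOL-Library.Discrete_Functions" "HOL-Library.Countable_Set"
begin

text \<open>
  Write \<open>Q = q\<^bsup>deg P\<^esup>\<close>. For a prime \<open>\<pp>\<close> of the integers of \<open>L\<close> over \<open>P\<close>, the sets of integers
  \<open>x\<close> with \<open>\<sigma> x \<equiv> x\<^sup>Q\<close> modulo \<open>\<pp>\<close>, for \<open>\<sigma>\<close> in the Galois group, are \<open>R\<close>-submodules that cover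
  everything. Since a vector space over a field with \<open>Q\<close> elements is not the union of at most \<open>Q\<close>
  proper subspaces, one of them is everything as soon as \<open>Q\<close> is at least the order of the group,
  and this \<open>\<sigma>\<close> is the Frobenius element. The same covering argument replaces the transitivity of
  the Galois group on the primes over \<open>P\<close>. Uniqueness of the Frobenius element and unramifiedness
  hold outside the divisors of finitely many nonzero elements of \<open>R\<close>.

  Sums and products of finite separable elements are computed in a common Galois extension, and an
  element \<open>ev L g\<close> is annihilated by the product of the minimal polynomials of the values of \<open>g\<close>.
  The inclusions are strict for the following reasons: the parity of \<open>deg P\<close> is an idempotent other
  than 0 and 1 that comes from the quadratic constant extension; there are only countably many
  finite separable elements, but uncountably many idempotents; the \<open>q\<close>-th root of \<open>\<theta>\<close> is not
  separable; and the powers of \<open>\<theta>\<close> with exponent the integer part of the square root of \<open>deg P\<close>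
  form a transcendental element.
\<close>

text \<open>Residue fields are never formed. A statement about them is read as a congruence modulo
  \<open>\<pp>\<close>, and \<open>\<pp>\<close> enters only through its closure properties; for
  instance, that the fixed points of the Q-th power map are the elements of R/(P) becomes the
  congruence of X^Q - X with the product of the X - b over the residues b. The definitions dictate
  what must be shown. \<open>frobenius\<close> is a definite description, so existence and
  uniqueness are both needed, and \<open>ev\<close> chooses one residue for all unramified primes
  over P at once, so the residue has to be independent of the prime. The obstructions are small
  degrees and nonzero elements of the integers of L (denominators, differences of conjugates), each
  of which divides a nonzero element of R; hence finitely many P are lost. The quadratic extension
  is generated by a root of x^2 - x - c because this form serves characteristic 2 as well. For the
  parity to differ from every element of K, both parities of deg P have to occur infinitely
  often.\<close>

hide_const (open) Polynomials.degree Polynomials.lead_coeff Divisibility.irreducible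

section \<open>Intermediate fields and their embeddings\<close>

text \<open>Since the closure is algebraic over the base field, every such subring is a subfield.\<close>

definition intermediate :: "'a::field alg_closure set \<Rightarrow> bool" where
  "intermediate F \<longleftrightarrow> range to_ac \<subseteq> F \<and> (\<forall>x\<in>F. \<forall>y\<in>F. x + y \<in> F \<and> x * y \<in> F)"

text \<open>Values outside F are arbitrary, so that an embedding of a field is also an embedding of
  every smaller one. Injectivity is automatic for homomorphisms of fields.\<close>

definition embedding_on :: "'a::field alg_closure set \<Rightarrow> ('a alg_closure \<Rightarrow> 'a alg_closure) \<Rightarrow> bool" where
  "embedding_on F \<sigma> \<longleftrightarrow> (\<forall>c. \<sigma> (to_ac c) = to_ac c) \<and>
     (\<forall>x\<in>F. \<forall>y\<in>F. \<sigma> (x + y) = \<sigma> x + \<sigma> y \<and> \<sigma> (x * y) = \<sigma> x * \<sigma> y)"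

definition polys_over :: "'a::zero set \<Rightarrow> 'a poly set" where
  "polys_over F = {p. \<forall>i. coeff p i \<in> F}"

lemma intermediateD:
  assumes "intermediate F"
  shows "to_ac c \<in> F" "0 \<in> F" "1 \<in> F" "x \<in> F \<Longrightarrow> y \<in> F \<Longrightarrow> x + y \<in> F"
    "x \<in> F \<Longrightarrow> y \<in> F \<Longrightarrow> x * y \<in> F" "x \<in> F \<Longrightarrow> - x \<in> F" "x \<in> F \<Longrightarrow> y \<in> F \<Longrightarrow> x - y \<in> F"
    "x \<in> F \<Longrightarrow> x ^ n \<in> F"
proof -
  show ac: "to_ac c \<in> F" for c using assms by (auto simp: intermediate_def)
  show "0 \<in> F" and one: "1 \<in> F" using ac[of 0] ac[of 1] by simp_all
  show plus: "x \<in> F \<Longrightarrow> y \<in> F \<Longrightarrow> x + y \<in> F" and times: "x \<in> F \<Longrightarrow> y \<in> F \<Longrightarrow> x * y \<in> F" for x y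
    using assms by (auto simp: intermediate_def)
  show minus: "x \<in> F \<Longrightarrow> - x \<in> F" for x
    using times[OF ac[of "-1"], of x] by simp
  show "x \<in> F \<Longrightarrow> y \<in> F \<Longrightarrow> x - y \<in> F"
    using plus[OF _ minus, of x y] by simp
  show "x \<in> F \<Longrightarrow> x ^ n \<in> F"
    by (induction n) (auto simp: one times)
qed

lemma intermediate_sum: "intermediate F \<Longrightarrow> (\<And>i. i \<in> I \<Longrightarrow> f i \<in> F) \<Longrightarrow> sum f I \<in> F"
  by (induction I rule: infinite_finite_induct) (auto intro: intermediateD)

lemma polys_overD: "p \<in> polys_over F \<Longrightarrow> coeff p i \<in> F"
  by (simp add: polys_over_def)

lemma poly_in_intermediate:
  assumes "intermediate F" "p \<in> polys_over F" "x \<in> F"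
  shows "poly p x \<in> F"
  unfolding poly_altdef using assms
  by (intro intermediate_sum intermediateD) (auto simp: polys_overD)

lemma map_poly_to_ac_in_polys_over: "intermediate F \<Longrightarrow> map_poly to_ac p \<in> polys_over F"
  by (auto simp: polys_over_def coeff_map_poly intermediateD)

lemma polys_over_closed:
  assumes "intermediate F"
  shows "0 \<in> polys_over F" "1 \<in> polys_over F"
    "p \<in> polys_over F \<Longrightarrow> r \<in> polys_over F \<Longrightarrow> p + r \<in> polys_over F"
    "p \<in> polys_over F \<Longrightarrow> r \<in> polys_over F \<Longrightarrow> p - r \<in> polys_over F"
    "p \<in> polys_over F \<Longrightarrow> r \<in> polys_over F \<Longrightarrow> p * r \<in> polys_over F"
    "c \<in> F \<Longrightarrow> monom c n \<in> polys_over F"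
    "c \<in> F \<Longrightarrow> p \<in> polys_over F \<Longrightarrow> pCons c p \<in> polys_over F"
    "c \<in> F \<Longrightarrow> p \<in> polys_over F \<Longrightarrow> Polynomial.smult c p \<in> polys_over F"
  using assms
  by (auto simp: polys_over_def coeff_mult coeff_pCons intermediateD split: nat.splits
      intro!: intermediate_sum)

lemma prod_linear_in_polys_over:
  assumes "intermediate F" "\<And>i. i \<in> I \<Longrightarrow> f i \<in> F"
  shows "(\<Prod>i\<in>I. [:- f i, 1:]) \<in> polys_over F"
  using assms(2)
  by (induction I rule: infinite_finite_induct)
     (auto intro!: polys_over_closed(2,5,7)[OF assms(1)] intermediateD[OF assms(1)] polys_over_closed(1)[OF assms(1)]
       simp del: mult_pCons_left)

text \<open>An annihilating polynomial is split as c + X * p. If c is not 0, then c + x * p(x) = 0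
  exhibits the inverse as a polynomial in x; if c = 0, the factor X cancels and p annihilates
  x.\<close>

lemma intermediate_inverse:
  assumes F: "intermediate F" and x: "x \<in> F"
  shows "inverse x \<in> F"
proof (cases "x = 0")
  case False
  obtain p :: "'a poly" where "p \<noteq> 0" "poly (map_poly to_ac p) x = 0"
    by (rule alg_closure_algebraic)
  then show ?thesis
  proof (induction p)
    case (pCons c p)
    let ?v = "poly (map_poly to_ac p) x"
    have v: "?v \<in> F"
      by (intro poly_in_intermediate F x map_poly_to_ac_in_polys_over)
    have e: "to_ac c + x * ?v = 0"
      using pCons.prems by (simp add: map_poly_pCons)
    show ?case
    proof (cases "c = 0")
      case True
      then have "?v = 0" using e False by simp
      moreover have "p \<noteq> 0" using pCons.hyps True by simp
      ultimately show ?thesis by (rule pCons.IH[rotated])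
    next
      case c: False
      have "x * (- (to_ac (inverse c) * ?v)) = to_ac (inverse c) * (- (x * ?v))"
        by (simp add: algebra_simps)
      also have "- (x * ?v) = to_ac c"
        using e by (metis add_eq_0_iff2)
      also have "to_ac (inverse c) * to_ac c = 1"
        using c by simp
      finally have "inverse x = - (to_ac (inverse c) * ?v)"
        by (rule inverse_unique)
      then show ?thesis
        using intermediateD[OF F] v by metis
    qed
  qed simp
qed (use assms in \<open>auto intro: intermediateD\<close>)

lemma embedding_onD:
  assumes "embedding_on F \<sigma>" "intermediate F"
  shows "\<sigma> (to_ac c) = to_ac c" "\<sigma> 0 = 0" "\<sigma> 1 = 1" "x \<in> F \<Longrightarrow> y \<in> F \<Longrightarrow> \<sigma> (x + y) = \<sigma> x + \<sigma> y"
    "x \<in> F \<Longrightarrow> y \<in> F \<Longrightarrow> \<sigma> (x * y) = \<sigma> x * \<sigma> y" "x \<in> F \<Longrightarrow> \<sigma> (- x) = - \<sigma> x"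
    "x \<in> F \<Longrightarrow> y \<in> F \<Longrightarrow> \<sigma> (x - y) = \<sigma> x - \<sigma> y" "x \<in> F \<Longrightarrow> \<sigma> (x ^ n) = \<sigma> x ^ n"
proof -
  show ac: "\<sigma> (to_ac c) = to_ac c" for c using assms by (auto simp: embedding_on_def)
  show "\<sigma> 0 = 0" and one: "\<sigma> 1 = 1" using ac[of 0] ac[of 1] by simp_all
  show plus: "x \<in> F \<Longrightarrow> y \<in> F \<Longrightarrow> \<sigma> (x + y) = \<sigma> x + \<sigma> y"
    and times: "x \<in> F \<Longrightarrow> y \<in> F \<Longrightarrow> \<sigma> (x * y) = \<sigma> x * \<sigma> y" for x y
    using assms by (auto simp: embedding_on_def)
  show minus: "x \<in> F \<Longrightarrow> \<sigma> (- x) = - \<sigma> x" for x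
    using times[OF intermediateD(1)[OF assms(2), of "-1"], of x] ac[of "-1"] by simp
  show "x \<in> F \<Longrightarrow> y \<in> F \<Longrightarrow> \<sigma> (x - y) = \<sigma> x - \<sigma> y"
    using plus[OF _ intermediateD(6)[OF assms(2)], of x y] minus[of y] by simp
  show "x \<in> F \<Longrightarrow> \<sigma> (x ^ n) = \<sigma> x ^ n"
    by (induction n) (auto simp: one times intermediateD[OF assms(2)])
qed

lemma embedding_on_subset: "embedding_on F \<sigma> \<Longrightarrow> E \<subseteq> F \<Longrightarrow> embedding_on E \<sigma>"
  by (auto simp: embedding_on_def)

lemma embedding_on_sum:
  assumes "embedding_on F \<sigma>" "intermediate F" "\<And>i. i \<in> I \<Longrightarrow> f i \<in> F"
  shows "\<sigma> (sum f I) = (\<Sum>i\<in>I. \<sigma> (f i))"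
  using assms(3)
  by (induction I rule: infinite_finite_induct)
     (auto simp: embedding_onD[OF assms(1,2)] intermediate_sum[OF assms(2)])

lemma embedding_on_inj:
  assumes "embedding_on F \<sigma>" "intermediate F"
  shows "inj_on \<sigma> F"
proof (rule inj_onI, rule ccontr)
  fix x y assume xy: "x \<in> F" "y \<in> F" "\<sigma> x = \<sigma> y" "x \<noteq> y"
  have "\<sigma> ((x - y) * inverse (x - y)) = \<sigma> (x - y) * \<sigma> (inverse (x - y))"
    using xy by (intro embedding_onD(5)[OF assms] intermediate_inverse[OF assms(2)] intermediateD(7)[OF assms(2)])
  also have "\<sigma> (x - y) = 0"
    using xy embedding_onD(7)[OF assms, of x y] by simp
  finally show False
    using xy embedding_onD(3)[OF assms] by simp
qed

lemma map_poly_embedding: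
  assumes "embedding_on F \<sigma>" "intermediate F" "p \<in> polys_over F" "r \<in> polys_over F"
  shows "map_poly \<sigma> (p + r) = map_poly \<sigma> p + map_poly \<sigma> r"
    "map_poly \<sigma> (p - r) = map_poly \<sigma> p - map_poly \<sigma> r"
    "map_poly \<sigma> (p * r) = map_poly \<sigma> p * map_poly \<sigma> r"
  using assms(3,4)
  by (auto intro!: poly_eqI simp: coeff_map_poly embedding_onD[OF assms(1,2)] polys_overD coeff_mult
      embedding_on_sum[OF assms(1,2)] intermediateD[OF assms(2)])

lemma map_poly_embedding_pCons:
  assumes "embedding_on F \<sigma>" "intermediate F"
  shows "map_poly \<sigma> (pCons c p) = pCons (\<sigma> c) (map_poly \<sigma> p)"
  by (rule poly_eqI) (simp add: coeff_map_poly coeff_pCons embedding_onD[OF assms] split: nat.split)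

lemma map_poly_embedding_prod_linear:
  assumes "embedding_on F \<sigma>" "intermediate F" "\<And>i. i \<in> I \<Longrightarrow> f i \<in> F"
  shows "map_poly \<sigma> (\<Prod>i\<in>I. [:- f i, 1:]) = (\<Prod>i\<in>I. [:- \<sigma> (f i), 1:])"
  using assms(3)
proof (induction I rule: infinite_finite_induct)
  case (insert i I)
  have "map_poly \<sigma> [:- f i, 1:] = [:- \<sigma> (f i), 1:]"
    using insert.prems by (simp add: map_poly_embedding_pCons[OF assms(1,2)] embedding_onD[OF assms(1,2)])
  moreover have "[:- f i, 1:] \<in> polys_over F" "(\<Prod>i\<in>I. [:- f i, 1:]) \<in> polys_over F"
    using insert.prems prod_linear_in_polys_over[OF assms(2), of "{i}" f]
      prod_linear_in_polys_over[OF assms(2), of I f] by auto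
  ultimately show ?case
    using insert by (simp add: map_poly_embedding(3)[OF assms(1,2)] del: mult_pCons_left)
qed (simp_all add: map_poly_1' embedding_onD[OF assms(1,2)])

lemma map_poly_embedding_to_ac:
  assumes "embedding_on F \<sigma>" "intermediate F"
  shows "map_poly \<sigma> (map_poly to_ac p) = map_poly to_ac p"
  by (rule poly_eqI) (simp add: coeff_map_poly embedding_onD[OF assms])

lemma embedding_on_poly:
  assumes "embedding_on F \<sigma>" "intermediate F" "p \<in> polys_over F" "x \<in> F"
  shows "\<sigma> (poly p x) = poly (map_poly \<sigma> p) (\<sigma> x)"
  using assms(3)
proof (induction p)
  case (pCons c p)
  have p: "p \<in> polys_over F" and c: "c \<in> F"
    using polys_overD[OF pCons.prems, of "Suc _"] polys_overD[OF pCons.prems, of 0]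
    by (auto simp: polys_over_def)
  show ?case
    using pCons.IH[OF p] c assms(4) poly_in_intermediate[OF assms(2) p assms(4)]
    by (simp add: map_poly_embedding_pCons[OF assms(1,2)] embedding_onD[OF assms(1,2)] intermediateD[OF assms(2)])
qed (simp add: embedding_onD[OF assms(1,2)])

lemma embedding_on_root:
  assumes "embedding_on F \<sigma>" "intermediate F" "x \<in> F" "poly (map_poly to_ac p) x = 0"
  shows "poly (map_poly to_ac p) (\<sigma> x) = 0"
  using embedding_on_poly[OF assms(1,2) map_poly_to_ac_in_polys_over[OF assms(2)] assms(3), of p]
    assms(4) by (simp add: map_poly_embedding_to_ac[OF assms(1,2)] embedding_onD[OF assms(1,2)])

section \<open>Division, minimal polynomials and simple extensions over F\<close>

lemma polys_over_division:
  assumes F: "intermediate F" and m: "m \<in> polys_over F" "lead_coeff m = 1"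
    and "p \<in> polys_over F"
  shows "\<exists>d\<in>polys_over F. \<exists>r\<in>polys_over F. p = m * d + r \<and> (r = 0 \<or> degree r < degree m)"
  using assms(4)
proof (induction "degree p" arbitrary: p rule: less_induct)
  case less
  note cl = polys_over_closed[OF F]
  show ?case
  proof (cases "p = 0 \<or> degree p < degree m")
    case True
    then show ?thesis using less.prems cl(1) by (intro bexI[of _ 0] bexI[of _ p]) auto
  next
    case False
    \<comment> \<open>Since m is monic, this multiple of m cancels the leading term of p without
      leaving F.\<close>
    define t where "t = monom (lead_coeff p) (degree p - degree m)"
    have t: "t \<in> polys_over F" unfolding t_def by (intro cl polys_overD less.prems)
    define p' where "p' = p - m * t"
    have p': "p' \<in> polys_over F" unfolding p'_def by (intro cl less.prems m t)
    have m0: "m \<noteq> 0" using m(2) by auto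
    have dt: "degree (m * t) = degree p"
      using False m0 by (auto simp: t_def degree_mult_eq degree_monom_eq)
    have lt: "coeff (m * t) (degree p) = lead_coeff p"
      using lead_coeff_mult[of m t] False m(2) by (simp add: dt) (simp add: t_def degree_monom_eq)
    show ?thesis
    proof (cases "p' = 0")
      case True
      then show ?thesis using t cl(1) by (intro bexI[of _ t] bexI[of _ 0]) (auto simp: p'_def)
    next
      case p'0: False
      have "degree p' \<le> degree p" unfolding p'_def using dt by (intro degree_diff_le) auto
      moreover have "coeff p' (degree p) = 0" using lt by (simp add: p'_def)
      ultimately have "degree p' < degree p"
        using p'0 by (metis le_neq_implies_less leading_coeff_0_iff)
      then obtain d r where dr: "d \<in> polys_over F" "r \<in> polys_over F" "p' = m * d + r"
        "r = 0 \<or> degree r < degree m" using less.hyps p' by blast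
      then have "p = m * (t + d) + r" by (simp add: p'_def algebra_simps)
      then show ?thesis using dr t cl(3) by blast
    qed
  qed
qed

text \<open>F is a set and not a type, so irreducibility over F is replaced by minimality of the
  degree among the polynomials with coefficients in F.\<close>

definition is_minpoly :: "'a::field alg_closure set \<Rightarrow> 'a alg_closure \<Rightarrow> 'a alg_closure poly \<Rightarrow> bool" where
  "is_minpoly F a m \<longleftrightarrow> m \<in> polys_over F \<and> lead_coeff m = 1 \<and> poly m a = 0 \<and>
     (\<forall>p\<in>polys_over F. p \<noteq> 0 \<longrightarrow> poly p a = 0 \<longrightarrow> degree m \<le> degree p)"

lemma minpoly_exists:
  assumes F: "intermediate F"
  shows "\<exists>m. is_minpoly F a m"
proof -
  define S where "S = {p \<in> polys_over F. p \<noteq> 0 \<and> poly p a = 0}"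
  obtain p :: "'a poly" where "p \<noteq> 0" "poly (map_poly to_ac p) a = 0"
    by (rule alg_closure_algebraic)
  then have "map_poly to_ac p \<in> S"
    using F by (auto simp: S_def map_poly_to_ac_in_polys_over map_poly_eq_0_iff)
  then obtain m where m: "m \<in> S" "\<And>p. p \<in> S \<Longrightarrow> degree m \<le> degree p"
    using ex_has_least_nat[of "\<lambda>p. p \<in> S" _ degree] by blast
  have "is_minpoly F a (Polynomial.smult (inverse (lead_coeff m)) m)"
    unfolding is_minpoly_def using m
    by (auto simp: S_def intro!: polys_over_closed[OF F] intermediate_inverse[OF F] polys_overD)
  then show ?thesis ..
qed

lemma minpoly_dvd:
  assumes F: "intermediate F" and m: "is_minpoly F a m" and p: "p \<in> polys_over F" "poly p a = 0"
  shows "\<exists>d\<in>polys_over F. p = m * d"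
proof -
  obtain d r where dr: "d \<in> polys_over F" "r \<in> polys_over F" "p = m * d + r"
    "r = 0 \<or> degree r < degree m"
    using polys_over_division[OF F _ _ p(1), of m] m by (auto simp: is_minpoly_def)
  have "poly r a = 0" using dr(3) p(2) m by (simp add: is_minpoly_def)
  then have "r = 0" using dr m unfolding is_minpoly_def by (metis not_less)
  then show ?thesis using dr by auto
qed

lemma minpoly_degree_pos: "is_minpoly F a m \<Longrightarrow> degree m > 0"
  unfolding is_minpoly_def by (cases "degree m") (auto elim: degree_eq_zeroE)

definition adjoin :: "'a::field alg_closure set \<Rightarrow> 'a alg_closure \<Rightarrow> 'a alg_closure set" where
  "adjoin F a = {poly p a | p. p \<in> polys_over F}"

lemma adjoin_intermediate:
  assumes F: "intermediate F"
  shows "intermediate (adjoin F a)" "F \<subseteq> adjoin F a" "a \<in> adjoin F a"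
proof -
  note cl = polys_over_closed[OF F]
  show sub: "F \<subseteq> adjoin F a"
  proof
    fix c assume "c \<in> F"
    then show "c \<in> adjoin F a"
      using cl(7)[OF _ cl(1)] by (auto simp: adjoin_def intro!: exI[of _ "[:c:]"])
  qed
  show "a \<in> adjoin F a"
    using cl(7)[OF intermediateD(2)[OF F] cl(2)]
    by (auto simp: adjoin_def intro!: exI[of _ "pCons 0 1"])
  show "intermediate (adjoin F a)"
    unfolding intermediate_def
  proof (intro conjI ballI)
    show "range to_ac \<subseteq> adjoin F a" using sub F by (auto simp: intermediate_def)
    fix x y assume "x \<in> adjoin F a" "y \<in> adjoin F a"
    then obtain p r where pr: "p \<in> polys_over F" "r \<in> polys_over F" "x = poly p a" "y = poly r a"
      by (auto simp: adjoin_def)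
    show "x + y \<in> adjoin F a" using pr cl(3)[of p r] unfolding adjoin_def
      by (metis (mono_tags, lifting) mem_Collect_eq poly_add)
    show "x * y \<in> adjoin F a" using pr cl(5)[of p r] unfolding adjoin_def
      by (metis (mono_tags, lifting) mem_Collect_eq poly_mult)
  qed
qed

lemma adjoin_subset:
  assumes "intermediate E" "F \<subseteq> E" "a \<in> E"
  shows "adjoin F a \<subseteq> E"
  using assms by (auto simp: adjoin_def polys_over_def subset_eq intro!: poly_in_intermediate)

text \<open>Two polynomials with the same value at a differ by a multiple of m, and the image of m
  vanishes at b; hence the value at b of the image polynomial depends on the element alone. The
  formula for \<open>\<sigma>'\<close> is kept in the conclusion because it later decides whether a
  given element is moved.\<close>

lemma embedding_adjoin:
  assumes F: "intermediate F" and s: "embedding_on F \<sigma>" and m: "is_minpoly F a m"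
    and b: "poly (map_poly \<sigma> m) b = 0"
  shows "\<exists>\<sigma>'. embedding_on (adjoin F a) \<sigma>' \<and> (\<forall>x\<in>F. \<sigma>' x = \<sigma> x) \<and>
           (\<forall>p\<in>polys_over F. \<sigma>' (poly p a) = poly (map_poly \<sigma> p) b)"
proof -
  note cl = polys_over_closed[OF F]
  define \<sigma>' where "\<sigma>' y = poly (map_poly \<sigma> (SOME p. p \<in> polys_over F \<and> poly p a = y)) b" for y
  have key: "\<sigma>' (poly p a) = poly (map_poly \<sigma> p) b" if p: "p \<in> polys_over F" for p
  proof -
    define r where "r = (SOME r. r \<in> polys_over F \<and> poly r a = poly p a)"
    have r: "r \<in> polys_over F \<and> poly r a = poly p a"
      unfolding r_def by (rule someI[of _ p]) (use p in auto)
    have "\<exists>d\<in>polys_over F. p - r = m * d"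
      using r by (intro minpoly_dvd[OF F m] cl p) auto
    then obtain d where d: "d \<in> polys_over F" "p - r = m * d" by blast
    have "map_poly \<sigma> p - map_poly \<sigma> r = map_poly \<sigma> m * map_poly \<sigma> d"
      using map_poly_embedding(2)[OF s F p, of r] map_poly_embedding(3)[OF s F _ d(1), of m] r d m
      by (simp add: is_minpoly_def)
    then have "poly (map_poly \<sigma> p) b - poly (map_poly \<sigma> r) b = 0"
      using b by (metis mult_zero_left poly_diff poly_mult)
    then show ?thesis by (simp add: \<sigma>'_def r_def)
  qed
  have const: "\<sigma>' c = \<sigma> c" if "c \<in> F" for c
    using key[OF cl(7)[OF that cl(1)]] by (simp add: map_poly_embedding_pCons[OF s F])
  have "embedding_on (adjoin F a) \<sigma>'"
    unfolding embedding_on_def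
  proof (intro conjI allI ballI)
    show "\<sigma>' (to_ac c) = to_ac c" for c
      using const[OF intermediateD(1)[OF F]] by (simp add: embedding_onD[OF s F])
    fix x y assume "x \<in> adjoin F a" "y \<in> adjoin F a"
    then obtain p r where pr: "p \<in> polys_over F" "r \<in> polys_over F" "x = poly p a" "y = poly r a"
      by (auto simp: adjoin_def)
    show "\<sigma>' (x + y) = \<sigma>' x + \<sigma>' y"
      using key[OF cl(3)[OF pr(1,2)]] pr by (simp add: key map_poly_embedding[OF s F])
    show "\<sigma>' (x * y) = \<sigma>' x * \<sigma>' y"
      using key[OF cl(5)[OF pr(1,2)]] pr by (simp add: key map_poly_embedding[OF s F])
  qed
  then show ?thesis using const key by blast
qed

text \<open>The elements of B are adjoined one after the other, each being sent to some root of the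
  image of its minimal polynomial.\<close>

lemma embedding_extends:
  assumes "finite B" "intermediate F" "embedding_on F \<sigma>"
  shows "\<exists>E \<sigma>'. intermediate E \<and> F \<union> B \<subseteq> E \<and> embedding_on E \<sigma>' \<and> (\<forall>x\<in>F. \<sigma>' x = \<sigma> x)"
  using assms(1)
proof induction
  case empty
  then show ?case using assms by auto
next
  case (insert a B)
  then obtain E \<tau> where E: "intermediate E" "F \<union> B \<subseteq> E" "embedding_on E \<tau>" "\<forall>x\<in>F. \<tau> x = \<sigma> x"
    by blast
  obtain m where m: "is_minpoly E a m" using minpoly_exists[OF E(1)] by blast
  \<comment> \<open>Mapping coefficients could lower the degree; the surviving leading coefficient 1
    excludes this and so guarantees a root.\<close>
  have "coeff (map_poly \<tau> m) (degree m) = 1"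
    using m by (simp add: coeff_map_poly embedding_onD[OF E(3,1)] is_minpoly_def)
  then have "degree (map_poly \<tau> m) \<ge> degree m"
    by (intro le_degree) simp
  then have "degree (map_poly \<tau> m) > 0" using minpoly_degree_pos[OF m] by simp
  then obtain b where "poly (map_poly \<tau> m) b = 0"
    using alg_closed_imp_poly_has_root by blast
  from embedding_adjoin[OF E(1,3) m this] obtain \<sigma>'
    where "embedding_on (adjoin E a) \<sigma>'" "\<forall>x\<in>E. \<sigma>' x = \<tau> x" by blast
  moreover have "intermediate (adjoin E a)" "E \<subseteq> adjoin E a" "a \<in> adjoin E a"
    using adjoin_intermediate[OF E(1)] by auto
  ultimately show ?case using E
    by (intro exI[of _ "adjoin E a"] exI[of _ \<sigma>']) auto
qed

text \<open>The polynomial splits into linear factors, and a factor occurring twice would give a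
  root of order at least 2; hence factors and roots correspond one to one.\<close>

lemma rsquarefree_card_roots:
  fixes p :: "'a::alg_closed_field poly"
  assumes "rsquarefree p"
  shows "card {x. poly p x = 0} = degree p"
proof -
  have p0: "p \<noteq> 0" using assms by (simp add: rsquarefree_def)
  obtain A where A: "size A = degree p" "p = Polynomial.smult (lead_coeff p) (\<Prod>x\<in>#A. [:-x, 1:])"
    using alg_closed_imp_factorization[OF p0] by blast
  have "count A x \<le> 1" for x
  proof (rule ccontr)
    assume c: "\<not> count A x \<le> 1"
    then have "x \<in># A" by (auto simp flip: count_greater_zero_iff)
    then obtain B1 where B1: "A = add_mset x B1" by (rule mset_add)
    then have "x \<in># B1" using c by (auto simp flip: count_greater_zero_iff)
    then obtain B where "B1 = add_mset x B" by (rule mset_add)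
    then have B: "A = add_mset x (add_mset x B)" using B1 by simp
    have "p = [:-x, 1:] ^ 2 * Polynomial.smult (lead_coeff p) (\<Prod>x\<in>#B. [:-x, 1:])"
      by (subst A(2)) (simp add: B power2_eq_square mult.assoc del: mult_pCons_left mult_pCons_right)
    then have "[:-x, 1:] ^ 2 dvd p" by (rule dvdI)
    then have "order x p \<ge> 2" using p0 by (simp add: order_divides)
    then show False using assms by (auto simp: rsquarefree_def dest: spec[of _ x])
  qed
  then have "size A = card (set_mset A)"
    unfolding size_multiset_overloaded_eq card_eq_sum
    by (intro sum.cong refl) (simp add: le_antisym Suc_leI)
  moreover have "poly p x = 0 \<longleftrightarrow> x \<in># A" for x
    using p0 by (subst A(2)) (auto simp: poly_prod_mset prod_mset_zero_iff)
  ultimately show ?thesis using A(1) by auto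
qed

lemma rsquarefree_dvd:
  assumes "rsquarefree p" "r dvd p"
  shows "rsquarefree r"
proof -
  have "r \<noteq> 0" using assms by (auto simp: rsquarefree_def)
  moreover have "order a r = 0 \<or> order a r = 1" for a
    using dvd_imp_order_le[OF _ assms(2), of a] assms(1)
    by (auto simp: rsquarefree_def dest!: spec[of _ a])
  ultimately show ?thesis by (simp add: rsquarefree_def)
qed

lemma rsquarefree_prod_linear:
  fixes S :: "'a::idom set"
  assumes "finite S"
  shows "rsquarefree (\<Prod>y\<in>S. [:- y, 1:])"
proof -
  have "order a (\<Prod>y\<in>S. [:- y, 1:]) \<le> 1" for a
    using assms
  proof induction
    case (insert y S)
    have nz: "[:-y, 1:] * (\<Prod>y\<in>S. [:- y, 1:]) \<noteq> 0"
      using insert.hyps(1) by (simp add: prod_zero_iff del: mult_pCons_left)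
    have "order y (\<Prod>y\<in>S. [:- y, 1:]) = 0"
      using insert.hyps by (intro order_0I) (auto simp: poly_prod prod_zero_iff)
    moreover have "order a [:-y, 1:] = (if a = y then 1 else 0)"
      using order_power_n_n[of a 1] by (auto intro!: order_0I)
    ultimately show ?case
      using insert by (simp add: order_mult[OF nz] del: mult_pCons_left)
  qed simp
  moreover have "(\<Prod>y\<in>S. [:- y, 1:]) \<noteq> 0"
    using assms by (auto simp: prod_zero_iff)
  ultimately show ?thesis
    by (auto simp: rsquarefree_def le_Suc_eq)
qed

section \<open>Finitely generated intermediate fields\<close>

interpretation to_ac: field_hom "to_ac :: 'a::field \<Rightarrow> 'a alg_closure"
  by unfold_locales auto

interpretation map_to_ac: map_poly_inj_idom_hom "to_ac :: 'a::field \<Rightarrow> 'a alg_closure"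
  by unfold_locales

definition gen :: "'a::field alg_closure set \<Rightarrow> 'a alg_closure set" where
  "gen A = \<Inter>{F. intermediate F \<and> A \<subseteq> F}"

lemma gen_intermediate: "intermediate (gen A)"
  by (auto simp: gen_def intermediate_def)

lemma gen_superset: "A \<subseteq> gen A"
  by (auto simp: gen_def)

lemma gen_least: "intermediate F \<Longrightarrow> A \<subseteq> F \<Longrightarrow> gen A \<subseteq> F"
  by (auto simp: gen_def)

lemma gen_mono: "A \<subseteq> B \<Longrightarrow> gen A \<subseteq> gen B"
  by (auto simp: gen_def)

lemma intermediate_range: "intermediate (range to_ac)"
  by (auto simp: intermediate_def simp flip: to_ac_add to_ac_mult)

lemma gen_empty: "gen {} = range to_ac"
  using gen_least[OF intermediate_range, of "{}"] intermediateD(1)[OF gen_intermediate] by auto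

lemma gen_insert: "gen (insert a A) = adjoin (gen A) a"
proof
  show "gen (insert a A) \<subseteq> adjoin (gen A) a"
    using adjoin_intermediate[OF gen_intermediate[of A], of a] gen_superset[of A]
    by (intro gen_least) auto
  show "adjoin (gen A) a \<subseteq> gen (insert a A)"
    using gen_superset[of "insert a A"]
    by (intro adjoin_subset gen_intermediate gen_mono) auto
qed

section \<open>Translation to and from algebraic structures with carriers\<close>

lemma ring_of_type_algebra_simps [simp]:
  "carrier ring_of_type_algebra = UNIV" "x \<otimes>\<^bsub>ring_of_type_algebra\<^esub> y = x * y"
  "x \<oplus>\<^bsub>ring_of_type_algebra\<^esub> y = x + y" "\<one>\<^bsub>ring_of_type_algebra\<^esub> = 1" "\<zero>\<^bsub>ring_of_type_algebra\<^esub> = 0"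
  by (simp_all add: ring_of_type_algebra_def)

lemma a_inv_type_algebra [simp]:
  "\<ominus>\<^bsub>ring_of_type_algebra\<^esub> x = - (x :: 'a::comm_ring_1)"
proof -
  interpret ring "ring_of_type_algebra :: 'a ring" by (rule ring_from_type_algebra)
  show ?thesis by (rule minus_equality) simp_all
qed

lemma subring_type_algebraI:
  fixes F :: "'a::comm_ring_1 set"
  assumes "1 \<in> F" "\<And>x. x \<in> F \<Longrightarrow> - x \<in> F" "\<And>x y. x \<in> F \<Longrightarrow> y \<in> F \<Longrightarrow> x * y \<in> F"
    "\<And>x y. x \<in> F \<Longrightarrow> y \<in> F \<Longrightarrow> x + y \<in> F"
  shows "subring F ring_of_type_algebra"
proof -
  interpret ring "ring_of_type_algebra :: 'a ring" by (rule ring_from_type_algebra)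
  show ?thesis by (rule subringI) (use assms in auto)
qed

lemma intermediate_iff_subfield:
  "intermediate F \<longleftrightarrow> subfield F ring_of_type_algebra \<and> range to_ac \<subseteq> F"
proof -
  interpret field "ring_of_type_algebra :: 'a alg_closure ring" by (rule field_from_type_algebra)
  show ?thesis
  proof
    assume F: "intermediate F"
    have "subring F ring_of_type_algebra"
      by (intro subring_type_algebraI intermediateD[OF F])
    then have "subfield F ring_of_type_algebra"
    proof (rule subfieldI')
      fix k assume k: "k \<in> F - {\<zero>\<^bsub>ring_of_type_algebra\<^esub>}"
      have "inv\<^bsub>ring_of_type_algebra\<^esub> k = inverse k"
        using k by (intro comm_inv_char) auto
      then show "inv\<^bsub>ring_of_type_algebra\<^esub> k \<in> F"
        using k intermediate_inverse[OF F] by auto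
    qed
    then show "subfield F ring_of_type_algebra \<and> range to_ac \<subseteq> F"
      using F by (simp add: intermediate_def)
  next
    assume F: "subfield F ring_of_type_algebra \<and> range to_ac \<subseteq> F"
    then have "subring F ring_of_type_algebra" using subfieldE(1) by blast
    then show "intermediate F"
      using subringE(6,7)[of F ring_of_type_algebra] F by (auto simp: intermediate_def)
  qed
qed

lemma algebraic_over_range:
  fixes x :: "'a::field alg_closure"
  shows "(ring.algebraic ring_of_type_algebra over range to_ac) x"
proof -
  interpret field "ring_of_type_algebra :: 'a alg_closure ring" by (rule field_from_type_algebra)
  obtain p :: "'a poly" where p: "p \<noteq> 0" "poly (map_poly to_ac p) x = 0"
    by (rule alg_closure_algebraic)
  \<comment> \<open>Polynomials over a carrier are lists with the leading coefficient first, hence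
    the reversal.\<close>
  define ps where "ps = rev (coeffs (map_poly to_ac p))"
  have np: "x [^]\<^bsub>ring_of_type_algebra\<^esub> n = x ^ n" for n :: nat
    by (induction n) (auto simp: mult.commute)
  have ev: "ring.eval ring_of_type_algebra xs x = poly (Poly (rev xs)) x" for xs
    by (induction xs) (auto simp: Poly_append poly_monom np)
  have "set ps \<subseteq> range to_ac"
    by (auto simp: ps_def coeffs_def coeff_map_poly split: if_splits)
  moreover have "ps \<noteq> [] \<and> hd ps \<noteq> 0"
    using p(1) last_coeffs_eq_coeff_degree[OF p(1)] by (auto simp: ps_def hd_rev last_map)
  moreover have "Poly (rev ps) = map_poly to_ac p"
    unfolding ps_def rev_rev_ident Poly_coeffs ..
  ultimately show ?thesis
    using p(2) by (intro algebraicI[of ps]) (auto simp: ev univ_poly_def polynomial_def)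
qed

text \<open>\<open>gen A\<close> is identified with an iterated simple extension, whose dimension is
  finite because its generators are algebraic.\<close>

lemma gen_finite_dimension:
  assumes "finite A"
  shows "ring.finite_dimension ring_of_type_algebra (range to_ac) (gen A)"
proof -
  interpret field "ring_of_type_algebra :: 'a alg_closure ring" by (rule field_from_type_algebra)
  obtain xs where xs: "set xs = A" using finite_list[OF assms] by blast
  have K: "subfield (range to_ac) ring_of_type_algebra"
    using intermediate_range intermediate_iff_subfield by blast
  have fd: "finite_dimension (range to_ac) (finite_extension (range to_ac) xs)"
    using finite_extension_finite_dimension(1)[OF K, of xs] algebraic_over_range by auto
  have "intermediate (finite_extension (range to_ac) xs)"
    using finite_extension_is_subfield[OF K, of xs] algebraic_over_range
      finite_extension_incl[of "range to_ac" xs]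
    by (auto simp: intermediate_iff_subfield)
  then have "gen A \<subseteq> finite_extension (range to_ac) xs"
    using finite_extension_mem[OF subfieldE(1)[OF K], of xs] xs by (intro gen_least) auto
  moreover have "finite_extension (range to_ac) xs \<subseteq> gen A"
    using gen_intermediate[of A] gen_superset[of A] xs
    by (intro finite_extension_subring_incl) (auto simp: intermediate_iff_subfield dest: subfieldE(1))
  ultimately show ?thesis using fd by (metis subset_antisym)
qed

lemma finite_galois_intermediate: "finite_galois L \<Longrightarrow> intermediate L"
  by (simp add: finite_galois_def intermediate_iff_subfield)

text \<open>A finite spanning list of L over the base field generates L; the later arguments use
  finite dimension only in this form.\<close>

lemma finite_galois_generators:
  assumes "finite_galois L"
  obtains A where "finite A" "L = gen A"
proof -
  interpret field "ring_of_type_algebra :: 'a alg_closure ring" by (rule field_from_type_algebra)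
  have K: "subfield (range to_ac) (ring_of_type_algebra :: 'a alg_closure ring)"
    using intermediate_range intermediate_iff_subfield by blast
  have "finite_dimension (range to_ac) L" using assms by (simp add: finite_galois_def)
  then obtain Us where Us: "Span (range to_ac) Us = L"
    using exists_base[OF K] by (metis finite_dimensionE')
  have L: "intermediate L" using finite_galois_intermediate[OF assms] .
  have "set Us \<subseteq> L" using Span_base_incl[OF K, of Us] Us by simp
  moreover have "L \<subseteq> gen (set Us)"
    unfolding Us[symmetric]
  proof (rule Span_min[OF K])
    have "subring (gen (set Us)) ring_of_type_algebra"
      using gen_intermediate[of "set Us"] subfieldE(1) by (auto simp: intermediate_iff_subfield)
    then show "subgroup (gen (set Us)) (add_monoid ring_of_type_algebra)"
      by (rule subring.axioms(1))
    show "range to_ac <#>\<^bsub>ring_of_type_algebra\<^esub> set Us \<subseteq> gen (set Us)"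
      using gen_superset[of "set Us"]
      by (auto simp: set_mult_def intro!: intermediateD[OF gen_intermediate])
  qed simp
  ultimately have "L = gen (set Us)" using gen_least[OF L] by blast
  then show ?thesis using that by blast
qed

lemma polys_over_range: "p \<in> polys_over (range to_ac) \<Longrightarrow> \<exists>r. p = map_poly to_ac r"
  by (intro exI[of _ "map_poly of_ac p"] poly_eqI)
     (simp add: coeff_map_poly to_ac_of_ac polys_overD)

text \<open>Connects minimality of the degree, a notion for the set \<open>range to_ac\<close>, with
  irreducibility over the type of the base field, to which \<open>finite_galois\<close> refers: a
  proper factorization would give a polynomial of smaller degree vanishing at x.\<close>

lemma minpoly_range_irreducible:
  obtains f where "irreducible f" "is_minpoly (range to_ac) x (map_poly to_ac f)"
proof -
  obtain m where m: "is_minpoly (range to_ac) x m" using minpoly_exists[OF intermediate_range] by blast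
  then obtain f where f: "m = map_poly to_ac f"
    using polys_over_range by (auto simp: is_minpoly_def)
  have degf: "degree m = degree f" by (simp add: f)
  have "irreducible f"
  proof (rule irreducibleI)
    show "f \<noteq> 0" using m f by (auto simp: is_minpoly_def)
    then show "\<not> f dvd 1" using minpoly_degree_pos[OF m] degf by (simp add: is_unit_iff_degree)
    fix a b assume ab: "f = a * b"
    then have nz: "a \<noteq> 0" "b \<noteq> 0" using \<open>f \<noteq> 0\<close> by auto
    have deg: "degree f = degree a + degree b" using ab nz by (simp add: degree_mult_eq)
    have "poly (map_poly to_ac a) x = 0 \<or> poly (map_poly to_ac b) x = 0"
      using m f ab by (auto simp: is_minpoly_def hom_distribs)
    moreover have "degree m \<le> degree r" if "poly (map_poly to_ac r) x = 0" "r \<noteq> 0" for r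
      using m that map_poly_to_ac_in_polys_over[OF intermediate_range, of r]
      unfolding is_minpoly_def by fastforce
    ultimately have "degree m \<le> degree a \<or> degree m \<le> degree b" using nz by blast
    then have "degree a = 0 \<or> degree b = 0" using deg degf by linarith
    then show "a dvd 1 \<or> b dvd 1" using nz by (simp add: is_unit_iff_degree)
  qed
  then show ?thesis using that m f by blast
qed

lemma irreducible_root_minpoly:
  assumes f: "irreducible f" "poly (map_poly to_ac f) x = 0" and m: "is_minpoly (range to_ac) x m"
  shows "\<exists>c. c \<noteq> 0 \<and> map_poly to_ac f = Polynomial.smult c m"
proof -
  obtain d where d: "d \<in> polys_over (range to_ac)" "map_poly to_ac f = m * d"
    using minpoly_dvd[OF intermediate_range m _ f(2)]
      map_poly_to_ac_in_polys_over[OF intermediate_range] by blast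
  obtain m' d' where m': "m = map_poly to_ac m'" "d = map_poly to_ac d'"
    using polys_over_range[OF d(1)] polys_over_range[of m] m by (auto simp: is_minpoly_def)
  have fd: "f = m' * d'"
    using d(2) by (simp add: m' flip: map_to_ac.hom_mult)
  have "degree m' > 0" using minpoly_degree_pos[OF m] by (simp add: m')
  then have "\<not> m' dvd 1" by (metis is_unit_iff_degree degree_0 less_irrefl)
  then have "d' dvd 1" using f(1) fd by (auto dest: irreducibleD)
  then obtain c where "d' = [:c:]" "c \<noteq> 0"
    by (metis is_unit_poly_iff dvd_0_left zero_neq_one)
  then have "map_poly to_ac f = Polynomial.smult (to_ac c) m" "to_ac c \<noteq> 0"
    using d(2) by (simp_all add: m' map_poly_pCons)
  then show ?thesis by blast
qed

text \<open>If \<open>z\<close> lies in \<open>F[a]\<close> but not in \<open>F\<close>, write \<open>z = h(a)\<close> with \<open>deg h\<close> less than the degree \<open>n\<close> of \<open>a\<close>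
  over \<open>F\<close>: if all embeddings over \<open>F\<close> fixed \<open>z\<close>, then \<open>h - z\<close> would vanish at the \<open>n\<close> conjugates of \<open>a\<close>.\<close>

lemma separable_generated_moved:
  assumes "finite A" "\<And>a. a \<in> A \<Longrightarrow> \<exists>f. separable_poly f \<and> poly (map_poly to_ac f) a = 0"
    and "z \<in> gen A" "z \<notin> range to_ac" "finite B"
  shows "\<exists>E \<sigma>. intermediate E \<and> gen A \<union> B \<subseteq> E \<and> embedding_on E \<sigma> \<and> \<sigma> z \<noteq> z"
  using assms
proof (induction arbitrary: B)
  case empty
  then show ?case by (simp add: gen_empty)
next
  case (insert a A)
  define F where "F = gen A"
  have F: "intermediate F" unfolding F_def by (rule gen_intermediate)
  show ?case
  proof (cases "z \<in> F")
    case True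
    \<comment> \<open>Requiring E to contain a as well makes it contain the field generated by
      \<open>insert a A\<close>.\<close>
    have "\<exists>E \<sigma>. intermediate E \<and> gen A \<union> insert a B \<subseteq> E \<and> embedding_on E \<sigma> \<and> \<sigma> z \<noteq> z"
      using insert.prems True by (intro insert.IH) (auto simp: F_def)
    then obtain E \<sigma> where E: "intermediate E" "gen A \<union> insert a B \<subseteq> E" "embedding_on E \<sigma>" "\<sigma> z \<noteq> z"
      by blast
    have "gen (insert a A) \<subseteq> E"
      using E(2) gen_superset[of A] by (intro gen_least[OF E(1)]) auto
    then show ?thesis using E by blast
  next
    case zF: False
    obtain m where m: "is_minpoly F a m" using minpoly_exists[OF F] by blast
    obtain f where f: "separable_poly f" "poly (map_poly to_ac f) a = 0"
      using insert.prems(1)[of a] by auto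
    have "m dvd map_poly to_ac f"
      using minpoly_dvd[OF F m map_poly_to_ac_in_polys_over[OF F] f(2)] by auto
    then have "rsquarefree m"
      using f(1) unfolding separable_poly_def by (rule rsquarefree_dvd[rotated])
    then have card: "card {x. poly m x = 0} = degree m" by (rule rsquarefree_card_roots)
    obtain h0 where h0: "h0 \<in> polys_over F" "z = poly h0 a"
      using insert.prems(2) unfolding gen_insert F_def adjoin_def by auto
    obtain d h where h: "h \<in> polys_over F" "h0 = m * d + h" "h = 0 \<or> degree h < degree m"
      using polys_over_division[OF F _ _ h0(1), of m] m by (auto simp: is_minpoly_def)
    have zh: "z = poly h a" using h0(2) h(2) m by (simp add: is_minpoly_def)
    have "\<exists>b. poly m b = 0 \<and> poly h b \<noteq> z"
    proof (rule ccontr)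
      assume neg: "\<nexists>b. poly m b = 0 \<and> poly h b \<noteq> z"
      have "h - [:z:] = 0"
      proof (rule ccontr)
        assume nz: "h - [:z:] \<noteq> 0"
        have "card {x. poly m x = 0} \<le> card {x. poly (h - [:z:]) x = 0}"
          using neg poly_roots_finite[OF nz] by (intro card_mono) auto
        also have "\<dots> \<le> degree (h - [:z:])"
          by (rule card_poly_roots_bound[OF nz])
        also have "\<dots> < degree m"
          using h(3) minpoly_degree_pos[OF m] by (intro degree_diff_less) auto
        finally show False using card by simp
      qed
      then have "coeff h 0 = z" by simp
      then show False using h(1) zF by (auto simp: polys_over_def)
    qed
    then obtain b where b: "poly m b = 0" "poly h b \<noteq> z" by blast
    have id: "embedding_on F id" by (auto simp: embedding_on_def)
    obtain \<sigma> where s: "embedding_on (adjoin F a) \<sigma>" "\<forall>p\<in>polys_over F. \<sigma> (poly p a) = poly (map_poly id p) b"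
      using embedding_adjoin[OF F id m, of b] b by auto
    have "\<sigma> z = poly h b"
      using bspec[OF s(2) h(1)] zh by simp
    then have neq: "\<sigma> z \<noteq> z" using b by simp
    have gi: "adjoin F a = gen (insert a A)" by (simp add: gen_insert F_def)
    obtain E \<tau> where E: "intermediate E" "adjoin F a \<union> B \<subseteq> E" "embedding_on E \<tau>" "\<forall>x\<in>adjoin F a. \<tau> x = \<sigma> x"
      using embedding_extends[OF insert.prems(4) adjoin_intermediate(1)[OF F] s(1)] by blast
    then have "\<tau> z \<noteq> z" using neq insert.prems(2) gi by auto
    then show ?thesis using E gi by auto
  qed
qed

text \<open>The elements of \<open>gen A\<close> whose image stays inside form an intermediate ring
  that contains A.\<close>

lemma embedding_image_in_gen:
  assumes "embedding_on (gen A) \<tau>" "\<tau> ` A \<subseteq> gen A"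
  shows "\<tau> ` gen A \<subseteq> gen A"
proof -
  note g = gen_intermediate[of A]
  have "intermediate {x \<in> gen A. \<tau> x \<in> gen A}"
    by (auto simp: intermediate_def embedding_onD[OF assms(1) g] intermediateD[OF g])
  then have "gen A \<subseteq> {x \<in> gen A. \<tau> x \<in> gen A}"
    using assms(2) gen_superset[of A] by (intro gen_least) auto
  then show ?thesis by auto
qed

text \<open>The orbit of z under the embeddings of \<open>gen A\<close> into itself is finite, and
  the product of the X - y over it has coefficients fixed by all of them, hence in the base field.
  An irreducible f vanishing at z divides this product, so f is separable and its roots lie in
  \<open>gen A\<close>.\<close>

theorem finite_galois_gen:
  assumes "finite A"
    and sep: "\<And>a. a \<in> A \<Longrightarrow> \<exists>f. separable_poly f \<and> poly (map_poly to_ac f) a = 0 \<and>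
                 {x. poly (map_poly to_ac f) x = 0} \<subseteq> A"
  shows "finite_galois (gen A)"
proof -
  let ?M = "gen A"
  have M: "intermediate ?M" by (rule gen_intermediate)
  have img: "\<tau> ` ?M \<subseteq> ?M" if t: "embedding_on ?M \<tau>" for \<tau>
  proof (rule embedding_image_in_gen[OF t])
    show "\<tau> ` A \<subseteq> ?M"
    proof
      fix y assume "y \<in> \<tau> ` A"
      then obtain a where a: "a \<in> A" "y = \<tau> a" by blast
      obtain f where "poly (map_poly to_ac f) a = 0" "{x. poly (map_poly to_ac f) x = 0} \<subseteq> A"
        using sep[OF a(1)] by blast
      then have "\<tau> a \<in> A"
        using embedding_on_root[OF t M, of a f] a gen_superset[of A] by auto
      then show "y \<in> ?M" using a gen_superset[of A] by auto
    qed
  qed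
  have fixed: "z \<in> range to_ac" if z: "z \<in> ?M" "\<And>\<tau>. embedding_on ?M \<tau> \<Longrightarrow> \<tau> z = z" for z
  proof (rule ccontr)
    assume "z \<notin> range to_ac"
    then have "\<exists>E \<sigma>. intermediate E \<and> gen A \<union> {} \<subseteq> E \<and> embedding_on E \<sigma> \<and> \<sigma> z \<noteq> z"
      using sep z(1) assms(1) by (intro separable_generated_moved) blast+
    then obtain E \<sigma> where "gen A \<subseteq> E" "embedding_on E \<sigma>" "\<sigma> z \<noteq> z"
      by blast
    then show False using z(2)[OF embedding_on_subset] by blast
  qed
  have "separable_poly f \<and> {x. poly (map_poly to_ac f) x = 0} \<subseteq> ?M"
    if f: "irreducible f" "z \<in> ?M" "poly (map_poly to_ac f) z = 0" for f z
  proof -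
    define Orb where "Orb = {\<tau> z | \<tau>. embedding_on ?M \<tau>}"
    have f0: "map_poly to_ac f \<noteq> 0" using f(1) by (auto simp: irreducible_def)
    have OrbR: "Orb \<subseteq> {x. poly (map_poly to_ac f) x = 0}"
      using embedding_on_root[OF _ M f(2,3)] by (auto simp: Orb_def)
    then have fin: "finite Orb" using poly_roots_finite[OF f0] finite_subset by blast
    have OrbM: "Orb \<subseteq> ?M" using img f(2) by (auto simp: Orb_def)
    have "embedding_on ?M id" by (auto simp: embedding_on_def)
    then have zO: "z \<in> Orb" unfolding Orb_def by (auto intro!: exI[of _ id])
    define h where "h = (\<Prod>y\<in>Orb. [:- y, 1:])"
    have hM: "h \<in> polys_over ?M"
      unfolding h_def using OrbM by (intro prod_linear_in_polys_over[OF M]) auto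
    have hfix: "map_poly \<tau> h = h" if t: "embedding_on ?M \<tau>" for \<tau>
    proof -
      have comp: "embedding_on ?M (\<tau> \<circ> \<tau>')" if t': "embedding_on ?M \<tau>'" for \<tau>'
        using t t' img[OF t'] by (auto simp: embedding_on_def image_subset_iff)
      have "\<tau> ` Orb \<subseteq> Orb"
      proof
        fix y assume "y \<in> \<tau> ` Orb"
        then obtain \<tau>' where "embedding_on ?M \<tau>'" "y = (\<tau> \<circ> \<tau>') z" by (auto simp: Orb_def)
        then show "y \<in> Orb" using comp unfolding Orb_def by blast
      qed
      moreover have inj: "inj_on \<tau> Orb" using embedding_on_inj[OF t M] OrbM inj_on_subset by blast
      \<comment> \<open>An injective map of a finite set into itself permutes it, so
        \<open>\<tau>\<close> only permutes the factors of h.\<close>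
      ultimately have im: "\<tau> ` Orb = Orb" using fin by (simp add: endo_inj_surj)
      have "map_poly \<tau> h = (\<Prod>y\<in>Orb. [:- \<tau> y, 1:])"
        unfolding h_def using OrbM by (intro map_poly_embedding_prod_linear[OF t M]) auto
      also have "\<dots> = (\<Prod>y\<in>\<tau> ` Orb. [:- y, 1:])"
        using inj by (simp add: prod.reindex)
      finally show ?thesis by (simp add: im h_def)
    qed
    have "coeff h i \<in> range to_ac" for i
    proof (rule fixed)
      show "coeff h i \<in> ?M" using hM by (rule polys_overD)
      fix \<tau> assume "embedding_on ?M \<tau>"
      then have "\<tau> (coeff h i) = coeff (map_poly \<tau> h) i"
        by (simp add: coeff_map_poly embedding_onD(2)[OF _ M])
      also have "map_poly \<tau> h = h" by (rule hfix) fact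
      finally show "\<tau> (coeff h i) = coeff h i" .
    qed
    then have hK: "h \<in> polys_over (range to_ac)" by (simp add: polys_over_def)
    obtain m where m: "is_minpoly (range to_ac) z m" using minpoly_exists[OF intermediate_range] by blast
    obtain c where c: "c \<noteq> 0" "map_poly to_ac f = Polynomial.smult c m"
      using irreducible_root_minpoly[OF f(1,3) m] by blast
    have "poly h z = 0" using zO fin by (auto simp: h_def poly_prod prod_zero_iff)
    then have "m dvd h" using minpoly_dvd[OF intermediate_range m hK] by auto
    then have dvd: "map_poly to_ac f dvd h" using c by (simp add: smult_dvd_iff)
    have "rsquarefree h" unfolding h_def by (rule rsquarefree_prod_linear[OF fin])
    then have "separable_poly f" unfolding separable_poly_def using dvd by (rule rsquarefree_dvd)
    moreover have "x \<in> ?M" if "poly (map_poly to_ac f) x = 0" for x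
    proof -
      have "poly h x = 0" using that dvd by (auto elim!: dvdE)
      then show ?thesis using fin OrbM by (auto simp: h_def poly_prod prod_zero_iff)
    qed
    ultimately show ?thesis by blast
  qed
  then show ?thesis
    using M gen_finite_dimension[OF assms(1)]
    by (auto simp: finite_galois_def intermediate_iff_subfield)
qed

section \<open>Galois groups\<close>

lemma galois_element_root:
  assumes "finite_galois L" "x \<in> L"
  obtains f where "irreducible f" "poly (map_poly to_ac f) x = 0" "separable_poly f"
    "{y. poly (map_poly to_ac f) y = 0} \<subseteq> L"
proof -
  obtain f where f: "irreducible f" "is_minpoly (range to_ac) x (map_poly to_ac f)"
    by (rule minpoly_range_irreducible)
  then have "poly (map_poly to_ac f) x = 0" by (simp add: is_minpoly_def)
  then show ?thesis using that f(1) assms unfolding finite_galois_def by blast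
qed

lemma finite_roots_irreducible: "irreducible f \<Longrightarrow> finite {y. poly (map_poly to_ac f) y = 0}"
  by (intro poly_roots_finite) (auto simp: irreducible_def)

text \<open>Each element lies in the finite root set of an irreducible polynomial, and this set,
  contained in L, is mapped injectively into itself, hence onto itself.\<close>

lemma embedding_on_galois_image:
  assumes L: "finite_galois L" and s: "embedding_on L \<sigma>"
  shows "\<sigma> ` L = L"
proof -
  have LI: "intermediate L" by (rule finite_galois_intermediate[OF L])
  have "x \<in> \<sigma> ` L \<and> \<sigma> x \<in> L" if x: "x \<in> L" for x
  proof -
    obtain f where f: "irreducible f" "poly (map_poly to_ac f) x = 0"
      "{y. poly (map_poly to_ac f) y = 0} \<subseteq> L" (is "?S \<subseteq> L")
      using galois_element_root[OF L x] by metis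
    have "\<sigma> ` ?S \<subseteq> ?S"
      using embedding_on_root[OF s LI, of _ f] f(3) by auto
    moreover have "inj_on \<sigma> ?S" using embedding_on_inj[OF s LI] f(3) inj_on_subset by blast
    ultimately have "\<sigma> ` ?S = ?S" using finite_roots_irreducible[OF f(1)] by (simp add: endo_inj_surj)
    then show ?thesis using f(2,3) by blast
  qed
  then show ?thesis by blast
qed

lemma gal_iff:
  assumes "intermediate L"
  shows "\<sigma> \<in> gal L \<longleftrightarrow> \<sigma> \<in> extensional L \<and> embedding_on L \<sigma> \<and> \<sigma> ` L = L"
proof
  assume "\<sigma> \<in> gal L"
  then show "\<sigma> \<in> extensional L \<and> embedding_on L \<sigma> \<and> \<sigma> ` L = L"
    by (auto simp: gal_def ring_iso_def Ring.ring_hom_def embedding_on_def bij_betw_def)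
next
  assume s: "\<sigma> \<in> extensional L \<and> embedding_on L \<sigma> \<and> \<sigma> ` L = L"
  then have "inj_on \<sigma> L" using embedding_on_inj assms by blast
  then show "\<sigma> \<in> gal L" using s embedding_onD(3)[OF _ assms]
    by (auto simp: gal_def ring_iso_def Ring.ring_hom_def embedding_on_def bij_betw_def)
qed

context
  fixes L :: "'a::field alg_closure set"
  assumes L: "finite_galois L"
begin

lemma galois_intermediate: "intermediate L"
  by (rule finite_galois_intermediate[OF L])

lemma restrict_in_gal:
  assumes "embedding_on L \<sigma>"
  shows "restrict \<sigma> L \<in> gal L"
proof -
  have "embedding_on L (restrict \<sigma> L)"
    using assms by (auto simp: embedding_on_def intermediateD[OF galois_intermediate])
  then show ?thesis
    using embedding_on_galois_image[OF L assms] by (simp add: gal_iff[OF galois_intermediate])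
qed

lemma galD:
  assumes "\<sigma> \<in> gal L"
  shows "embedding_on L \<sigma>" "\<sigma> ` L = L" "\<sigma> \<in> extensional L" "inj_on \<sigma> L" "x \<in> L \<Longrightarrow> \<sigma> x \<in> L"
proof -
  show s: "embedding_on L \<sigma>" "\<sigma> ` L = L" "\<sigma> \<in> extensional L"
    using assms by (simp_all add: gal_iff[OF galois_intermediate])
  show "inj_on \<sigma> L" by (rule embedding_on_inj[OF s(1) galois_intermediate])
  show "x \<in> L \<Longrightarrow> \<sigma> x \<in> L" using s(2) by blast
qed

lemma gal_eqI: "\<sigma> \<in> gal L \<Longrightarrow> \<tau> \<in> gal L \<Longrightarrow> (\<And>x. x \<in> L \<Longrightarrow> \<sigma> x = \<tau> x) \<Longrightarrow> \<sigma> = \<tau>"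
  by (rule extensionalityI[of _ L]) (auto dest: galD)

lemma gal_id: "(\<lambda>x\<in>L. x) \<in> gal L"
  by (rule restrict_in_gal) (auto simp: embedding_on_def)

lemma gal_compose:
  assumes "\<sigma> \<in> gal L" "\<tau> \<in> gal L"
  shows "compose L \<sigma> \<tau> \<in> gal L"
  unfolding compose_def
proof (rule restrict_in_gal)
  show "embedding_on L (\<lambda>x. \<sigma> (\<tau> x))"
    using galD(5)[OF assms(2)]
    by (simp add: embedding_on_def embedding_onD[OF galD(1)[OF assms(1)] galois_intermediate]
        embedding_onD[OF galD(1)[OF assms(2)] galois_intermediate])
qed

lemma gal_inv_into:
  assumes "\<sigma> \<in> gal L" "x \<in> L"
  shows "inv_into L \<sigma> x \<in> L" "\<sigma> (inv_into L \<sigma> x) = x" "inv_into L \<sigma> (\<sigma> x) = x"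
  using galD(2,4)[OF assms(1)] assms(2) by (simp_all add: inv_into_into f_inv_into_f)

lemma gal_inv:
  assumes "\<sigma> \<in> gal L"
  shows "restrict (inv_into L \<sigma>) L \<in> gal L"
proof (rule restrict_in_gal)
  note s = embedding_onD[OF galD(1)[OF assms] galois_intermediate]
  have "inv_into L \<sigma> y = x" if "x \<in> L" "\<sigma> x = y" for x y
    using that gal_inv_into(3)[OF assms] by auto
  then show "embedding_on L (inv_into L \<sigma>)"
    by (auto simp: embedding_on_def s gal_inv_into[OF assms] intermediateD[OF galois_intermediate])
qed

lemma gal_conj:
  assumes "\<sigma> \<in> gal L" "\<tau> \<in> gal L"
  shows "compose L (compose L \<sigma> \<tau>) (inv_into L \<sigma>) \<in> gal L"
proof -
  \<comment> \<open>\<open>inv_into L \<sigma>\<close> is not extensional, but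
    \<open>compose\<close> discards its values outside L.\<close>
  have "compose L (compose L \<sigma> \<tau>) (inv_into L \<sigma>) =
        compose L (compose L \<sigma> \<tau>) (restrict (inv_into L \<sigma>) L)"
    by (auto simp: compose_def)
  then show ?thesis using gal_compose gal_inv assms by simp
qed

text \<open>An automorphism is determined by its values on finitely many generators, and each of
  these can only go to a root of its irreducible polynomial.\<close>

lemma gal_finite: "finite (gal L)"
proof -
  obtain A where A: "finite A" "L = gen A" by (rule finite_galois_generators[OF L])
  have AL: "A \<subseteq> L" using A(2) gen_superset by blast
  have "\<exists>S. finite S \<and> (\<forall>\<sigma>\<in>gal L. \<sigma> a \<in> S)" if "a \<in> A" for a
  proof -
    have a: "a \<in> L" using that AL by blast
    obtain f where f: "irreducible f" "poly (map_poly to_ac f) a = 0"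
      using galois_element_root[OF L a] by metis
    then show ?thesis
      using embedding_on_root[OF galD(1) galois_intermediate a, of _ f] finite_roots_irreducible[OF f(1)]
      by (intro exI[of _ "{y. poly (map_poly to_ac f) y = 0}"]) auto
  qed
  then obtain S where S: "\<And>a. a \<in> A \<Longrightarrow> finite (S a) \<and> (\<forall>\<sigma>\<in>gal L. \<sigma> a \<in> S a)" by metis
  have "inj_on (\<lambda>\<sigma>. restrict \<sigma> A) (gal L)"
  proof (rule inj_onI)
    fix \<sigma> \<tau> assume st: "\<sigma> \<in> gal L" "\<tau> \<in> gal L" "restrict \<sigma> A = restrict \<tau> A"
    have "intermediate {x \<in> L. \<sigma> x = \<tau> x}"
      unfolding intermediate_def
      using embedding_onD[OF galD(1)[OF st(1)] galois_intermediate]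
        embedding_onD[OF galD(1)[OF st(2)] galois_intermediate]
      by (auto simp: intermediateD[OF galois_intermediate])
    moreover have "A \<subseteq> {x \<in> L. \<sigma> x = \<tau> x}" using AL st(3) by (auto dest: fun_cong simp: restrict_def) metis
    ultimately have "L \<subseteq> {x \<in> L. \<sigma> x = \<tau> x}" using A(2) gen_least by blast
    then show "\<sigma> = \<tau>" using gal_eqI st by blast
  qed
  moreover have "(\<lambda>\<sigma>. restrict \<sigma> A) ` gal L \<subseteq> PiE A S" using S by auto
  ultimately show ?thesis
    using finite_PiE[OF A(1), of S] S by (meson finite_subset inj_on_finite)
qed

text \<open>The generators of L are separable, so an element outside the base field is moved by an
  embedding of some field containing L, and the restriction of this embedding to L is an
  automorphism.\<close>

lemma gal_fixed:
  assumes x: "x \<in> L" and fx: "\<And>\<sigma>. \<sigma> \<in> gal L \<Longrightarrow> \<sigma> x = x"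
  shows "x \<in> range to_ac"
proof (rule ccontr)
  assume xK: "x \<notin> range to_ac"
  obtain A where A: "finite A" "L = gen A" by (rule finite_galois_generators[OF L])
  have "\<exists>f. separable_poly f \<and> poly (map_poly to_ac f) a = 0" if "a \<in> A" for a
    using galois_element_root[OF L, of a] A(2) gen_superset[of A] that by (metis subsetD)
  then obtain E \<sigma> where E: "L \<subseteq> E" "embedding_on E \<sigma>" "\<sigma> x \<noteq> x"
    using separable_generated_moved[OF A(1), of x "{}"] x xK A(2) by auto
  then have "restrict \<sigma> L \<in> gal L" by (intro restrict_in_gal embedding_on_subset[OF E(2)])
  then show False using fx[of "restrict \<sigma> L"] E(3) x by auto
qed

lemma gal_restrict:
  assumes "finite_galois M" "L \<subseteq> M" "\<sigma> \<in> gal M"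
  shows "restrict \<sigma> L \<in> gal L"
proof (rule restrict_in_gal)
  have "embedding_on M \<sigma>"
    using assms(3) gal_iff[OF finite_galois_intermediate[OF assms(1)]] by blast
  then show "embedding_on L \<sigma>" using assms(2) by (rule embedding_on_subset)
qed

end

text \<open>All roots of the irreducible polynomials of the generators of both fields form a finite
  set to which \<open>finite_galois_gen\<close> applies.\<close>

lemma galois_compositum:
  assumes "finite_galois L" "finite_galois M"
  obtains N where "finite_galois N" "L \<subseteq> N" "M \<subseteq> N"
proof -
  obtain A B where A: "finite A" "L = gen A" and B: "finite B" "M = gen B"
    using finite_galois_generators assms by metis
  have "\<exists>f. irreducible f \<and> separable_poly f \<and> poly (map_poly to_ac f) a = 0" if "a \<in> A \<union> B" for a
  proof -
    have "a \<in> L \<or> a \<in> M" using that A(2) B(2) gen_superset by blast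
    then show ?thesis using galois_element_root assms by metis
  qed
  then obtain f where f: "\<And>a. a \<in> A \<union> B \<Longrightarrow> irreducible (f a) \<and> separable_poly (f a) \<and> poly (map_poly to_ac (f a)) a = 0"
    by metis
  define C where "C = (\<Union>a\<in>A \<union> B. {x. poly (map_poly to_ac (f a)) x = 0})"
  have "finite C"
    unfolding C_def using A(1) B(1) f by (intro finite_UN_I) (auto intro!: finite_roots_irreducible)
  then have "finite_galois (gen C)"
    using f by (intro finite_galois_gen) (auto simp: C_def)
  moreover have "A \<union> B \<subseteq> C" using f by (auto simp: C_def)
  ultimately show ?thesis using that A(2) B(2) gen_mono by blast
qed

section \<open>Polynomials over a finite field\<close>

text \<open>A nonzero element g of least degree in the ideal generated by P and a divides both. As P
  does not divide a, it does not divide g, so irreducibility of P makes g a unit.\<close>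

lemma irreducible_bezout:
  fixes P a :: "'k::field poly"
  assumes P: "irreducible P" and a: "\<not> P dvd a"
  obtains u v where "u * P + v * a = 1"
proof -
  define I where "I = {u * P + v * a | u v. True}"
  have P0: "P \<noteq> 0" using P by auto
  have PI: "P \<in> I" unfolding I_def using mult_1[of P] by (intro CollectI exI[of _ 1] exI[of _ 0]) simp
  have aI: "a \<in> I" unfolding I_def by (intro CollectI exI[of _ 0] exI[of _ 1]) simp
  obtain g where g: "g \<in> I" "g \<noteq> 0" "\<And>h. h \<in> I \<Longrightarrow> h \<noteq> 0 \<Longrightarrow> degree g \<le> degree h"
    using ex_has_least_nat[of "\<lambda>g. g \<in> I \<and> g \<noteq> 0" P degree] PI P0 by auto
  have dvd: "g dvd h" if h: "h \<in> I" for h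
  proof -
    obtain u v u' v' where uv: "g = u * P + v * a" "h = u' * P + v' * a"
      using g(1) h unfolding I_def by blast
    have "h mod g = (u' - h div g * u) * P + (v' - h div g * v) * a"
      using uv by (simp add: minus_div_mult_eq_mod[symmetric] algebra_simps)
    then have "h mod g \<in> I" unfolding I_def by blast
    then have "h mod g = 0" using g degree_mod_less[of g h] by fastforce
    then show ?thesis by (simp add: dvd_eq_mod_eq_0)
  qed
  have "\<not> P dvd g" using dvd[OF aI] a dvd_trans by blast
  then have "g dvd 1" using dvd[OF PI] P
    by (metis dvdE irreducibleD dvd_mult_unit_iff dvd_refl)
  then obtain w where "1 = g * w" by (rule dvdE)
  moreover obtain u v where "g = u * P + v * a" using g(1) unfolding I_def by blast
  ultimately have "(u * w) * P + (v * w) * a = 1" by (simp add: algebra_simps)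
  then show ?thesis by (rule that)
qed

lemma irreducible_dvd_mult:
  fixes P a b :: "'k::field poly"
  assumes P: "irreducible P" and ab: "P dvd a * b"
  shows "P dvd a \<or> P dvd b"
proof (rule disjCI)
  assume "\<not> P dvd b"
  then obtain u v where "u * P + v * b = 1" by (rule irreducible_bezout[OF P])
  then have "a = a * (u * P + v * b)" by simp
  also have "\<dots> = (a * u) * P + v * (a * b)" by (simp add: algebra_simps)
  finally show "P dvd a" using ab by (metis dvd_add dvd_mult dvd_triv_right)
qed

lemma irreducible_dvd_power:
  fixes P a :: "'k::field poly"
  assumes P: "irreducible P" and "P dvd a ^ n"
  shows "P dvd a"
  using assms(2)
  by (induction n) (use P irreducible_dvd_mult[OF P] in \<open>auto simp: irreducible_def\<close>)

lemma irreducible_degree_pos: "irreducible (P :: 'k::field poly) \<Longrightarrow> degree P > 0"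
  by (auto simp: irreducible_def is_unit_iff_degree)

definition residues_mod :: "'k::zero poly \<Rightarrow> 'k poly set" where
  "residues_mod P = {r. degree r < degree P}"

lemma polys_degree_less:
  fixes n :: nat
  assumes "n > 0"
  shows "finite {r :: 'k::{zero,finite} poly. degree r < n}"
    "card {r :: 'k::{zero,finite} poly. degree r < n} = CARD('k) ^ n"
proof -
  let ?X = "{xs :: 'k list. set xs \<subseteq> UNIV \<and> length xs = n}"
  have inj: "inj_on Poly ?X"
  proof (rule inj_onI)
    fix xs ys :: "'k list" assume a: "xs \<in> ?X" "ys \<in> ?X" "Poly xs = Poly ys"
    have "nth_default 0 xs i = nth_default 0 ys i" for i
      using a(3) by (metis coeff_Poly_eq)
    then show "xs = ys" using a(1,2)
      by (intro nth_equalityI) (auto, metis nth_default_nth)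
  qed
  have im: "Poly ` ?X = {r. degree r < n}"
  proof (intro equalityI subsetI)
    fix r assume "r \<in> Poly ` ?X"
    then obtain xs where "r = Poly xs" "length xs = n" by auto
    then have "\<forall>i\<ge>n. coeff r i = 0" by (auto simp: nth_default_def)
    then have "degree r \<le> n - 1" using assms by (intro degree_le) auto
    then show "r \<in> {r. degree r < n}" using assms by auto
  next
    fix r :: "'k poly" assume r: "r \<in> {r. degree r < n}"
    have "r = Poly (map (coeff r) [0..<n])"
      using r by (intro poly_eqI) (auto simp: nth_default_def coeff_eq_0)
    then show "r \<in> Poly ` ?X" by (intro image_eqI) auto
  qed
  show "finite {r :: 'k poly. degree r < n}"
    unfolding im[symmetric] by (intro finite_imageI finite_lists_length_eq) simp
  show "card {r :: 'k poly. degree r < n} = CARD('k) ^ n"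
    unfolding im[symmetric] card_image[OF inj] by (rule card_lists_length_eq) simp
qed

lemma residues_mod:
  fixes P :: "'k::{field,finite} poly"
  assumes "degree P > 0"
  shows "finite (residues_mod P)" "card (residues_mod P) = CARD('k) ^ degree P"
    "\<And>r. r \<in> residues_mod P \<Longrightarrow> P dvd r \<Longrightarrow> r = 0"
    "\<And>r s. r \<in> residues_mod P \<Longrightarrow> s \<in> residues_mod P \<Longrightarrow> P dvd r - s \<Longrightarrow> r = s"
    "0 \<in> residues_mod P" "\<And>a. a mod P \<in> residues_mod P"
proof -
  show "finite (residues_mod P)" "card (residues_mod P) = CARD('k) ^ degree P"
    using polys_degree_less[OF assms, where 'k='k] by (simp_all add: residues_mod_def)
  show z: "r = 0" if "r \<in> residues_mod P" "P dvd r" for r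
    using that dvd_imp_degree_le[of P r] by (auto simp: residues_mod_def)
  show "r = s" if "r \<in> residues_mod P" "s \<in> residues_mod P" "P dvd r - s" for r s
    using z[of "r - s"] that by (auto simp: residues_mod_def intro: degree_diff_less)
  show "0 \<in> residues_mod P" using assms by (simp add: residues_mod_def)
  show "a mod P \<in> residues_mod P" for a
    using degree_mod_less[of P a] assms by (cases "P = 0") (auto simp: residues_mod_def)
qed

text \<open>If P does not divide a, multiplication by a permutes the nonzero residues; comparing the
  products over all of them gives the exponent Q - 1. One more factor a leads to the form that also
  holds when P divides a.\<close>

lemma residue_fermat:
  fixes P a :: "'k::{field,finite} poly"
  assumes P: "irreducible P"
  shows "P dvd a ^ (CARD('k) ^ degree P) - a"
proof (cases "P dvd a")
  case True
  have "CARD('k) ^ degree P > 0" by simp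
  then have "a dvd a ^ (CARD('k) ^ degree P)" by (intro dvd_power) auto
  then show ?thesis using True dvd_trans by (metis dvd_diff)
next
  case False
  note res = residues_mod[OF irreducible_degree_pos[OF P]]
  define D where "D = residues_mod P - {0}"
  have fin: "finite D" using res(1) by (simp add: D_def)
  have cardD: "card D = CARD('k) ^ degree P - 1"
    using res(2,5) by (simp add: D_def)
  have inj: "inj_on (\<lambda>r. a * r mod P) D"
  proof (rule inj_onI)
    fix r s assume rs: "r \<in> D" "s \<in> D" "a * r mod P = a * s mod P"
    then have "P dvd a * (r - s)" by (simp add: mod_eq_dvd_iff right_diff_distrib)
    then have "P dvd r - s" using irreducible_dvd_mult[OF P] False by blast
    then show "r = s" using res(4) rs by (auto simp: D_def)
  qed
  have "(\<lambda>r. a * r mod P) ` D \<subseteq> D"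
  proof
    fix y assume "y \<in> (\<lambda>r. a * r mod P) ` D"
    then obtain r where r: "r \<in> D" "y = a * r mod P" by blast
    have "\<not> P dvd a * r" using irreducible_dvd_mult[OF P] False res(3) r by (auto simp: D_def)
    then have "y \<noteq> 0" using r(2) by (simp add: dvd_eq_mod_eq_0)
    then show "y \<in> D" using res(6) r(2) by (auto simp: D_def)
  qed
  then have im: "(\<lambda>r. a * r mod P) ` D = D" using inj fin by (simp add: endo_inj_surj)
  have "(\<Prod>r\<in>D. r) mod P = (\<Prod>r\<in>D. a * r mod P) mod P"
    using prod.reindex[OF inj, of "\<lambda>r. r"] im by simp
  also have "\<dots> = (\<Prod>r\<in>D. a * r) mod P" by (rule mod_prod_eq)
  also have "(\<Prod>r\<in>D. a * r) = a ^ card D * (\<Prod>r\<in>D. r)" by (simp add: prod.distrib)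
  finally have "P dvd (a ^ card D - 1) * (\<Prod>r\<in>D. r)"
    by (metis left_diff_distrib mod_eq_dvd_iff mult_1)
  moreover have "\<not> P dvd (\<Prod>r\<in>S. r)" if "finite S" "S \<subseteq> D" for S
    using that
  proof induction
    case empty
    then show ?case using P by (auto simp: irreducible_def)
  next
    case (insert r S)
    then have "\<not> P dvd r" using res(3)[of r] by (auto simp: D_def)
    moreover have "\<not> P dvd (\<Prod>r\<in>S. r)" using insert by blast
    ultimately show ?case unfolding prod.insert[OF insert.hyps] using irreducible_dvd_mult[OF P] by blast
  qed
  then have "\<not> P dvd (\<Prod>r\<in>D. r)" using fin by blast
  ultimately have "P dvd a ^ card D - 1" using irreducible_dvd_mult[OF P] by blast
  then have "P dvd a * (a ^ card D - 1)" by simp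
  also have "a * (a ^ card D - 1) = a ^ Suc (card D) - a" by (simp add: algebra_simps)
  also have "Suc (card D) = CARD('k) ^ degree P" using cardD by simp
  finally show ?thesis .
qed

text \<open>Expresses that a property holds for all but finitely many P, so that finite exceptional
  sets are combined by \<open>eventually_elim\<close>.\<close>

definition primes_filter :: "'k::field poly filter" where
  "primes_filter = inf cofinite (principal {P. monic_irreducible P})"

lemma eventually_primes_filter:
  "eventually Q primes_filter \<longleftrightarrow> finite {P. monic_irreducible P \<and> \<not> Q P}"
  by (simp add: primes_filter_def eventually_inf_principal eventually_cofinite)

lemma eq_almost_all_iff: "eq_almost_all a b \<longleftrightarrow> (\<forall>\<^sub>F P in primes_filter. P dvd a P - b P)"
  by (simp add: eq_almost_all_def eventually_primes_filter cong_iff_dvd_diff)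

lemma primes_filter_nontrivial: "(primes_filter :: 'k::field poly filter) \<noteq> bot"
  by (simp add: trivial_limit_def eventually_primes_filter infinite_monic_irreducible)

lemma eventually_irreducible: "\<forall>\<^sub>F P in primes_filter. irreducible P \<and> lead_coeff P = 1"
proof -
  have "{P :: 'a poly. monic_irreducible P \<and> \<not> (irreducible P \<and> lead_coeff P = 1)} = {}"
    by (auto simp: monic_irreducible_def)
  then show ?thesis by (simp only: eventually_primes_filter finite.emptyI)
qed

lemma eventually_degree_ge:
  "\<forall>\<^sub>F P :: 'k::{field,finite} poly in primes_filter. degree P \<ge> n"
proof -
  have "{P :: 'k poly. monic_irreducible P \<and> \<not> degree P \<ge> n} \<subseteq> {r. degree r < Suc n}" by auto
  then show ?thesis
    unfolding eventually_primes_filter using polys_degree_less(1)[of "Suc n"] finite_subset by blast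
qed

lemma eventually_not_dvd:
  fixes r :: "'k::{field,finite} poly"
  assumes "r \<noteq> 0"
  shows "\<forall>\<^sub>F P in primes_filter. \<not> P dvd r"
  using eventually_degree_ge[of "Suc (degree r)"]
proof eventually_elim
  case (elim P)
  then show ?case using dvd_imp_degree_le[of P r] assms by linarith
qed

text \<open>A nonzero r has no divisor of degree above its own. This turns congruences modulo almost
  all P into equations in R.\<close>

lemma eventually_dvd_const:
  fixes r :: "'k::{field,finite} poly"
  assumes "\<forall>\<^sub>F P in primes_filter. P dvd r"
  shows "r = 0"
proof (rule ccontr)
  assume "r \<noteq> 0"
  from eventually_not_dvd[OF this] assms have "\<forall>\<^sub>F P :: 'k poly in primes_filter. False"
    by eventually_elim simp
  then show False
    using primes_filter_nontrivial[where 'k = 'k] by (simp add: trivial_limit_def)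
qed

section \<open>Integral elements\<close>

interpretation to_fract: inj_idom_hom "to_fract :: 'k::field poly \<Rightarrow> 'k poly fract"
  by unfold_locales auto

interpretation of_R: inj_idom_hom "of_R :: 'k::field poly \<Rightarrow> 'k poly fract alg_closure"
  by unfold_locales (auto simp: of_R_def)

interpretation map_of_R: map_poly_inj_idom_hom "of_R :: 'k::field poly \<Rightarrow> 'k poly fract alg_closure"
  by unfold_locales

definition integral :: "'k::field poly fract alg_closure \<Rightarrow> bool" where
  "integral x \<longleftrightarrow> (\<exists>f :: 'k poly poly. lead_coeff f = 1 \<and> poly (map_poly of_R f) x = 0)"

lemma integers_altdef: "integers L = {x \<in> L. integral x}"
  by (simp add: integers_def integral_def)

definition span_R :: "'k::field poly fract alg_closure set \<Rightarrow> 'k poly fract alg_closure set" where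
  "span_R E = {\<Sum>e\<in>E. of_R (c e) * e | c. True}"

lemma span_R_add: "u \<in> span_R E \<Longrightarrow> v \<in> span_R E \<Longrightarrow> u + v \<in> span_R E"
proof -
  assume "u \<in> span_R E" "v \<in> span_R E"
  then obtain c d where "u = (\<Sum>e\<in>E. of_R (c e) * e)" "v = (\<Sum>e\<in>E. of_R (d e) * e)"
    unfolding span_R_def by blast
  then have "u + v = (\<Sum>e\<in>E. of_R (c e + d e) * e)"
    by (simp add: sum.distrib of_R.hom_add algebra_simps)
  then show ?thesis unfolding span_R_def by (intro CollectI exI[of _ "\<lambda>e. c e + d e"]) simp
qed

lemma span_R_smult: "u \<in> span_R E \<Longrightarrow> of_R r * u \<in> span_R E"
proof -
  assume "u \<in> span_R E"
  then obtain c where "u = (\<Sum>e\<in>E. of_R (c e) * e)" unfolding span_R_def by blast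
  then have "of_R r * u = (\<Sum>e\<in>E. of_R (r * c e) * e)"
    by (simp add: sum_distrib_left of_R.hom_mult algebra_simps)
  then show ?thesis unfolding span_R_def by (intro CollectI exI[of _ "\<lambda>e. r * c e"]) simp
qed

lemma span_R_0: "0 \<in> span_R E"
  unfolding span_R_def by (intro CollectI exI[of _ "\<lambda>_. 0"]) simp

lemma span_R_base: "finite E \<Longrightarrow> e \<in> E \<Longrightarrow> e \<in> span_R E"
proof -
  assume "finite E" "e \<in> E"
  then have "(\<Sum>x\<in>E. if x = e then e else 0) = e" by simp
  moreover have "(\<Sum>x\<in>E. if x = e then e else 0) = (\<Sum>x\<in>E. of_R (if x = e then 1 else 0) * x)"
    by (intro sum.cong) auto
  ultimately show ?thesis
    unfolding span_R_def by (intro CollectI exI[of _ "\<lambda>x. if x = e then 1 else 0"]) metis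
qed

lemma span_R_sum: "(\<And>i. i \<in> I \<Longrightarrow> f i \<in> span_R E) \<Longrightarrow> sum f I \<in> span_R E"
  by (induction I rule: infinite_finite_induct) (auto intro: span_R_0 span_R_add)

lemma span_R_times:
  assumes "\<And>e. e \<in> E \<Longrightarrow> x * e \<in> span_R E" "u \<in> span_R E"
  shows "x * u \<in> span_R E"
proof -
  obtain c where "u = (\<Sum>e\<in>E. of_R (c e) * e)" using assms(2) unfolding span_R_def by blast
  then have "x * u = (\<Sum>e\<in>E. of_R (c e) * (x * e))" by (simp add: sum_distrib_left algebra_simps)
  then show ?thesis using assms(1) by (auto intro!: span_R_sum span_R_smult)
qed

text \<open>The characteristic polynomial of multiplication by \<open>z\<close> on the generators annihilates \<open>z\<close>.\<close>

lemma integral_of_module: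
  assumes E: "finite E" "e\<^sub>0 \<in> E" "e\<^sub>0 \<noteq> 0" and z: "\<And>e. e \<in> E \<Longrightarrow> z * e \<in> span_R E"
  shows "integral z"
proof -
  obtain es where es: "set es = E" "distinct es" using finite_distinct_list[OF E(1)] by blast
  define N where "N = length es"
  have "\<exists>c. z * e = (\<Sum>x\<in>E. of_R (c x) * x)" if "e \<in> E" for e
    using z[OF that] unfolding span_R_def by blast
  then obtain c where c: "\<And>e. e \<in> E \<Longrightarrow> z * e = (\<Sum>x\<in>E. of_R (c e x) * x)" by metis
  define A where "A = mat N N (\<lambda>(i, j). c (es ! i) (es ! j))"
  define v where "v = vec N (\<lambda>i. es ! i)"
  have A: "A \<in> carrier_mat N N" by (simp add: A_def)
  have mA: "map_mat of_R A \<in> carrier_mat N N" using A by simp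
  have bij: "bij_betw ((!) es) {..<N} E"
    using bij_betw_nth[OF es(2)] es(1) N_def by blast
  have "map_mat of_R A *\<^sub>v v = z \<cdot>\<^sub>v v"
  proof (rule eq_vecI)
    fix i assume "i < dim_vec (z \<cdot>\<^sub>v v)"
    then have i: "i < N" by (simp add: v_def)
    then have "(map_mat of_R A *\<^sub>v v) $ i = (\<Sum>j<N. of_R (c (es ! i) (es ! j)) * es ! j)"
      by (simp add: A_def v_def scalar_prod_def row_def lessThan_atLeast0)
    also have "\<dots> = (\<Sum>x\<in>E. of_R (c (es ! i) x) * x)"
      using bij by (rule sum.reindex_bij_betw)
    also have "\<dots> = z * es ! i" using c[of "es ! i"] i es(1) N_def nth_mem by metis
    finally show "(map_mat of_R A *\<^sub>v v) $ i = (z \<cdot>\<^sub>v v) $ i" using i by (simp add: v_def)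
  qed (simp add: A_def v_def)
  moreover have "v \<noteq> 0\<^sub>v N"
  proof
    obtain i where "i < N" "es ! i = e\<^sub>0" using E(2) es(1) N_def by (metis in_set_conv_nth)
    moreover assume "v = 0\<^sub>v N"
    ultimately show False using E(3) by (metis index_vec index_zero_vec(1) v_def)
  qed
  ultimately have "eigenvector (map_mat of_R A) v z"
    using A by (simp add: eigenvector_def v_def)
  then have "eigenvalue (map_mat of_R A) z" unfolding eigenvalue_def by blast
  then have "poly (char_poly (map_mat of_R A)) z = 0" using eigenvalue_root_char_poly[OF mA] by blast
  then have "poly (map_poly of_R (char_poly A)) z = 0" by (simp add: of_R.char_poly_hom[OF A])
  moreover have "lead_coeff (char_poly A) = 1" using degree_monic_char_poly[OF A] by simp
  ultimately show ?thesis unfolding integral_def by blast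
qed

lemma poly_lead_split:
  "poly (map_poly of_R f) x = of_R (lead_coeff f) * x ^ degree f + (\<Sum>i<degree f. of_R (coeff f i) * x ^ i)"
proof -
  have "poly (map_poly of_R f) x = (\<Sum>i\<le>degree f. of_R (coeff f i) * x ^ i)"
    by (simp add: poly_altdef)
  then show ?thesis by (simp add: lessThan_Suc_atMost[symmetric])
qed

lemma integral_power_reduce:
  assumes "lead_coeff f = 1" "poly (map_poly of_R f) x = 0"
  shows "degree f > 0" "x ^ degree f = (\<Sum>i<degree f. of_R (- coeff f i) * x ^ i)"
proof -
  show "degree f > 0" using assms by (cases "degree f") (auto elim!: degree_eq_zeroE)
  have "x ^ degree f = - (\<Sum>i<degree f. of_R (coeff f i) * x ^ i)"
    using assms poly_lead_split[of f x] by (simp add: eq_neg_iff_add_eq_0)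
  then show "x ^ degree f = (\<Sum>i<degree f. of_R (- coeff f i) * x ^ i)"
    by (simp add: sum_negf of_R.hom_uminus)
qed

text \<open>With exponents below the degrees of the two monic equations, the products
  \<open>x ^ i * y ^ j\<close> span a module stable under x and under y, hence under their sum and
  product.\<close>

lemma integral_common_module:
  assumes "integral x" "integral y"
  obtains E where "finite E" "1 \<in> E" "\<And>e. e \<in> E \<Longrightarrow> x * e \<in> span_R E" "\<And>e. e \<in> E \<Longrightarrow> y * e \<in> span_R E"
proof -
  obtain f g where f: "lead_coeff f = 1" "poly (map_poly of_R f) x = 0"
    and g: "lead_coeff g = 1" "poly (map_poly of_R g) y = 0"
    using assms unfolding integral_def by blast
  define n m where "n = degree f" and "m = degree g"
  note fr = integral_power_reduce[OF f, folded n_def] and gr = integral_power_reduce[OF g, folded m_def]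
  define E where "E = (\<lambda>(i, j). x ^ i * y ^ j) ` ({..<n} \<times> {..<m})"
  have fin: "finite E" by (simp add: E_def)
  have base: "x ^ i * y ^ j \<in> span_R E" if "i < n" "j < m" for i j
    using that by (intro span_R_base[OF fin]) (auto simp: E_def)
  \<comment> \<open>The exponent i = n is included because multiplication by x raises i by one; the
    monic equation of x brings it back.\<close>
  have xs: "x ^ i * y ^ j \<in> span_R E" if "i \<le> n" "j < m" for i j
  proof (cases "i = n")
    case True
    then have "x ^ i * y ^ j = (\<Sum>i<n. of_R (- coeff f i) * (x ^ i * y ^ j))"
      using fr(2) by (simp add: sum_distrib_right mult.assoc)
    then show ?thesis using that by (auto intro!: span_R_sum span_R_smult base)
  qed (use that base in auto)
  have ys: "x ^ i * y ^ j \<in> span_R E" if "i < n" "j \<le> m" for i j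
  proof (cases "j = m")
    case True
    then have "x ^ i * y ^ j = (\<Sum>j<m. of_R (- coeff g j) * (x ^ i * y ^ j))"
      using gr(2) by (simp add: sum_distrib_left algebra_simps)
    then show ?thesis using that by (auto intro!: span_R_sum span_R_smult base)
  qed (use that base in auto)
  show ?thesis
  proof (rule that[OF fin])
    show "1 \<in> E" using fr(1) gr(1) by (auto simp: E_def intro!: image_eqI[of _ _ "(0, 0)"])
    fix e assume "e \<in> E"
    then obtain i j where ij: "i < n" "j < m" "e = x ^ i * y ^ j" by (auto simp: E_def)
    show "x * e \<in> span_R E" using xs[of "Suc i" j] ij by (simp add: algebra_simps)
    show "y * e \<in> span_R E" using ys[of i "Suc j"] ij by (simp add: algebra_simps)
  qed
qed

lemma integral_add: "integral x \<Longrightarrow> integral y \<Longrightarrow> integral (x + y)"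
proof -
  assume "integral x" "integral y"
  then obtain E where E: "finite E" "1 \<in> E" "\<And>e. e \<in> E \<Longrightarrow> x * e \<in> span_R E"
    "\<And>e. e \<in> E \<Longrightarrow> y * e \<in> span_R E" by (rule integral_common_module) blast
  show ?thesis
    by (rule integral_of_module[OF E(1,2)]) (auto simp: distrib_right intro!: span_R_add E(3,4))
qed

lemma integral_mult: "integral x \<Longrightarrow> integral y \<Longrightarrow> integral (x * y)"
proof -
  assume "integral x" "integral y"
  then obtain E where E: "finite E" "1 \<in> E" "\<And>e. e \<in> E \<Longrightarrow> x * e \<in> span_R E"
    "\<And>e. e \<in> E \<Longrightarrow> y * e \<in> span_R E" by (rule integral_common_module) blast
  show ?thesis
    by (rule integral_of_module[OF E(1,2)]) (auto simp: mult.assoc intro: span_R_times[OF E(3) E(4)])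
qed

lemma integral_of_R: "integral (of_R r)"
  unfolding integral_def by (rule exI[of _ "[:- r, 1:]"]) (simp add: map_poly_pCons of_R.hom_uminus)

lemma clear_denominators:
  fixes p :: "'k::field poly fract poly"
  shows "\<exists>d g. d \<noteq> 0 \<and> map_poly to_fract g = Polynomial.smult (to_fract d) p"
proof (induction p)
  case 0
  show ?case by (intro exI[of _ 1] exI[of _ 0]) simp
next
  case (pCons c p)
  then obtain d g where dg: "d \<noteq> 0" "map_poly to_fract g = Polynomial.smult (to_fract d) p" by blast
  obtain a b where ab: "c = Fraction_Field.Fract a b" "b \<noteq> 0" by (cases c) auto
  have "to_fract (a * d) = to_fract (b * d) * c"
    using ab by (simp add: Fract_conv_to_fract)
  then have "map_poly to_fract (pCons (a * d) (Polynomial.smult b g)) = Polynomial.smult (to_fract (b * d)) (pCons c p)"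
    using dg(2) by (simp add: Polynomial.map_poly_pCons[where f = to_fract, OF to_fract_0] del: to_fract_mult) (simp add: mult.assoc)
  then show ?case using dg(1) ab(2) by (intro exI[of _ "b * d"]) auto
qed

lemma map_poly_of_R: "map_poly of_R g = map_poly to_ac (map_poly to_fract g)"
  by (rule poly_eqI) (simp add: coeff_map_poly of_R_def)

text \<open>The leading coefficient c of an equation over R serves: c * x maps the module spanned by
  the powers of x below the degree into itself, because c times the top power is a combination of
  lower ones.\<close>

lemma integral_denominator:
  fixes x :: "'k::field poly fract alg_closure"
  obtains c where "c \<noteq> 0" "integral (of_R c * x)"
proof -
  obtain p :: "'k poly fract poly" where p: "p \<noteq> 0" "poly (map_poly to_ac p) x = 0"
    by (rule alg_closure_algebraic)
  obtain d g where dg: "d \<noteq> 0" "map_poly to_fract g = Polynomial.smult (to_fract d) p"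
    using clear_denominators by blast
  have g0: "g \<noteq> 0" using dg p(1) by auto
  have gx: "poly (map_poly of_R g) x = 0"
    using p(2) by (simp add: map_poly_of_R dg(2) hom_distribs)
  define n where "n = degree g"
  have n: "n > 0"
    using g0 gx by (cases n) (auto simp: n_def elim!: degree_eq_zeroE)
  define E where "E = (\<lambda>i. x ^ i) ` {..<n}"
  have fin: "finite E" by (simp add: E_def)
  have base: "x ^ i \<in> span_R E" if "i < n" for i
    using that by (intro span_R_base[OF fin]) (auto simp: E_def)
  have top: "of_R (lead_coeff g) * x ^ n = (\<Sum>i<n. of_R (- coeff g i) * x ^ i)"
    using gx poly_lead_split[of g x] by (simp add: n_def of_R.hom_uminus sum_negf eq_neg_iff_add_eq_0)
  have "integral (of_R (lead_coeff g) * x)"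
  proof (rule integral_of_module[OF fin])
    show "1 \<in> E" using n by (auto simp: E_def intro!: image_eqI[of _ _ 0])
    fix e assume "e \<in> E"
    then obtain i where i: "i < n" "e = x ^ i" by (auto simp: E_def)
    have e: "of_R (lead_coeff g) * x * e = of_R (lead_coeff g) * x ^ Suc i" using i by simp
    show "of_R (lead_coeff g) * x * e \<in> span_R E"
    proof (cases "Suc i = n")
      case True
      then show ?thesis unfolding e by (simp only: top) (auto intro!: span_R_sum span_R_smult base)
    next
      case False
      then show ?thesis unfolding e using i by (intro span_R_smult base) simp
    qed
  qed simp
  then show ?thesis using that[of "lead_coeff g"] g0 by simp
qed

text \<open>This is the integral closedness of R. For an element u / v, clearing denominators in a
  monic equation shows that v divides a power of u.\<close>

lemma integral_in_base:
  fixes r :: "'k::field poly fract"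
  assumes "integral (to_ac r)"
  shows "\<exists>s. to_ac r = of_R s"
proof -
  obtain f where f: "lead_coeff f = 1" "poly (map_poly of_R f) (to_ac r) = 0"
    using assms unfolding integral_def by blast
  define n where "n = degree f"
  have "to_ac (poly (map_poly to_fract f) r) = 0"
    using f(2) by (simp add: map_poly_of_R hom_distribs flip: to_ac.poly_map_poly)
  then have fr: "poly (map_poly to_fract f) r = 0" by simp
  \<comment> \<open>A denominator of least degree plays the role of a reduced fraction: a prime
    factor common to u and v could be cancelled.\<close>
  define S where "S = {(u, v). v \<noteq> 0 \<and> r = Fraction_Field.Fract u v}"
  have "\<exists>uv. uv \<in> S" by (cases r) (auto simp: S_def)
  then obtain uv where uv: "uv \<in> S" "\<And>w. w \<in> S \<Longrightarrow> degree (snd uv) \<le> degree (snd w)"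
    using ex_has_least_nat[of "\<lambda>w. w \<in> S" _ "\<lambda>w. degree (snd w)"] by blast
  obtain u v where u: "uv = (u, v)" by (cases uv)
  have v0: "v \<noteq> 0" and r: "r = Fraction_Field.Fract u v" using uv(1) u by (auto simp: S_def)
  have rv: "r * to_fract v = to_fract u" using v0 by (simp add: r Fract_conv_to_fract)
  have "0 = to_fract v ^ n * poly (map_poly to_fract f) r" using fr by simp
  also have "poly (map_poly to_fract f) r = (\<Sum>i\<le>n. to_fract (coeff f i) * r ^ i)"
    by (simp add: poly_altdef n_def)
  also have "to_fract v ^ n * \<dots> = (\<Sum>i\<le>n. to_fract (coeff f i * u ^ i * v ^ (n - i)))"
    unfolding sum_distrib_left
  proof (rule sum.cong)
    fix i assume "i \<in> {..n}"
    then have "to_fract v ^ n = to_fract v ^ i * to_fract v ^ (n - i)" by (simp flip: power_add)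
    then show "to_fract v ^ n * (to_fract (coeff f i) * r ^ i) = to_fract (coeff f i * u ^ i * v ^ (n - i))"
      by (simp add: hom_distribs rv[symmetric] power_mult_distrib)
  qed simp
  also have "\<dots> = to_fract (\<Sum>i\<le>n. coeff f i * u ^ i * v ^ (n - i))" by simp
  finally have "(\<Sum>i\<le>n. coeff f i * u ^ i * v ^ (n - i)) = 0" by (metis to_fract_eq_0_iff)
  then have eq: "u ^ n + (\<Sum>i<n. coeff f i * u ^ i * v ^ (n - i)) = 0"
    using f(1) by (simp add: lessThan_Suc_atMost[symmetric] n_def add.commute)
  have "v dvd (\<Sum>i<n. coeff f i * u ^ i * v ^ (n - i))"
    by (intro dvd_sum dvd_mult dvd_power) auto
  moreover have "u ^ n = - (\<Sum>i<n. coeff f i * u ^ i * v ^ (n - i))"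
    using eq by (simp add: eq_neg_iff_add_eq_0)
  ultimately have vu: "v dvd u ^ n" by simp
  have "degree v = 0"
  proof (rule ccontr)
    assume "degree v \<noteq> 0"
    then obtain P where P: "monic_irreducible P" "P dvd v" using monic_irreducible_divisor_exists by blast
    have Pi: "irreducible P" using P by (simp add: monic_irreducible_def)
    have "P dvd u" using irreducible_dvd_power[OF Pi] P(2) vu dvd_trans by blast
    then obtain u' v' where uv': "u = P * u'" "v = P * v'" using P(2) by (metis dvdE)
    have nz: "P \<noteq> 0" "v' \<noteq> 0" using v0 uv' by auto
    have "r = Fraction_Field.Fract u' v'"
      unfolding r uv' using nz by (simp add: Fract_conv_to_fract)
    then have "(u', v') \<in> S" using nz by (simp add: S_def)
    then have "degree v \<le> degree v'" using uv(2) u by fastforce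
    moreover have "degree v = degree P + degree v'" using uv'(2) nz by (simp add: degree_mult_eq)
    ultimately show False using irreducible_degree_pos[OF Pi] by simp
  qed
  then obtain c where c: "v = [:c:]" "c \<noteq> 0" using v0 by (metis degree_eq_zeroE pCons_0_0)
  have "v * [:inverse c:] = 1" using c by simp
  then have "to_fract v * to_fract [:inverse c:] = 1" by (metis to_fract_1 to_fract_mult)
  then have "r = r * (to_fract v * to_fract [:inverse c:])" by simp
  also have "\<dots> = to_fract (u * [:inverse c:])"
    unfolding mult.assoc[symmetric] rv to_fract_mult ..
  finally have "r = to_fract (u * [:inverse c:])" .
  then show ?thesis by (auto simp: of_R_def)
qed

text \<open>This is \<open>residue_fermat\<close> for the irreducible polynomial X of degree one,
  applied to a constant and evaluated at 0.\<close>

lemma finite_field_fermat: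
  fixes c :: "'k::{field,finite}"
  shows "c ^ CARD('k) = c"
proof -
  have "irreducible ([:0, 1:] :: 'k poly)" by (rule irreducible_linear_field_poly) simp
  then have "[:0, 1:] dvd [:c:] ^ (CARD('k) ^ degree [:0, 1 :: 'k:]) - [:c:]" by (rule residue_fermat)
  then obtain h where "[:c:] ^ CARD('k) - [:c:] = [:0, 1:] * h" by (auto elim: dvdE)
  then have "poly ([:c:] ^ CARD('k) - [:c:]) 0 = poly ([:0, 1:] * h) 0" by (rule arg_cong)
  then show ?thesis by simp
qed

text \<open>For fixed \<open>y\<close>, the polynomial \<open>E(X + y) - E(X) - E(y)\<close> with \<open>E = X\<^sup>q - X\<close> has degree less
  than \<open>q\<close> and vanishes on the finite field, so it is zero.\<close>

lemma power_card_add: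
  fixes x y :: "'k::{field,finite} poly fract alg_closure"
  shows "(x + y) ^ CARD('k) = x ^ CARD('k) + y ^ CARD('k)"
proof -
  define q where "q = CARD('k)"
  define \<kappa> where "\<kappa> c = of_R [:c:]" for c :: 'k
  have q: "q > 1"
    using card_mono[of "UNIV :: 'k set" "{0, 1}"] by (simp add: q_def)
  have inj: "inj \<kappa>" by (rule injI) (simp add: \<kappa>_def)
  have \<kappa>q: "\<kappa> c ^ q = \<kappa> c" for c
    by (simp add: \<kappa>_def q_def poly_const_pow finite_field_fermat flip: of_R.hom_power)
  have \<kappa>diff: "\<kappa> c - \<kappa> d = \<kappa> (c - d)" for c d by (simp add: \<kappa>_def flip: of_R.hom_minus)
  define E :: "'k poly fract alg_closure poly" where "E = (\<Prod>c\<in>UNIV. [:- \<kappa> c, 1:])"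
  have degE: "degree E = q" by (simp add: E_def q_def degree_prod_eq_sum_degree)
  have lcE: "coeff E q = 1"
    using degE lead_coeff_prod[of "\<lambda>c. [:- \<kappa> c, 1:]" UNIV] by (simp add: E_def)
  have zero: "G = 0" if "degree G < q" "\<And>c. poly G (\<kappa> c) = 0" for G
  proof (rule ccontr)
    assume G: "G \<noteq> 0"
    have "card (range \<kappa>) \<le> card {x. poly G x = 0}"
      using that(2) poly_roots_finite[OF G] by (intro card_mono) auto
    also have "\<dots> \<le> degree G" by (rule card_poly_roots_bound[OF G])
    finally show False using that(1) card_image[OF inj] by (simp add: q_def)
  qed
  have small: "degree (A - B) < q" if "degree A \<le> q" "degree B \<le> q" "coeff A q = coeff B q"
    for A B :: "'k poly fract alg_closure poly"
    using that q
    by (intro degree_lessI) (auto simp: coeff_eq_0 le_less)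
  have Ek: "poly E (\<kappa> c) = 0" for c
    by (auto simp: E_def poly_prod prod_zero_iff)
  have "monom 1 q - [:0, 1:] - E = 0"
  proof (rule zero)
    have "degree (monom 1 q - [:0, 1:] :: 'k poly fract alg_closure poly) \<le> q"
      using q by (intro degree_diff_le degree_monom_le) auto
    moreover have "coeff [:0, 1 :: 'k poly fract alg_closure:] q = 0" using q by (simp add: coeff_eq_0)
    ultimately show "degree (monom 1 q - [:0, 1:] - E) < q" using degE lcE by (intro small) auto
    show "poly (monom 1 q - [:0, 1:] - E) (\<kappa> c) = 0" for c
      by (simp add: poly_monom \<kappa>q Ek)
  qed
  then have "E = monom 1 q - [:0, 1:]" by simp
  then have Ev: "poly E z = z ^ q - z" for z by (simp add: poly_monom)
  have "pcompose E [:y, 1:] - (E + [:poly E y:]) = 0"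
  proof (rule zero)
    have "lead_coeff (pcompose E [:y, 1:]) = lead_coeff E"
      using lead_coeff_comp[of "[:y, 1:]" E] by simp
    then have "coeff (pcompose E [:y, 1:]) q = 1" using degE lcE by simp
    moreover have "degree (E + [:poly E y:]) \<le> q" using degE by (intro degree_add_le) auto
    moreover have "coeff [:poly E y:] q = 0" using q by (simp add: coeff_eq_0)
    ultimately show "degree (pcompose E [:y, 1:] - (E + [:poly E y:])) < q"
      using degE lcE by (intro small) auto
    fix c
    \<comment> \<open>In product form E is invariant under translation by constants, as subtracting
      c permutes the factors.\<close>
    have "poly E (y + \<kappa> c) = (\<Prod>d\<in>UNIV. y - \<kappa> (d - c))"
      by (simp add: E_def poly_prod \<kappa>diff[symmetric] algebra_simps)
    also have "\<dots> = (\<Prod>d\<in>UNIV. y - \<kappa> d)"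
      by (rule prod.reindex_bij_witness[of _ "\<lambda>d. d + c" "\<lambda>d. d - c"]) auto
    also have "\<dots> = poly E y" by (simp add: E_def poly_prod)
    finally show "poly (pcompose E [:y, 1:] - (E + [:poly E y:])) (\<kappa> c) = 0"
      by (simp add: poly_pcompose Ek)
  qed
  then have "poly (pcompose E [:y, 1:] - (E + [:poly E y:])) x = 0" by simp
  then have "poly E (y + x) = poly E x + poly E y" by (simp add: poly_pcompose)
  then show ?thesis by (simp add: Ev q_def algebra_simps)
qed

lemma power_card_power_add:
  fixes x y :: "'k::{field,finite} poly fract alg_closure"
  shows "(x + y) ^ (CARD('k) ^ n) = x ^ (CARD('k) ^ n) + y ^ (CARD('k) ^ n)"
  by (induction n) (simp_all add: power_mult power_card_add mult.commute[of "CARD('k)"])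

lemma power_card_power_sum:
  fixes f :: "'i \<Rightarrow> 'k::{field,finite} poly fract alg_closure"
  shows "(\<Sum>i\<in>I. f i) ^ (CARD('k) ^ n) = (\<Sum>i\<in>I. f i ^ (CARD('k) ^ n))"
  by (induction I rule: infinite_finite_induct) (simp_all add: power_card_power_add power_0_left)

text \<open>The bound on the number of roots over the field R/(P), written without that field:
  divisibility by \<open>[:P:]\<close> means that G vanishes modulo P, and S consists of pairwise
  incongruent roots.\<close>

lemma const_dvd_of_many_roots:
  fixes P :: "'k::field poly" and G :: "'k poly poly"
  assumes P: "irreducible P" and "finite S" "degree G < card S" "\<And>b. b \<in> S \<Longrightarrow> P dvd poly G b"
    and "\<And>b c. b \<in> S \<Longrightarrow> c \<in> S \<Longrightarrow> P dvd b - c \<Longrightarrow> b = c"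
  shows "[:P:] dvd G"
  using assms(2-)
proof (induction "degree G" arbitrary: G S)
  case 0
  then obtain c b where "G = [:c:]" "b \<in> S"
    by (metis card.empty degree_eq_zeroE equals0I less_nat_zero_code)
  then have "G = [:c:]" "P dvd c" using "0.prems"(3)[of b] by auto
  then show ?case by (auto simp: const_poly_dvd_iff coeff_pCons split: nat.splits)
next
  case (Suc d)
  then obtain b where b: "b \<in> S" by (metis card.empty equals0I less_nat_zero_code)
  define H where "H = synthetic_div G b"
  have G: "G = [:-b, 1:] * H + [:poly G b:]" using synthetic_div_correct'[of b G] by (simp add: H_def)
  have "[:P:] dvd H"
  proof (rule Suc.hyps(1))
    show "d = degree H" using Suc.hyps(2) by (simp add: H_def degree_synthetic_div)
    then show "degree H < card (S - {b})" using Suc.prems(1,2) Suc.hyps(2) b by simp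
    fix c assume c: "c \<in> S - {b}"
    have "poly G c = (c - b) * poly H c + poly G b" by (subst G) (simp add: algebra_simps)
    then have "P dvd (c - b) * poly H c" using Suc.prems(3)[of c] Suc.prems(3)[OF b] c
      by (metis DiffD1 dvd_add_left_iff)
    moreover have "\<not> P dvd c - b" using Suc.prems(4)[of c b] b c by auto
    ultimately show "P dvd poly H c" using irreducible_dvd_mult[OF P] by blast
  qed (use Suc.prems in auto)
  moreover have "[:P:] dvd [:poly G b:]"
    using Suc.prems(3)[OF b] by (auto simp: const_poly_dvd_iff coeff_pCons split: nat.splits)
  ultimately show ?case by (subst G) (intro dvd_add dvd_mult)
qed

text \<open>Over R/(P), both polynomials are monic of degree Q and vanish at all Q residues, so
  their difference has more roots than its degree allows.\<close>

lemma residue_product: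
  fixes P :: "'k::{field,finite} poly"
  assumes P: "irreducible P"
  shows "[:P:] dvd (\<Prod>b\<in>residues_mod P. [:- b, 1:]) - (monom 1 (CARD('k) ^ degree P) - [:0, 1:])"
    (is "_ dvd ?A - ?B")
proof -
  note res = residues_mod[OF irreducible_degree_pos[OF P]]
  define Q where "Q = CARD('k) ^ degree P"
  have "CARD('k) > 1" using card_mono[of "UNIV :: 'k set" "{0, 1}"] by simp
  then have Q: "Q > 1" unfolding Q_def using irreducible_degree_pos[OF P] by (intro one_less_power)
  have degA: "degree ?A = Q" using res(1,2) by (simp add: degree_prod_eq_sum_degree Q_def)
  have lcA: "coeff ?A Q = 1"
    using degA lead_coeff_prod[of "\<lambda>b. [:- b, 1:]" "residues_mod P"] by simp
  have degB: "degree ?B \<le> Q" unfolding Q_def[symmetric]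
    using Q by (intro degree_diff_le degree_monom_le) auto
  have lcB: "coeff ?B Q = 1" unfolding Q_def[symmetric] using Q by (simp add: coeff_eq_0)
  have deg: "degree (?A - ?B) < Q"
    using degA degB lcA lcB Q by (intro degree_lessI) (auto simp: coeff_eq_0 le_less)
  show ?thesis
  proof (rule const_dvd_of_many_roots[OF P res(1)])
    show "degree (?A - ?B) < card (residues_mod P)" using deg res(2) by (simp add: Q_def)
    fix b assume b: "b \<in> residues_mod P"
    have "poly ?A b = 0" using b res(1) by (auto simp: poly_prod prod_zero_iff)
    then show "P dvd poly (?A - ?B) b"
      using residue_fermat[OF P, of b] by (simp add: poly_monom dvd_diff_commute)
  qed (rule res(4))
qed

section \<open>Rings of integers\<close>

lemma integers_closed:
  assumes "intermediate L"
  shows "of_R r \<in> integers L" "0 \<in> integers L" "1 \<in> integers L"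
    "x \<in> integers L \<Longrightarrow> y \<in> integers L \<Longrightarrow> x + y \<in> integers L"
    "x \<in> integers L \<Longrightarrow> y \<in> integers L \<Longrightarrow> x * y \<in> integers L"
    "x \<in> integers L \<Longrightarrow> - x \<in> integers L"
    "x \<in> integers L \<Longrightarrow> y \<in> integers L \<Longrightarrow> x - y \<in> integers L"
    "x \<in> integers L \<Longrightarrow> x ^ n \<in> integers L"
proof -
  show R: "of_R r \<in> integers L" for r
    using intermediateD(1)[OF assms] integral_of_R by (simp add: integers_altdef of_R_def)
  show "0 \<in> integers L" and one: "1 \<in> integers L" using R[of 0] R[of 1] by simp_all
  show add: "x \<in> integers L \<Longrightarrow> y \<in> integers L \<Longrightarrow> x + y \<in> integers L"
    and mult: "x \<in> integers L \<Longrightarrow> y \<in> integers L \<Longrightarrow> x * y \<in> integers L" for x y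
    using intermediateD[OF assms] integral_add integral_mult by (auto simp: integers_altdef)
  show minus: "x \<in> integers L \<Longrightarrow> - x \<in> integers L" for x
    using mult[OF R[of "-1"], of x] by (simp add: of_R.hom_uminus)
  show "x \<in> integers L \<Longrightarrow> y \<in> integers L \<Longrightarrow> x - y \<in> integers L"
    using add[OF _ minus, of x y] by simp
  show "x \<in> integers L \<Longrightarrow> x ^ n \<in> integers L"
    by (induction n) (auto simp: one mult)
qed

lemma integers_sum: "intermediate L \<Longrightarrow> (\<And>i. i \<in> I \<Longrightarrow> f i \<in> integers L) \<Longrightarrow> sum f I \<in> integers L"
  by (induction I rule: infinite_finite_induct) (auto intro: integers_closed)

lemma integers_prod: "intermediate L \<Longrightarrow> (\<And>i. i \<in> I \<Longrightarrow> f i \<in> integers L) \<Longrightarrow> prod f I \<in> integers L"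
  by (induction I rule: infinite_finite_induct) (auto intro: integers_closed)

lemma integers_poly: "intermediate L \<Longrightarrow> x \<in> integers L \<Longrightarrow> poly (map_poly of_R f) x \<in> integers L"
  unfolding poly_altdef by (intro integers_sum) (auto intro!: integers_closed)

lemma integers_subset: "integers L \<subseteq> L"
  by (auto simp: integers_altdef)

lemma coeff_prod_linear_closed:
  fixes S :: "'a::comm_ring_1 set"
  assumes "0 \<in> S" "1 \<in> S" "\<And>x y. x \<in> S \<Longrightarrow> y \<in> S \<Longrightarrow> x + y \<in> S"
    "\<And>x y. x \<in> S \<Longrightarrow> y \<in> S \<Longrightarrow> x * y \<in> S" "\<And>x. x \<in> S \<Longrightarrow> - x \<in> S"
    and "\<And>i. i \<in> I \<Longrightarrow> f i \<in> S"
  shows "coeff (\<Prod>i\<in>I. [:- f i, 1:]) n \<in> S"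
  using assms(6)
proof (induction I arbitrary: n rule: infinite_finite_induct)
  case (insert i I)
  have eq: "coeff ([:- f i, 1:] * (\<Prod>i\<in>I. [:- f i, 1:])) n =
     - f i * coeff (\<Prod>i\<in>I. [:- f i, 1:]) n + (if n = 0 then 0 else coeff (\<Prod>i\<in>I. [:- f i, 1:]) (n - 1))"
    by (simp add: coeff_pCons split: nat.splits)
  have "- f i * coeff (\<Prod>i\<in>I. [:- f i, 1:]) n \<in> S"
    using insert by (intro assms(4,5)) auto
  moreover have "(if n = 0 then 0 else coeff (\<Prod>i\<in>I. [:- f i, 1:]) (n - 1)) \<in> S"
    using insert assms(1) by auto
  ultimately show ?case
    unfolding prod.insert[OF insert.hyps] eq by (rule assms(3))
qed (use assms(1,2) in \<open>auto simp: coeff_1\<close>)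

text \<open>The third condition on \<open>V\<close> makes the sets behave like subspaces modulo P *
  M. In a minimal subcover, take x in M that lies in \<open>V i\<close> and in no other member, and
  y in M outside \<open>V i\<close>. The elements y + a * x avoid \<open>V i\<close>, so by counting
  two of them, for incongruent a and b, share another member. It contains (a - b) * x and P * x,
  hence x.\<close>

lemma submodule_cover:
  fixes P :: "'k::{field,finite} poly" and V :: "'i \<Rightarrow> 'k poly fract alg_closure set"
  assumes P: "irreducible P" and I: "finite I" "card I \<le> CARD('k) ^ degree P"
    and M: "0 \<in> M" "\<And>x y. x \<in> M \<Longrightarrow> y \<in> M \<Longrightarrow> x + y \<in> M" "\<And>r x. x \<in> M \<Longrightarrow> of_R r * x \<in> M"
    and V: "\<And>i x y. i \<in> I \<Longrightarrow> x \<in> V i \<Longrightarrow> y \<in> V i \<Longrightarrow> x + y \<in> V i"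
      "\<And>i r x. i \<in> I \<Longrightarrow> x \<in> V i \<Longrightarrow> of_R r * x \<in> V i"
      "\<And>i x. i \<in> I \<Longrightarrow> x \<in> M \<Longrightarrow> of_R P * x \<in> V i"
    and cover: "M \<subseteq> (\<Union>i\<in>I. V i)"
  shows "\<exists>i\<in>I. M \<subseteq> V i"
proof -
  note res = residues_mod[OF irreducible_degree_pos[OF P]]
  have Vd: "x - y \<in> V i" if "i \<in> I" "x \<in> V i" "y \<in> V i" for i x y
    using V(1)[OF that(1,2) V(2)[OF that(1,3), of "-1"]] by (simp add: of_R.hom_uminus)
  define covers where "covers J \<longleftrightarrow> J \<subseteq> I \<and> M \<subseteq> (\<Union>i\<in>J. V i)" for J
  have "covers I" using cover by (simp add: covers_def)
  then obtain J where "covers J" and min: "\<forall>J'. covers J' \<longrightarrow> card J \<le> card J'"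
    using ex_has_least_nat[of covers I card] by blast
  then have J: "J \<subseteq> I" "M \<subseteq> (\<Union>i\<in>J. V i)" by (simp_all add: covers_def)
  have finJ: "finite J" using J(1) I(1) finite_subset by blast
  obtain i where i: "i \<in> J" using J(2) M(1) by blast
  show ?thesis
  proof (rule ccontr)
    assume neg: "\<not> ?thesis"
    then obtain y where y: "y \<in> M" "y \<notin> V i" using i J(1) by blast
    have "\<not> M \<subseteq> (\<Union>i\<in>J - {i}. V i)"
    proof
      assume "M \<subseteq> (\<Union>i\<in>J - {i}. V i)"
      then have "covers (J - {i})" using J(1) by (auto simp: covers_def)
      then show False using min card_Diff1_less[OF finJ i] by (metis not_le)
    qed
    then obtain x where x: "x \<in> M" "x \<notin> (\<Union>i\<in>J - {i}. V i)" by blast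
    then have xi: "x \<in> V i" using J(2) by blast
    have iI: "i \<in> I" using i J(1) by blast
    have "\<exists>j\<in>J - {i}. y + of_R a * x \<in> V j" for a
    proof -
      have "y + of_R a * x \<notin> V i"
      proof
        assume "y + of_R a * x \<in> V i"
        then have "(y + of_R a * x) - of_R a * x \<in> V i" using V(2) xi iI by (intro Vd) auto
        then show False using y(2) by simp
      qed
      moreover have "y + of_R a * x \<in> M" using M y(1) x(1) by auto
      ultimately show ?thesis using J(2) by blast
    qed
    then obtain j where j: "\<And>a. j a \<in> J - {i} \<and> y + of_R a * x \<in> V (j a)" by metis
    have "card (j ` residues_mod P) \<le> card (J - {i})" using j finJ by (intro card_mono) auto
    also have "\<dots> < card J" by (rule card_Diff1_less[OF finJ i])
    also have "\<dots> \<le> card I" using J(1) I(1) by (rule card_mono[rotated])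
    also have "\<dots> \<le> card (residues_mod P)" using I(2) res(2) by simp
    finally have "\<not> inj_on j (residues_mod P)" using card_image by fastforce
    then obtain a b where ab: "a \<in> residues_mod P" "b \<in> residues_mod P" "a \<noteq> b" "j a = j b"
      by (auto simp: inj_on_def)
    have jI: "j a \<in> I" using j J(1) by blast
    have "(y + of_R a * x) - (y + of_R b * x) \<in> V (j a)"
      using j[of a] j[of b] ab(4) by (intro Vd jI) auto
    then have d: "of_R (a - b) * x \<in> V (j a)" by (simp add: of_R.hom_minus algebra_simps)
    have "\<not> P dvd a - b" using res(4) ab by blast
    then obtain u v where uv: "u * P + v * (a - b) = 1" by (rule irreducible_bezout[OF P])
    have "of_R u * (of_R P * x) + of_R v * (of_R (a - b) * x) \<in> V (j a)"
      by (intro V(1,2,3) jI d x)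
    also have "of_R u * (of_R P * x) + of_R v * (of_R (a - b) * x) = of_R (u * P + v * (a - b)) * x"
      by (simp only: of_R.hom_mult of_R.hom_add distrib_right mult.assoc)
    finally have "x \<in> V (j a)" by (simp add: uv)
    then show False using x(2) j[of a] by blast
  qed
qed

section \<open>Prime ideals of the integers of L lying over P\<close>

lemma integer_ring_simps [simp]:
  "carrier (integer_ring L) = integers L" "x \<otimes>\<^bsub>integer_ring L\<^esub> y = x * y"
  "x \<oplus>\<^bsub>integer_ring L\<^esub> y = x + y" "\<one>\<^bsub>integer_ring L\<^esub> = 1" "\<zero>\<^bsub>integer_ring L\<^esub> = 0"
  by (simp_all add: integer_ring_def)

lemma integer_ring_cring:
  fixes L :: "'k::field poly fract alg_closure set"
  assumes "intermediate L"
  shows "cring (integer_ring L)"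
proof -
  interpret field "ring_of_type_algebra :: 'k poly fract alg_closure ring" by (rule field_from_type_algebra)
  have "subring (integers L) ring_of_type_algebra"
    by (intro subring_type_algebraI integers_closed[OF assms])
  then have "subcring (integers L) ring_of_type_algebra" by (rule subcringI')
  then show ?thesis unfolding integer_ring_def using subcring_iff by auto
qed

lemma prime_overD:
  assumes L: "intermediate L" and pp: "prime_over L P \<pp>"
  shows "\<pp> \<subseteq> integers L" "0 \<in> \<pp>" "x \<in> \<pp> \<Longrightarrow> y \<in> \<pp> \<Longrightarrow> x + y \<in> \<pp>" "x \<in> integers L \<Longrightarrow> y \<in> \<pp> \<Longrightarrow> x * y \<in> \<pp>"
    "x \<in> \<pp> \<Longrightarrow> y \<in> integers L \<Longrightarrow> x * y \<in> \<pp>"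
    "x \<in> \<pp> \<Longrightarrow> - x \<in> \<pp>" "x \<in> \<pp> \<Longrightarrow> y \<in> \<pp> \<Longrightarrow> x - y \<in> \<pp>" "of_R r \<in> \<pp> \<longleftrightarrow> P dvd r"
    "x \<in> integers L \<Longrightarrow> y \<in> integers L \<Longrightarrow> x * y \<in> \<pp> \<Longrightarrow> x \<in> \<pp> \<or> y \<in> \<pp>" "1 \<notin> \<pp>"
proof -
  interpret primeideal \<pp> "integer_ring L" using pp by (simp add: prime_over_def)
  show sub: "\<pp> \<subseteq> integers L" using a_subset by simp
  show "0 \<in> \<pp>" using additive_subgroup.zero_closed[OF is_additive_subgroup] by simp
  show plus: "x \<in> \<pp> \<Longrightarrow> y \<in> \<pp> \<Longrightarrow> x + y \<in> \<pp>" for x y using additive_subgroup.a_closed[OF is_additive_subgroup, of x y] by simp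
  show times: "x \<in> integers L \<Longrightarrow> y \<in> \<pp> \<Longrightarrow> x * y \<in> \<pp>" for x y using I_l_closed[of y x] by simp
  show "x \<in> \<pp> \<Longrightarrow> y \<in> integers L \<Longrightarrow> x * y \<in> \<pp>" using times[of y x] by (simp add: mult.commute)
  show minus: "x \<in> \<pp> \<Longrightarrow> - x \<in> \<pp>" for x
    using times[of "- 1" x] integers_closed(3,6)[OF L] by auto
  show "x \<in> \<pp> \<Longrightarrow> y \<in> \<pp> \<Longrightarrow> x - y \<in> \<pp>" using plus[OF _ minus, of x y] by simp
  show "of_R r \<in> \<pp> \<longleftrightarrow> P dvd r" using pp by (auto simp: prime_over_def)
  show "x \<in> integers L \<Longrightarrow> y \<in> integers L \<Longrightarrow> x * y \<in> \<pp> \<Longrightarrow> x \<in> \<pp> \<or> y \<in> \<pp>"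
    using I_prime[of x y] by simp
  show "1 \<notin> \<pp>"
  proof
    assume "1 \<in> \<pp>"
    then have "integers L \<subseteq> \<pp>" using times[of _ 1] by auto
    then show False using I_notcarr sub by auto
  qed
qed

lemma prime_overI:
  assumes L: "intermediate L" and "\<pp> \<subseteq> integers L" "0 \<in> \<pp>" "\<And>x y. x \<in> \<pp> \<Longrightarrow> y \<in> \<pp> \<Longrightarrow> x + y \<in> \<pp>"
    and times: "\<And>x y. x \<in> integers L \<Longrightarrow> y \<in> \<pp> \<Longrightarrow> x * y \<in> \<pp>"
    and "\<And>x y. x \<in> integers L \<Longrightarrow> y \<in> integers L \<Longrightarrow> x * y \<in> \<pp> \<Longrightarrow> x \<in> \<pp> \<or> y \<in> \<pp>"
    and "1 \<notin> \<pp>" "\<And>r. of_R r \<in> \<pp> \<longleftrightarrow> P dvd r"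
  shows "prime_over L P \<pp>"
proof -
  interpret cring "integer_ring L" by (rule integer_ring_cring[OF L])
  have minus: "- x \<in> \<pp>" if "x \<in> \<pp>" for x
    using times[of "- 1" x] integers_closed(3,6)[OF L] that by auto
  have "primeideal \<pp> (integer_ring L)"
  proof (rule primeidealI)
    have "subgroup \<pp> (add_monoid (integer_ring L))"
    proof (rule add.subgroupI)
      fix a assume a: "a \<in> \<pp>"
      then have "\<ominus>\<^bsub>integer_ring L\<^esub> a = - a"
        using assms(2) integers_closed(6)[OF L] by (intro minus_equality) auto
      then show "\<ominus>\<^bsub>integer_ring L\<^esub> a \<in> \<pp>" using minus a by simp
    qed (use assms in auto)
    moreover have "y * x \<in> \<pp>" if "x \<in> integers L" "y \<in> \<pp>" for x y
      using times[OF that] by (simp add: mult.commute)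
    ultimately show "ideal \<pp> (integer_ring L)"
      using times by (intro idealI ring_axioms) auto
    show "cring (integer_ring L)" by (rule cring_axioms)
    show "carrier (integer_ring L) \<noteq> \<pp>" using assms(7) integers_closed(3)[OF L] by auto
  qed (use assms(6) in auto)
  then show ?thesis using assms(8) by (auto simp: prime_over_def)
qed

lemma prime_over_sum:
  assumes "intermediate L" "prime_over L P \<pp>" "\<And>i. i \<in> I \<Longrightarrow> f i \<in> \<pp>"
  shows "sum f I \<in> \<pp>"
  using assms(3) by (induction I rule: infinite_finite_induct) (auto simp: prime_overD[OF assms(1,2)])

lemma prime_over_prod:
  assumes L: "intermediate L" and pp: "prime_over L P \<pp>" and "finite I" "\<And>i. i \<in> I \<Longrightarrow> f i \<in> integers L"
    "prod f I \<in> \<pp>"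
  shows "\<exists>i\<in>I. f i \<in> \<pp>"
  using assms(3-)
proof (induction I)
  case (insert i I)
  then show ?case
    using prime_overD(9)[OF L pp, of "f i" "prod f I"] integers_prod[OF L, of I f] by auto
qed (use prime_overD(10)[OF L pp] in simp)

text \<open>By Zorn's lemma there is an ideal maximal among those that contain P but not 1; it is
  prime, and it meets R in (P) by the Bezout identity. The ideal generated by P is proper because an
  inverse of P would be an integral element of the base field, hence in R.\<close>

lemma prime_over_exists:
  assumes L: "intermediate L" and P: "irreducible P"
  shows "\<exists>\<pp>. prime_over L P \<pp>"
proof -
  note cl = integers_closed[OF L]
  define ideals where "ideals = {J. J \<subseteq> integers L \<and> of_R P \<in> J \<and> 1 \<notin> J \<and> (\<forall>x\<in>J. \<forall>y\<in>J. x + y \<in> J) \<and>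
    (\<forall>x\<in>integers L. \<forall>y\<in>J. x * y \<in> J)}"
  let ?PR = "{of_R P * w | w. w \<in> integers L}"
  have "1 \<notin> ?PR"
  proof
    assume "1 \<in> ?PR"
    then obtain w where w: "w \<in> integers L" "of_R P * w = 1" by auto
    have "P \<noteq> 0" using P by auto
    then have "w = inverse (of_R P)" using w(2) by (metis inverse_unique)
    also have "\<dots> = to_ac (inverse (to_fract P))" by (simp add: of_R_def)
    finally have wK: "w = to_ac (inverse (to_fract P))" .
    then have "integral (to_ac (inverse (to_fract P)))" using w(1) unfolding integers_altdef by blast
    then obtain s where "w = of_R s" using integral_in_base wK by blast
    then have "of_R (P * s) = of_R 1" using w(2) by (simp add: of_R.hom_mult)
    then have "P * s = 1" by simp
    then show False using P by (metis dvd_triv_left irreducible_def)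
  qed
  moreover have "?PR \<subseteq> integers L" by (auto intro!: cl)
  moreover have "of_R P \<in> ?PR" using cl(3) by (intro CollectI exI[of _ 1]) simp
  moreover have "x + y \<in> ?PR" if "x \<in> ?PR" "y \<in> ?PR" for x y
  proof -
    obtain v w where "x = of_R P * v" "y = of_R P * w" "v \<in> integers L" "w \<in> integers L"
      using \<open>x \<in> ?PR\<close> \<open>y \<in> ?PR\<close> by blast
    then show ?thesis using cl(4) by (intro CollectI exI[of _ "v + w"]) (simp add: distrib_left)
  qed
  moreover have "x * y \<in> ?PR" if "x \<in> integers L" "y \<in> ?PR" for x y
  proof -
    obtain w where "y = of_R P * w" "w \<in> integers L" using \<open>y \<in> ?PR\<close> by blast
    then show ?thesis using cl(5) that(1) by (intro CollectI exI[of _ "x * w"]) (simp add: mult_ac)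
  qed
  ultimately have "?PR \<in> ideals" unfolding ideals_def by blast
  then have ne: "ideals \<noteq> {}" by blast
  have "\<Union>C \<in> ideals" if C: "C \<noteq> {}" "subset.chain ideals C" for C
  proof -
    have CI: "J \<in> ideals" if "J \<in> C" for J using C(2) that by (auto simp: subset.chain_def)
    have "x + y \<in> \<Union>C" if xy: "x \<in> \<Union>C" "y \<in> \<Union>C" for x y
    proof -
      obtain U W where UW: "U \<in> C" "x \<in> U" "W \<in> C" "y \<in> W" using xy by blast
      have "U \<subseteq> W \<or> W \<subseteq> U" using C(2) UW by (auto simp: subset_chain_def)
      then obtain Z where Z: "Z \<in> C" "x \<in> Z" "y \<in> Z" using UW by blast
      then have "x + y \<in> Z" using CI[OF Z(1)] unfolding ideals_def by blast
      then show ?thesis using Z(1) by blast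
    qed
    then show ?thesis using CI C(1) unfolding ideals_def by blast
  qed
  with ne obtain M where M: "M \<in> ideals" "\<And>U. U \<in> ideals \<Longrightarrow> M \<subseteq> U \<Longrightarrow> U = M"
    using subset_Zorn_nonempty[of ideals] by blast
  have MR: "M \<subseteq> integers L" "of_R P \<in> M" "1 \<notin> M" and Madd: "\<And>x y. x \<in> M \<Longrightarrow> y \<in> M \<Longrightarrow> x + y \<in> M"
    and Mmult: "\<And>x y. x \<in> integers L \<Longrightarrow> y \<in> M \<Longrightarrow> x * y \<in> M"
    using M(1) unfolding ideals_def by blast+
  have M0: "0 \<in> M" using Mmult[OF cl(2) MR(2)] by simp
  have "prime_over L P M"
  proof (rule prime_overI[OF L MR(1) M0 Madd Mmult _ MR(3)])
    fix x y assume xy: "x \<in> integers L" "y \<in> integers L" "x * y \<in> M"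
    show "x \<in> M \<or> y \<in> M"
    proof (rule disjCI)
      assume y: "y \<notin> M"
      \<comment> \<open>The ideal generated by M and y; maximality forces it to contain 1.\<close>
      define U where "U = {m + y * w | m w. m \<in> M \<and> w \<in> integers L}"
      have MU: "M \<subseteq> U" unfolding U_def using cl(2) by (force intro: exI[of _ 0])
      have "y \<in> U" unfolding U_def using M0 cl(3) by (force intro: exI[of _ 0] exI[of _ 1])
      then have "U \<noteq> M" using y by blast
      then have "U \<notin> ideals" using M(2) MU by blast
      moreover have "U \<subseteq> integers L" unfolding U_def using MR(1) xy(2) by (auto intro!: cl)
      moreover have "a + b \<in> U" if "a \<in> U" "b \<in> U" for a b
      proof -
        obtain m w m' w' where "a = m + y * w" "b = m' + y * w'" "m \<in> M" "m' \<in> M" "w \<in> integers L" "w' \<in> integers L"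
          using \<open>a \<in> U\<close> \<open>b \<in> U\<close> unfolding U_def by blast
        then have "a + b = (m + m') + y * (w + w')" "m + m' \<in> M" "w + w' \<in> integers L"
          by (auto simp: algebra_simps Madd cl)
        then show ?thesis unfolding U_def by blast
      qed
      moreover have "a * b \<in> U" if "a \<in> integers L" "b \<in> U" for a b
      proof -
        obtain m w where "b = m + y * w" "m \<in> M" "w \<in> integers L"
          using \<open>b \<in> U\<close> unfolding U_def by blast
        then have "a * b = a * m + y * (a * w)" "a * m \<in> M" "a * w \<in> integers L"
          using that by (auto simp: algebra_simps Mmult cl)
        then show ?thesis unfolding U_def by blast
      qed
      ultimately have "1 \<in> U" using MU MR(2) unfolding ideals_def by blast
      then obtain m w where mw: "1 = m + y * w" "m \<in> M" "w \<in> integers L" unfolding U_def by blast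
      have "x = x * (m + y * w)" by (simp flip: mw(1))
      also have "\<dots> = x * m + w * (x * y)" by (simp add: algebra_simps)
      finally show "x \<in> M" using Madd Mmult mw xy by metis
    qed
  next
    fix r
    show "of_R r \<in> M \<longleftrightarrow> P dvd r"
    proof
      assume "P dvd r"
      then obtain s where "r = s * P" by (metis dvdE mult.commute)
      then show "of_R r \<in> M" using Mmult[OF cl(1) MR(2)] by (simp add: of_R.hom_mult)
    next
      assume r: "of_R r \<in> M"
      show "P dvd r"
      proof (rule ccontr)
        assume "\<not> P dvd r"
        then obtain u v where "u * P + v * r = 1" by (rule irreducible_bezout[OF P])
        then have "of_R u * of_R P + of_R v * of_R r = 1"
          by (metis of_R.hom_add of_R.hom_mult of_R.hom_one)
        then show False using Madd Mmult cl(1) MR r by metis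
      qed
    qed
  qed
  then show ?thesis ..
qed

section \<open>Frobenius elements\<close>

definition is_frobenius :: "'k::{field,finite} poly fract alg_closure set \<Rightarrow> 'k poly \<Rightarrow> 'k poly fract alg_closure set
    \<Rightarrow> ('k poly fract alg_closure \<Rightarrow> 'k poly fract alg_closure) \<Rightarrow> bool" where
  "is_frobenius L P \<pp> \<phi> \<longleftrightarrow> \<phi> \<in> gal L \<and> (\<forall>x\<in>integers L. \<phi> x - x ^ (CARD('k) ^ degree P) \<in> \<pp>)"

context
  fixes L :: "'k::{field,finite} poly fract alg_closure set"
  assumes L: "finite_galois L"
begin

lemma gal_of_R: "\<sigma> \<in> gal L \<Longrightarrow> \<sigma> (of_R r) = of_R r"
  using embedding_onD(1)[OF galD(1)[OF L] galois_intermediate[OF L]] by (simp add: of_R_def)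

lemma gal_integers:
  assumes s: "\<sigma> \<in> gal L" and x: "x \<in> integers L"
  shows "\<sigma> x \<in> integers L"
proof -
  obtain f :: "'k poly poly" where f: "lead_coeff f = 1" "poly (map_poly of_R f) x = 0" and xL: "x \<in> L"
    using x by (auto simp: integers_def)
  have "poly (map_poly of_R f) (\<sigma> x) = 0"
    using embedding_on_root[OF galD(1)[OF L s] galois_intermediate[OF L] xL, of "map_poly to_fract f"] f(2)
    by (simp add: map_poly_of_R)
  then show ?thesis using f(1) galD(5)[OF L s xL] by (auto simp: integers_def)
qed

lemma integers_fixed:
  assumes "x \<in> integers L" "\<And>\<sigma>. \<sigma> \<in> gal L \<Longrightarrow> \<sigma> x = x"
  shows "\<exists>r. x = of_R r"
proof -
  have "x \<in> range to_ac" using gal_fixed[OF L] assms integers_subset by blast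
  then show ?thesis using integral_in_base assms(1) by (auto simp: integers_altdef)
qed

lemma gal_compose_bij:
  assumes "\<tau> \<in> gal L"
  shows "bij_betw (compose L \<tau>) (gal L) (gal L)"
proof -
  have "inj_on (compose L \<tau>) (gal L)"
  proof (rule inj_onI)
    fix \<sigma> \<rho> assume a: "\<sigma> \<in> gal L" "\<rho> \<in> gal L" "compose L \<tau> \<sigma> = compose L \<tau> \<rho>"
    have "\<sigma> x = \<rho> x" if "x \<in> L" for x
    proof -
      have "\<tau> (\<sigma> x) = \<tau> (\<rho> x)" using fun_cong[OF a(3), of x] that by (simp add: compose_def)
      then show ?thesis using inj_onD[OF galD(4)[OF L assms]] galD(5)[OF L] a(1,2) that by blast
    qed
    then show "\<sigma> = \<rho>" using gal_eqI[OF L a(1,2)] by blast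
  qed
  moreover have "compose L \<tau> ` gal L \<subseteq> gal L" using gal_compose[OF L assms] by blast
  ultimately show ?thesis using gal_finite[OF L] by (simp add: bij_betw_def endo_inj_surj)
qed

lemma trace_in_R:
  assumes x: "x \<in> integers L"
  shows "\<exists>r. (\<Sum>\<sigma>\<in>gal L. \<sigma> x) = of_R r"
proof (rule integers_fixed)
  note LI = galois_intermediate[OF L]
  have xL: "x \<in> L" using x integers_subset by blast
  show "(\<Sum>\<sigma>\<in>gal L. \<sigma> x) \<in> integers L" using gal_integers[OF _ x] by (intro integers_sum[OF LI])
  fix \<tau> assume t: "\<tau> \<in> gal L"
  have "\<tau> (\<Sum>\<sigma>\<in>gal L. \<sigma> x) = (\<Sum>\<sigma>\<in>gal L. \<tau> (\<sigma> x))"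
    using galD(5)[OF L] xL by (intro embedding_on_sum[OF galD(1)[OF L t] LI])
  also have "\<dots> = (\<Sum>\<sigma>\<in>gal L. compose L \<tau> \<sigma> x)" using xL by (simp add: compose_def)
  also have "\<dots> = (\<Sum>\<sigma>\<in>gal L. \<sigma> x)" using gal_compose_bij[OF t] by (rule sum.reindex_bij_betw)
  finally show "\<tau> (\<Sum>\<sigma>\<in>gal L. \<sigma> x) = (\<Sum>\<sigma>\<in>gal L. \<sigma> x)" .
qed

text \<open>The coefficients are integral and fixed by the group, hence in R. This product is used
  instead of the minimal polynomial because each of its factors names an automorphism, as the
  covering arguments require.\<close>

lemma conjugates_poly_over_R:
  assumes x: "x \<in> integers L"
  shows "\<exists>f. map_poly of_R f = (\<Prod>\<sigma>\<in>gal L. [:- \<sigma> x, 1:])"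
proof -
  note LI = galois_intermediate[OF L]
  have xL: "x \<in> L" using x integers_subset by blast
  define F where "F = (\<Prod>\<sigma>\<in>gal L. [:- \<sigma> x, 1:])"
  have "\<exists>r. coeff F n = of_R r" for n
  proof (rule integers_fixed)
    show "coeff F n \<in> integers L" unfolding F_def
      using gal_integers[OF _ x] by (intro coeff_prod_linear_closed integers_closed[OF LI])
    fix \<tau> assume t: "\<tau> \<in> gal L"
    note te = galD(1)[OF L t]
    have "map_poly \<tau> F = (\<Prod>\<sigma>\<in>gal L. [:- \<tau> (\<sigma> x), 1:])"
      unfolding F_def using galD(5)[OF L] xL by (intro map_poly_embedding_prod_linear[OF te LI])
    also have "\<dots> = (\<Prod>\<sigma>\<in>gal L. [:- compose L \<tau> \<sigma> x, 1:])" using xL by (simp add: compose_def)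
    also have "\<dots> = F" unfolding F_def using gal_compose_bij[OF t] by (rule prod.reindex_bij_betw)
    finally have "coeff (map_poly \<tau> F) n = coeff F n" by simp
    then show "\<tau> (coeff F n) = coeff F n" by (simp add: coeff_map_poly embedding_onD(2)[OF te LI])
  qed
  then obtain r where r: "\<And>n. coeff F n = of_R (r n)" by metis
  have "map_poly of_R (map_poly (\<lambda>c. the_inv of_R c) F) = F"
  proof (rule poly_eqI)
    fix n
    have inj: "inj (of_R :: 'k poly \<Rightarrow> _)" by (simp add: inj_def)
    \<comment> \<open>\<open>map_poly\<close> acts coefficientwise only for functions that send 0 to
      0.\<close>
    have "the_inv of_R (0 :: 'k poly fract alg_closure) = (0 :: 'k poly)"
      using the_inv_f_f[OF inj, of 0] by simp
    then show "coeff (map_poly of_R (map_poly (\<lambda>c. the_inv of_R c) F)) n = coeff F n"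
      by (simp add: coeff_map_poly r the_inv_f_f[OF inj])
  qed
  then show ?thesis unfolding F_def by blast
qed

text \<open>Additivity of the Q-th power and the congruence of r^Q with r make the sets
  \<open>V \<sigma>\<close> submodules. They cover because the polynomial f with the roots
  \<open>\<sigma> x\<close> has f(x^Q) congruent to f(x)^Q = 0 modulo \<open>\<pp>\<close>, so that
  some factor \<open>x ^ Q - \<sigma> x\<close> lies in \<open>\<pp>\<close>.\<close>

lemma frobenius_exists:
  assumes P: "irreducible P" and card: "card (gal L) \<le> CARD('k) ^ degree P" and pp: "prime_over L P \<pp>"
  shows "\<exists>\<phi>. is_frobenius L P \<pp> \<phi>"
proof -
  note LI = galois_intermediate[OF L]
  note cl = integers_closed[OF LI] and p = prime_overD[OF LI pp]
  define Q where "Q = CARD('k) ^ degree P"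
  define V where "V \<sigma> = {x \<in> integers L. \<sigma> x - x ^ Q \<in> \<pp>}" for \<sigma>
  have fermat: "of_R (r - r ^ Q) \<in> \<pp>" for r
    using residue_fermat[OF P, of r] by (simp add: p(8) Q_def dvd_diff_commute)
  have "\<exists>\<phi>\<in>gal L. integers L \<subseteq> V \<phi>"
  proof (rule submodule_cover[OF P gal_finite[OF L] card cl(2)])
    show "x + y \<in> integers L" if "x \<in> integers L" "y \<in> integers L" for x y using that by (rule cl)
    show "of_R r * x \<in> integers L" if "x \<in> integers L" for r x using that by (intro cl)
    fix \<sigma> assume s: "\<sigma> \<in> gal L"
    note se = embedding_onD[OF galD(1)[OF L s] LI]
    have RL: "x \<in> L" if "x \<in> integers L" for x using that integers_subset by blast
    show "x + y \<in> V \<sigma>" if "x \<in> V \<sigma>" "y \<in> V \<sigma>" for x y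
    proof -
      have "\<sigma> (x + y) - (x + y) ^ Q = (\<sigma> x - x ^ Q) + (\<sigma> y - y ^ Q)"
        using that by (simp add: V_def se RL Q_def power_card_power_add)
      then show ?thesis using that cl p(3) by (simp add: V_def)
    qed
    \<comment> \<open>The second premise has two sources: x in \<open>V \<sigma>\<close>, or r =
      P.\<close>
    have smult: "of_R r * x \<in> V \<sigma>" if x: "x \<in> integers L" and "of_R r * (\<sigma> x - x ^ Q) \<in> \<pp>" for r x
    proof -
      have "\<sigma> (of_R r * x) - (of_R r * x) ^ Q = of_R r * (\<sigma> x - x ^ Q) + of_R (r - r ^ Q) * x ^ Q"
        using x RL[OF x] RL[OF cl(1)]
        by (simp add: se gal_of_R[OF s] power_mult_distrib of_R.hom_minus of_R.hom_power algebra_simps)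
      moreover have "of_R (r - r ^ Q) * x ^ Q \<in> \<pp>" using fermat x by (intro p(5) cl)
      ultimately show ?thesis using that cl p(3) by (simp add: V_def)
    qed
    show "of_R r * x \<in> V \<sigma>" if "x \<in> V \<sigma>" for r x
      using that by (intro smult p(4) cl) (auto simp: V_def)
    show "of_R P * x \<in> V \<sigma>" if x: "x \<in> integers L" for x
      using x gal_integers[OF s x] p(8)[of P] by (intro smult p(5) cl) auto
  next
    show "integers L \<subseteq> (\<Union>\<sigma>\<in>gal L. V \<sigma>)"
    proof
      fix x assume x: "x \<in> integers L"
      obtain f where f: "map_poly of_R f = (\<Prod>\<sigma>\<in>gal L. [:- \<sigma> x, 1:])"
        using conjugates_poly_over_R[OF x] by blast
      have "(\<lambda>x\<in>L. x) x = x" using x integers_subset by auto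
      then have "(\<Prod>\<sigma>\<in>gal L. x - \<sigma> x) = 0"
        using gal_id[OF L] by (intro prod_zero[OF gal_finite[OF L]] bexI[of _ "\<lambda>x\<in>L. x"]) auto
      then have "poly (map_poly of_R f) x = 0" by (simp add: f poly_prod)
      then have "0 = (\<Sum>i\<le>degree f. of_R (coeff f i) * x ^ i) ^ Q"
        by (simp add: poly_altdef Q_def)
      also have "\<dots> = (\<Sum>i\<le>degree f. (of_R (coeff f i) * x ^ i) ^ Q)"
        unfolding Q_def by (rule power_card_power_sum)
      finally have z: "(\<Sum>i\<le>degree f. (of_R (coeff f i) * x ^ i) ^ Q) = 0" by simp
      have "poly (map_poly of_R f) (x ^ Q) =
          (\<Sum>i\<le>degree f. of_R (coeff f i) * (x ^ Q) ^ i) - (\<Sum>i\<le>degree f. (of_R (coeff f i) * x ^ i) ^ Q)"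
        unfolding z by (simp add: poly_altdef)
      also have "\<dots> = (\<Sum>i\<le>degree f. of_R (coeff f i - coeff f i ^ Q) * (x ^ Q) ^ i)"
        unfolding sum_subtractf[symmetric]
        by (intro sum.cong refl) (simp add: of_R.hom_minus of_R.hom_power power_mult_distrib
            left_diff_distrib power_mult[symmetric] mult.commute[of Q])
      also have "\<dots> \<in> \<pp>"
        using fermat x by (intro prime_over_sum[OF LI pp] p(5) cl)
      finally have "(\<Prod>\<sigma>\<in>gal L. x ^ Q - \<sigma> x) \<in> \<pp>" by (simp add: f poly_prod)
      then obtain \<sigma> where s: "\<sigma> \<in> gal L" "x ^ Q - \<sigma> x \<in> \<pp>"
        using prime_over_prod[OF LI pp gal_finite[OF L], of "\<lambda>\<sigma>. x ^ Q - \<sigma> x"] cl(7,8) x gal_integers[OF _ x]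
        by blast
      then have "\<sigma> x - x ^ Q \<in> \<pp>" using p(6)[OF s(2)] by simp
      then show "x \<in> (\<Union>\<sigma>\<in>gal L. V \<sigma>)" using s(1) x by (auto simp: V_def)
    qed
  qed
  then show ?thesis by (auto simp: is_frobenius_def V_def Q_def)
qed

text \<open>The lowest nonzero coefficient of an equation for z over R is a multiple of z. As a
  consequence, z lies in primes over finitely many P only.\<close>

lemma integers_divides_R:
  assumes z: "z \<in> integers L" "z \<noteq> 0"
  shows "\<exists>r\<noteq>0. \<exists>w\<in>integers L. of_R r = z * w"
proof -
  obtain f :: "'k poly poly" where f: "lead_coeff f = 1" "poly (map_poly of_R f) z = 0"
    using z(1) unfolding integers_def by blast
  have "f \<noteq> 0" using f(1) by auto
  then show ?thesis using f(2)
  proof (induction f)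
    case (pCons c f)
    let ?v = "poly (map_poly of_R f) z"
    have e: "of_R c + z * ?v = 0"
      using pCons.prems by (simp add: Polynomial.map_poly_pCons[where f = of_R, OF of_R.hom_zero])
    show ?case
    proof (cases "c = 0")
      case True
      then have "?v = 0" using e z(2) by simp
      moreover have "f \<noteq> 0" using pCons.hyps True by simp
      ultimately show ?thesis by (rule pCons.IH[rotated])
    next
      case False
      have "of_R c = z * (- ?v)" using e by (simp add: eq_neg_iff_add_eq_0)
      moreover have "- ?v \<in> integers L"
        using z(1) by (intro integers_closed[OF galois_intermediate[OF L]] integers_poly[OF galois_intermediate[OF L]])
      ultimately show ?thesis using False by blast
    qed
  qed simp
qed

lemma eventually_notin_prime:
  assumes "z \<in> integers L" "z \<noteq> 0"
  shows "\<forall>\<^sub>F P in primes_filter. \<forall>\<pp>. prime_over L P \<pp> \<longrightarrow> z \<notin> \<pp>"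
proof -
  obtain r w where r: "r \<noteq> 0" "w \<in> integers L" "of_R r = z * w"
    using integers_divides_R[OF assms] by blast
  from eventually_not_dvd[OF r(1)] show ?thesis
  proof eventually_elim
    case (elim P)
    show ?case
    proof (intro allI impI notI)
      fix \<pp> assume pp: "prime_over L P \<pp>" "z \<in> \<pp>"
      note p = prime_overD[OF galois_intermediate[OF L] pp(1)]
      have "of_R r \<in> \<pp>" unfolding r(3) using pp(2) r(2) by (rule p(5))
      then show False using p(8) elim by blast
    qed
  qed
qed

lemma integers_separate_gal:
  assumes "\<sigma> \<in> gal L" "\<tau> \<in> gal L" "\<sigma> \<noteq> \<tau>"
  shows "\<exists>x\<in>integers L. \<sigma> x \<noteq> \<tau> x"
proof -
  note LI = galois_intermediate[OF L]
  obtain x where x: "x \<in> L" "\<sigma> x \<noteq> \<tau> x" using gal_eqI[OF L assms(1,2)] assms(3) by blast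
  obtain c where c: "c \<noteq> 0" "integral (of_R c * x)" by (rule integral_denominator)
  have cL: "of_R c \<in> L" by (simp add: of_R_def intermediateD[OF LI])
  have sc: "\<rho> (of_R c * x) = of_R c * \<rho> x" if "\<rho> \<in> gal L" for \<rho>
    using embedding_onD(5)[OF galD(1)[OF L that] LI cL x(1)] gal_of_R[OF that] by simp
  have "\<sigma> (of_R c * x) \<noteq> \<tau> (of_R c * x)"
    unfolding sc[OF assms(1)] sc[OF assms(2)] using x(2) c(1) by simp
  moreover have "of_R c * x \<in> integers L"
    using c(2) intermediateD(5)[OF LI cL x(1)] by (simp add: integers_altdef)
  ultimately show ?thesis by blast
qed

text \<open>Distinct automorphisms differ at some integral x. If both are Frobenius elements at
  \<open>\<pp>\<close>, then \<open>\<pp>\<close> contains the nonzero difference of the two values;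
  this concerns finitely many P for each of the finitely many pairs.\<close>

lemma eventually_frobenius_unique:
  "\<forall>\<^sub>F P in primes_filter. \<forall>\<pp> \<phi> \<psi>. prime_over L P \<pp> \<longrightarrow> is_frobenius L P \<pp> \<phi> \<longrightarrow> is_frobenius L P \<pp> \<psi> \<longrightarrow> \<phi> = \<psi>"
proof -
  note LI = galois_intermediate[OF L]
  have "\<forall>\<^sub>F P in primes_filter. \<forall>\<pp>. prime_over L P \<pp> \<longrightarrow> \<not> (is_frobenius L P \<pp> \<phi> \<and> is_frobenius L P \<pp> \<psi>)"
    if st: "\<phi> \<in> gal L" "\<psi> \<in> gal L" "\<phi> \<noteq> \<psi>" for \<phi> \<psi>
  proof -
    obtain x where x: "x \<in> integers L" "\<phi> x \<noteq> \<psi> x" using integers_separate_gal[OF st] by blast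
    have "\<phi> x - \<psi> x \<in> integers L" "\<phi> x - \<psi> x \<noteq> 0"
      using x gal_integers[OF st(1) x(1)] gal_integers[OF st(2) x(1)] integers_closed(7)[OF LI] by simp_all
    from eventually_notin_prime[OF this] show ?thesis
    proof eventually_elim
      case (elim P)
      show ?case
      proof (intro allI impI notI)
        fix \<pp> assume pp: "prime_over L P \<pp>" "is_frobenius L P \<pp> \<phi> \<and> is_frobenius L P \<pp> \<psi>"
        have "(\<phi> x - x ^ (CARD('k) ^ degree P)) - (\<psi> x - x ^ (CARD('k) ^ degree P)) \<in> \<pp>"
          using pp(2) x(1) by (intro prime_overD(7)[OF LI pp(1), of "\<phi> x - _" "\<psi> x - _"]) (simp_all add: is_frobenius_def)
        then show False using elim pp(1) by simp
      qed
    qed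
  qed
  then have "\<forall>st\<in>{st \<in> gal L \<times> gal L. fst st \<noteq> snd st}. \<forall>\<^sub>F P in primes_filter.
      \<forall>\<pp>. prime_over L P \<pp> \<longrightarrow> \<not> (is_frobenius L P \<pp> (fst st) \<and> is_frobenius L P \<pp> (snd st))"
    by auto
  then have "\<forall>\<^sub>F P in primes_filter. \<forall>st\<in>{st \<in> gal L \<times> gal L. fst st \<noteq> snd st}.
      \<forall>\<pp>. prime_over L P \<pp> \<longrightarrow> \<not> (is_frobenius L P \<pp> (fst st) \<and> is_frobenius L P \<pp> (snd st))"
    using gal_finite[OF L] by (intro eventually_ball_finite) auto
  then show ?thesis
    by eventually_elim (force simp: is_frobenius_def)
qed

lemma eventually_card_gal: "\<forall>\<^sub>F P :: 'k poly in primes_filter. card (gal L) \<le> CARD('k) ^ degree P"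
  using eventually_degree_ge[of "card (gal L)"]
proof eventually_elim
  case (elim P)
  have "CARD('k) \<ge> 2" using card_mono[of "UNIV :: 'k set" "{0, 1}"] by simp
  then have "2 ^ degree P \<le> CARD('k) ^ degree P" by (intro power_mono) auto
  moreover have "degree P < 2 ^ degree P" by (rule less_exp)
  ultimately show ?case using elim by linarith
qed

text \<open>The orbit stays in a finite set of roots, and injectivity of \<open>\<sigma>\<close>
  turns a repetition into a return to x.\<close>

lemma gal_orbit_periodic:
  assumes s: "\<sigma> \<in> gal L" and x: "x \<in> L"
  shows "\<exists>m>0. (\<sigma> ^^ m) x = x"
proof -
  obtain f where f: "irreducible f" "poly (map_poly to_ac f) x = 0"
    "{y. poly (map_poly to_ac f) y = 0} \<subseteq> L" (is "?S \<subseteq> L")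
    using galois_element_root[OF L x] by metis
  have it: "(\<sigma> ^^ n) x \<in> ?S" for n
  proof (induction n)
    case (Suc n)
    then show ?case
      using embedding_on_root[OF galD(1)[OF L s] galois_intermediate[OF L], of "(\<sigma> ^^ n) x" f] f(3) by auto
  qed (use f(2) in simp)
  have "\<not> inj (\<lambda>n. (\<sigma> ^^ n) x)"
  proof
    assume "inj (\<lambda>n. (\<sigma> ^^ n) x)"
    then have "infinite (range (\<lambda>n. (\<sigma> ^^ n) x))" using finite_imageD infinite_UNIV_nat by blast
    then show False using it finite_roots_irreducible[OF f(1)] by (meson finite_subset image_subsetI)
  qed
  then obtain i m where im: "m > 0" "(\<sigma> ^^ (i + m)) x = (\<sigma> ^^ i) x"
    by (auto simp: inj_def) (metis less_imp_add_positive nat_neq_iff)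
  have "(\<sigma> ^^ (i + m)) x = (\<sigma> ^^ i) x \<Longrightarrow> (\<sigma> ^^ m) x = x"
  proof (induction i)
    case (Suc i)
    have "\<sigma> ((\<sigma> ^^ (i + m)) x) = \<sigma> ((\<sigma> ^^ i) x)" using Suc.prems by simp
    then show ?case using inj_onD[OF galD(4)[OF L s]] it f(3) Suc.IH by blast
  qed simp
  then show ?thesis using im by blast
qed

text \<open>The product \<open>\<delta>\<close> of the differences \<open>b \<sigma> - \<sigma> (b \<sigma>)\<close> over the nontrivial \<open>\<sigma>\<close> plays the role of
  the discriminant: if all conjugates of \<open>x\<close> lie in \<open>\<pp>\<close>, then the traces of its multiples are
  divisible by \<open>P\<close>, and \<open>\<delta> * x\<close> is a combination of such traces.\<close>

lemma eventually_unramified: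
  "\<forall>\<^sub>F P in primes_filter. \<forall>\<pp>. prime_over L P \<pp> \<longrightarrow> unramified_prime_over L P \<pp>"
proof -
  note LI = galois_intermediate[OF L]
  note cl = integers_closed[OF LI]
  define e where "e = (\<lambda>x\<in>L. x)"
  have e: "e \<in> gal L" unfolding e_def by (rule gal_id[OF L])
  have ex: "e x = x" if "x \<in> integers L" for x using that integers_subset by (auto simp: e_def)
  have "\<exists>x\<in>integers L. \<sigma> x \<noteq> x" if "\<sigma> \<in> gal L - {e}" for \<sigma>
    using integers_separate_gal[OF _ e, of \<sigma>] that ex by auto
  then obtain b where b: "\<And>\<sigma>. \<sigma> \<in> gal L - {e} \<Longrightarrow> b \<sigma> \<in> integers L \<and> \<sigma> (b \<sigma>) \<noteq> b \<sigma>" by metis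
  define \<delta> where "\<delta> = (\<Prod>\<sigma>\<in>gal L - {e}. b \<sigma> - \<sigma> (b \<sigma>))"
  have "\<delta> \<in> integers L" unfolding \<delta>_def using b gal_integers by (intro integers_prod[OF LI] cl(7)) blast+
  moreover have "\<delta> \<noteq> 0"
  proof
    assume "\<delta> = 0"
    then obtain \<sigma> where "\<sigma> \<in> gal L - {e}" "b \<sigma> - \<sigma> (b \<sigma>) = 0"
      unfolding \<delta>_def using gal_finite[OF L] by (auto simp: prod_zero_iff)
    then show False using b[of \<sigma>] by simp
  qed
  ultimately obtain r w where r: "r \<noteq> 0" "w \<in> integers L" "of_R r = \<delta> * w"
    using integers_divides_R by blast
  from eventually_conj[OF eventually_not_dvd[OF r(1)] eventually_irreducible] show ?thesis
  proof eventually_elim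
    case (elim P)
    then have Pr: "\<not> P dvd r" and P: "irreducible P" by auto
    show ?case
    proof (intro allI impI)
      fix \<pp> assume pp: "prime_over L P \<pp>"
      note p = prime_overD[OF LI pp]
      define PR where "PR = {of_R P * z | z. z \<in> integers L}"
      have PRd: "x - y \<in> PR" if "x \<in> PR" "y \<in> PR" for x y
        proof -
        obtain v z where "x = of_R P * v" "y = of_R P * z" "v \<in> integers L" "z \<in> integers L"
          using \<open>x \<in> PR\<close> \<open>y \<in> PR\<close> unfolding PR_def by blast
        then show ?thesis
          unfolding PR_def using cl(7) by (intro CollectI exI[of _ "v - z"]) (simp add: right_diff_distrib)
      qed
      have PRm: "x * y \<in> PR" if "x \<in> integers L" "y \<in> PR" for x y
        proof -
        obtain z where "y = of_R P * z" "z \<in> integers L" using \<open>y \<in> PR\<close> unfolding PR_def by blast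
        then show ?thesis
          unfolding PR_def using cl(5) \<open>x \<in> integers L\<close> by (intro CollectI exI[of _ "x * z"]) (simp add: mult_ac)
      qed
      \<comment> \<open>The intersection of the conjugates of \<open>\<pp>\<close>: the trace of its
        elements lies in R and in \<open>\<pp>\<close>.\<close>
      define J where "J = {x \<in> integers L. \<forall>\<sigma>\<in>gal L. \<sigma> x \<in> \<pp>}"
      have Jm: "y * x \<in> J" if xy: "x \<in> J" "y \<in> integers L" for x y
      proof -
        have "\<sigma> (y * x) \<in> \<pp>" if s: "\<sigma> \<in> gal L" for \<sigma>
        proof -
          have "\<sigma> (y * x) = \<sigma> y * \<sigma> x"
            using embedding_onD(5)[OF galD(1)[OF L s] LI] xy integers_subset by (auto simp: J_def)
          moreover have "\<sigma> x \<in> \<pp>" using xy(1) s by (simp add: J_def)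
          ultimately show ?thesis using p(4)[OF gal_integers[OF s xy(2)]] by simp
        qed
        then show ?thesis using xy cl(5) by (simp add: J_def)
      qed
      \<comment> \<open>Expanding the factor \<open>\<tau> (b \<rho>) - \<rho> (b \<rho>)\<close>
        writes the sum for \<open>insert \<rho> S\<close> as a combination of the sums for S at
        \<open>b \<rho> * x\<close> and at x; the empty product leaves the trace.\<close>
      have tr: "(\<Sum>\<tau>\<in>gal L. (\<Prod>\<sigma>\<in>S. \<tau> (b \<sigma>) - \<sigma> (b \<sigma>)) * \<tau> x) \<in> PR"
        if "finite S" "S \<subseteq> gal L - {e}" "x \<in> J" for S x
        using that
      proof (induction S arbitrary: x)
        case empty
        then have x: "x \<in> integers L" "\<And>\<sigma>. \<sigma> \<in> gal L \<Longrightarrow> \<sigma> x \<in> \<pp>" by (auto simp: J_def)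
        obtain s where s: "(\<Sum>\<sigma>\<in>gal L. \<sigma> x) = of_R s" using trace_in_R[OF x(1)] by blast
        have "of_R s \<in> \<pp>" unfolding s[symmetric] using x(2) by (rule prime_over_sum[OF LI pp])
        then obtain s' where "s = P * s'" using p(8) by blast
        then show ?case using s by (auto simp: PR_def of_R.hom_mult intro!: cl)
      next
        case (insert \<rho> S)
        have \<rho>: "\<rho> \<in> gal L" "b \<rho> \<in> integers L" using insert.prems b by auto
        let ?f = "\<lambda>\<tau>. \<Prod>\<sigma>\<in>S. \<tau> (b \<sigma>) - \<sigma> (b \<sigma>)"
        have "(\<Sum>\<tau>\<in>gal L. (\<Prod>\<sigma>\<in>insert \<rho> S. \<tau> (b \<sigma>) - \<sigma> (b \<sigma>)) * \<tau> x) =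
           (\<Sum>\<tau>\<in>gal L. ?f \<tau> * \<tau> (b \<rho> * x) - \<rho> (b \<rho>) * (?f \<tau> * \<tau> x))"
        proof (rule sum.cong[OF refl])
          fix \<tau> assume t: "\<tau> \<in> gal L"
          have "\<tau> (b \<rho> * x) = \<tau> (b \<rho>) * \<tau> x"
            using embedding_onD(5)[OF galD(1)[OF L t] LI] \<rho>(2) insert.prems(2) integers_subset
            by (auto simp: J_def)
          then show "(\<Prod>\<sigma>\<in>insert \<rho> S. \<tau> (b \<sigma>) - \<sigma> (b \<sigma>)) * \<tau> x =
            ?f \<tau> * \<tau> (b \<rho> * x) - \<rho> (b \<rho>) * (?f \<tau> * \<tau> x)"
            using insert.hyps by (simp add: algebra_simps)
        qed
        also have "\<dots> = (\<Sum>\<tau>\<in>gal L. ?f \<tau> * \<tau> (b \<rho> * x)) - \<rho> (b \<rho>) * (\<Sum>\<tau>\<in>gal L. ?f \<tau> * \<tau> x)"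
          by (simp add: sum_subtractf sum_distrib_left)
        also have "\<dots> \<in> PR"
          using insert.prems \<rho> gal_integers[OF \<rho>] by (intro PRd PRm insert.IH Jm) auto
        finally show ?case .
      qed
      have JP: "x \<in> PR" if x: "x \<in> J" for x
      proof -
        have xi: "x \<in> integers L" using x by (simp add: J_def)
        \<comment> \<open>For \<open>\<tau>\<close> other than e the factor with
          \<open>\<sigma>\<close> equal to \<open>\<tau>\<close> vanishes, so only the term
          \<open>\<delta> * x\<close> remains.\<close>
        let ?g = "\<lambda>\<tau>. (\<Prod>\<sigma>\<in>gal L - {e}. \<tau> (b \<sigma>) - \<sigma> (b \<sigma>)) * \<tau> x"
        have "(\<Sum>\<tau>\<in>gal L. ?g \<tau>) = ?g e + (\<Sum>\<tau>\<in>gal L - {e}. ?g \<tau>)"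
          using e gal_finite[OF L] by (rule sum.remove[rotated])
        also have "(\<Sum>\<tau>\<in>gal L - {e}. ?g \<tau>) = 0"
        proof (rule sum.neutral, rule ballI)
          fix \<tau> assume t: "\<tau> \<in> gal L - {e}"
          have "(\<Prod>\<sigma>\<in>gal L - {e}. \<tau> (b \<sigma>) - \<sigma> (b \<sigma>)) = 0"
            using t gal_finite[OF L] by (intro prod_zero) auto
          then show "?g \<tau> = 0" by simp
        qed
        also have "?g e = \<delta> * x"
          unfolding \<delta>_def using b by (simp add: ex xi)
        finally have "\<delta> * x \<in> PR" using tr[of "gal L - {e}" x] x gal_finite[OF L] by simp
        then have "w * (\<delta> * x) \<in> PR" by (rule PRm[OF r(2)])
        then have rx: "of_R r * x \<in> PR" by (simp add: r(3) mult_ac)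
        obtain u v where uv: "u * P + v * r = 1" using irreducible_bezout[OF P Pr] by blast
        have "x = of_R (u * P + v * r) * x" by (simp add: uv)
        also have "\<dots> = of_R v * (of_R r * x) - of_R P * (of_R (- u) * x)"
          by (simp add: of_R.hom_add of_R.hom_mult of_R.hom_uminus algebra_simps)
        also have "\<dots> \<in> PR"
        proof (rule PRd)
          show "of_R v * (of_R r * x) \<in> PR" by (rule PRm[OF cl(1) rx])
          show "of_R P * (of_R (- u) * x) \<in> PR" unfolding PR_def using cl(5)[OF cl(1) xi] by blast
        qed
        finally show ?thesis .
      qed
      \<comment> \<open>An element y outside \<open>\<pp>\<close> with as many conjugates in
        \<open>\<pp>\<close> as possible does the work of prime avoidance: if
        \<open>\<sigma> y\<close> is not in \<open>\<pp>\<close>, then \<open>\<sigma>\<close> sends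
        no integer outside \<open>\<pp>\<close> into \<open>\<pp>\<close>.\<close>
      define T where "T y = {\<sigma> \<in> gal L. \<sigma> y \<in> \<pp>}" for y
      have finT: "finite (T y)" for y using gal_finite[OF L] by (simp add: T_def)
      have "\<forall>z. z \<in> integers L \<and> z \<notin> \<pp> \<longrightarrow> card (T z) \<le> card (gal L)"
        using gal_finite[OF L] by (auto intro!: card_mono simp: T_def)
      then have "\<exists>y. (y \<in> integers L \<and> y \<notin> \<pp>) \<and> (\<forall>z. z \<in> integers L \<and> z \<notin> \<pp> \<longrightarrow> card (T z) \<le> card (T y))"
        using cl(3) p(10)
        by (intro ex_has_greatest_nat[of "\<lambda>y. y \<in> integers L \<and> y \<notin> \<pp>" 1 "\<lambda>y. card (T y)" "Suc (card (gal L))"]) (auto simp: less_Suc_eq_le)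
      then obtain y where y: "y \<in> integers L" "y \<notin> \<pp>"
        and ymax: "\<And>z. z \<in> integers L \<Longrightarrow> z \<notin> \<pp> \<Longrightarrow> card (T z) \<le> card (T y)" by blast
      have Tsub: "T z \<subseteq> T y" if z: "z \<in> integers L" "z \<notin> \<pp>" for z
      proof -
        have "\<sigma> (y * z) \<in> \<pp>" if s: "\<sigma> \<in> gal L" "\<sigma> y \<in> \<pp> \<or> \<sigma> z \<in> \<pp>" for \<sigma>
        proof -
          have "\<sigma> (y * z) = \<sigma> y * \<sigma> z"
            using embedding_onD(5)[OF galD(1)[OF L s(1)] LI] y z integers_subset by blast
          then show ?thesis
            using gal_integers[OF s(1) y(1)] gal_integers[OF s(1) z(1)] s(2) p(4,5) by auto
        qed
        then have sup: "T y \<union> T z \<subseteq> T (y * z)" by (auto simp: T_def)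
        have "y * z \<notin> \<pp>" using p(9) y z by blast
        then have "card (T (y * z)) \<le> card (T y)" using y z by (intro ymax cl)
        then have "T (y * z) = T y" using sup finT by (metis card_seteq le_sup_iff)
        then show ?thesis using sup by blast
      qed
      have yJ: "y * x \<in> J" if x: "x \<in> \<pp>" for x
      proof -
        have xi: "x \<in> integers L" using x p(1) by blast
        have "\<sigma> (y * x) \<in> \<pp>" if s: "\<sigma> \<in> gal L" for \<sigma>
        proof -
          have xL: "x \<in> L" using xi integers_subset by blast
          have "\<sigma> x \<in> \<pp>" if "\<sigma> \<notin> T y"
          proof (rule ccontr)
            assume neg: "\<sigma> x \<notin> \<pp>"
            \<comment> \<open>Once outside \<open>\<pp>\<close>, the iterates of
              \<open>\<sigma>\<close> stay outside, while periodicity brings them back to x, which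
              lies in \<open>\<pp>\<close>.\<close>
            have "(\<sigma> ^^ Suc n) x \<in> integers L \<and> (\<sigma> ^^ Suc n) x \<notin> \<pp>" for n
            proof (induction n)
              case 0
              then show ?case using neg gal_integers[OF s xi] by simp
            next
              case (Suc n)
              then have "T ((\<sigma> ^^ Suc n) x) \<subseteq> T y" by (intro Tsub) auto
              then have "\<sigma> ((\<sigma> ^^ Suc n) x) \<notin> \<pp>" using \<open>\<sigma> \<notin> T y\<close> s by (auto simp: T_def)
              then show ?case using Suc gal_integers[OF s] by simp
            qed
            moreover obtain m where "m > 0" "(\<sigma> ^^ m) x = x" using gal_orbit_periodic[OF s xL] by blast
            ultimately show False using x by (metis gr0_implies_Suc)
          qed
          moreover have "\<sigma> (y * x) = \<sigma> y * \<sigma> x"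
            using embedding_onD(5)[OF galD(1)[OF L s] LI] y(1) xi integers_subset by blast
          moreover have "\<sigma> y \<in> \<pp>" if "\<sigma> \<in> T y" using that by (simp add: T_def)
          ultimately show ?thesis
            using gal_integers[OF s y(1)] gal_integers[OF s xi] p(4,5) by metis
        qed
        then show ?thesis using y(1) xi by (auto simp: J_def intro!: cl)
      qed
      \<comment> \<open>Since y times an element of \<open>\<pp>\<close> is divisible by P, y^2
        times an element of the square of \<open>\<pp>\<close> is divisible by P^2. If P were in
        that square, y^2 would be divisible by P and lie in \<open>\<pp>\<close>.\<close>
      have "\<exists>z'\<in>integers L. y * y * z = of_R P * of_R P * z'" if "z \<in> ideal_prod (integer_ring L) \<pp> \<pp>" for z
        using that
      proof induction
        case (prod i j)
        obtain i' j' where ij: "y * i = of_R P * i'" "y * j = of_R P * j'"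
          "i' \<in> integers L" "j' \<in> integers L"
          using JP[OF yJ[OF prod(1)]] JP[OF yJ[OF prod(2)]] by (auto simp: PR_def)
        have "y * y * (i * j) = (y * i) * (y * j)" by (simp add: mult_ac)
        also have "\<dots> = of_R P * of_R P * (i' * j')" unfolding ij(1,2) by (simp add: mult_ac)
        finally show ?case using cl(5)[OF ij(3,4)] by auto
      next
        case (sum s1 s2)
        then obtain z1 z2 where "y * y * s1 = of_R P * of_R P * z1" "y * y * s2 = of_R P * of_R P * z2"
          "z1 \<in> integers L" "z2 \<in> integers L" by blast
        then have "y * y * (s1 + s2) = of_R P * of_R P * (z1 + z2)" "z1 + z2 \<in> integers L"
          by (auto simp: cl distrib_left)
        then show ?case by auto
      qed
      moreover have "\<not> (\<exists>z'\<in>integers L. y * y * of_R P = of_R P * of_R P * z')"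
      proof
        assume "\<exists>z'\<in>integers L. y * y * of_R P = of_R P * of_R P * z'"
        then obtain z' where z': "z' \<in> integers L" "of_R P * (y * y) = of_R P * (of_R P * z')"
          by (auto simp: mult_ac)
        have "P \<noteq> 0" using P by auto
        then have "y * y = of_R P * z'" using z'(2) by simp
        moreover have "of_R P * z' \<in> \<pp>" using z'(1) p(8) by (intro p(5)) auto
        ultimately show False using p(9) y by metis
      qed
      ultimately have "of_R P \<notin> ideal_prod (integer_ring L) \<pp> \<pp>" by blast
      then show "unramified_prime_over L P \<pp>" using pp by (simp add: unramified_prime_over_def)
    qed
  qed
qed

end

section \<open>Evaluation at Frobenius elements\<close>

text \<open>The bound on the group order yields a Frobenius element by
  \<open>frobenius_exists\<close>, the last condition makes it unique, and the condition on
  ramification lets \<open>ev\<close> quantify over all primes over P.\<close>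

definition good_prime :: "'k::{field,finite} poly fract alg_closure set \<Rightarrow> 'k poly \<Rightarrow> bool" where
  "good_prime L P \<longleftrightarrow> irreducible P \<and> lead_coeff P = 1 \<and> card (gal L) \<le> CARD('k) ^ degree P \<and>
     (\<forall>\<pp>. prime_over L P \<pp> \<longrightarrow> unramified_prime_over L P \<pp>) \<and>
     (\<forall>\<pp> \<phi> \<psi>. prime_over L P \<pp> \<longrightarrow> is_frobenius L P \<pp> \<phi> \<longrightarrow> is_frobenius L P \<pp> \<psi> \<longrightarrow> \<phi> = \<psi>)"

lemma eventually_good_prime:
  assumes "finite_galois L"
  shows "\<forall>\<^sub>F P in primes_filter. good_prime L P"
  using eventually_irreducible eventually_card_gal[OF assms] eventually_unramified[OF assms]
    eventually_frobenius_unique[OF assms]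
  by eventually_elim (simp add: good_prime_def)

lemma good_prime_frobenius:
  assumes L: "finite_galois L" and good: "good_prime L P" and pp: "prime_over L P \<pp>"
  shows "is_frobenius L P \<pp> (frobenius L P \<pp>)" "is_frobenius L P \<pp> \<phi> \<Longrightarrow> \<phi> = frobenius L P \<pp>"
proof -
  have uniq: "\<phi> = \<psi>" if "is_frobenius L P \<pp> \<phi>" "is_frobenius L P \<pp> \<psi>" for \<phi> \<psi>
    using good pp that unfolding good_prime_def by blast
  obtain \<phi>\<^sub>0 where "is_frobenius L P \<pp> \<phi>\<^sub>0"
    using frobenius_exists[OF L _ _ pp] good unfolding good_prime_def by blast
  then have "\<exists>!\<phi>. is_frobenius L P \<pp> \<phi>" using uniq by blast
  moreover have "frobenius L P \<pp> = (THE \<phi>. is_frobenius L P \<pp> \<phi>)"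
    by (simp add: frobenius_def is_frobenius_def)
  ultimately show "is_frobenius L P \<pp> (frobenius L P \<pp>)" using theI' by metis
  then show "is_frobenius L P \<pp> \<phi> \<Longrightarrow> \<phi> = frobenius L P \<pp>" using uniq by blast
qed

lemma good_prime_prime_over:
  "finite_galois L \<Longrightarrow> good_prime L P \<Longrightarrow> \<exists>\<pp>. prime_over L P \<pp>"
  using prime_over_exists galois_intermediate unfolding good_prime_def by blast

section \<open>Calculation with congruences at a prime\<close>

context
  fixes L :: "'k::field poly fract alg_closure set" and P \<pp>
  assumes LI: "intermediate L" and pp: "prime_over L P \<pp>"
begin

lemma prime_complement_mult: "s \<in> integers L - \<pp> \<Longrightarrow> t \<in> integers L - \<pp> \<Longrightarrow> s * t \<in> integers L - \<pp>"
  using prime_overD(9)[OF LI pp] integers_closed(5)[OF LI] by blast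

lemma cong_atI: "x - y = u / s \<Longrightarrow> u \<in> \<pp> \<Longrightarrow> s \<in> integers L - \<pp> \<Longrightarrow> cong_at L \<pp> x y"
  by (auto simp: cong_at_def)

lemma cong_at_add:
  assumes "cong_at L \<pp> x a" "cong_at L \<pp> y b"
  shows "cong_at L \<pp> (x + y) (a + b)"
proof -
  obtain u s v t where us: "u \<in> \<pp>" "s \<in> integers L - \<pp>" "x - a = u / s" and vt: "v \<in> \<pp>" "t \<in> integers L - \<pp>" "y - b = v / t"
    using assms unfolding cong_at_def by blast
  have nz: "s \<noteq> 0" "t \<noteq> 0" using us vt prime_overD(2)[OF LI pp] by auto
  have "(x + y) - (a + b) = u / s + v / t" using us vt by (simp flip: us(3) vt(3))
  also have "\<dots> = (u * t + v * s) / (s * t)" by (rule add_frac_eq[OF nz])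
  finally have "(x + y) - (a + b) = (u * t + v * s) / (s * t)" .
  moreover have "u * t + v * s \<in> \<pp>" using us vt by (intro prime_overD(3,5)[OF LI pp]) auto
  ultimately show ?thesis by (rule cong_atI) (rule prime_complement_mult[OF us(2) vt(2)])
qed

lemma cong_at_mult:
  assumes "cong_at L \<pp> x a" "cong_at L \<pp> y b" "a \<in> integers L" "b \<in> integers L"
  shows "cong_at L \<pp> (x * y) (a * b)"
proof -
  note cl = integers_closed[OF LI] and p = prime_overD[OF LI pp]
  obtain u s v t where us: "u \<in> \<pp>" "s \<in> integers L - \<pp>" "x - a = u / s" and vt: "v \<in> \<pp>" "t \<in> integers L - \<pp>" "y - b = v / t"
    using assms unfolding cong_at_def by blast
  have nz: "s \<noteq> 0" "t \<noteq> 0" using us vt p(2) by auto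
  have "x = a + u / s" "y = b + v / t" by (simp_all flip: us(3) vt(3))
  then have "x * y - a * b = u / s * (v / t) + b * (u / s) + a * (v / t)" by (simp add: algebra_simps)
  also have "\<dots> = (u * (v + b * t) + v * (a * s)) / (s * t)"
    using nz by (simp add: add_divide_distrib distrib_left) (simp add: mult_ac)
  finally have "x * y - a * b = (u * (v + b * t) + v * (a * s)) / (s * t)" .
  moreover have "u * (v + b * t) + v * (a * s) \<in> \<pp>"
    using us vt assms(3,4) p(1) by (intro p(3,5) cl) auto
  ultimately show ?thesis by (rule cong_atI) (rule prime_complement_mult[OF us(2) vt(2)])
qed

lemma cong_at_unique:
  assumes "cong_at L \<pp> x (of_R a)" "cong_at L \<pp> x (of_R b)"
  shows "P dvd a - b"
proof -
  note cl = integers_closed[OF LI] and p = prime_overD[OF LI pp]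
  obtain u s v t where us: "u \<in> \<pp>" "s \<in> integers L - \<pp>" "x - of_R a = u / s"
    and vt: "v \<in> \<pp>" "t \<in> integers L - \<pp>" "x - of_R b = v / t"
    using assms unfolding cong_at_def by blast
  have nz: "s \<noteq> 0" "t \<noteq> 0" using us vt p(2) by auto
  have "of_R (a - b) = (x - of_R b) - (x - of_R a)" by (simp add: of_R.hom_minus)
  also have "\<dots> = v / t - u / s" by (simp only: us(3) vt(3))
  finally have "(s * t) * of_R (a - b) = v * s - u * t" using nz by (simp add: field_simps)
  also have "\<dots> \<in> \<pp>" using us vt by (intro p(7,5)) auto
  finally have "s * t \<in> \<pp> \<or> of_R (a - b) \<in> \<pp>" using us vt by (intro p(9) cl) auto
  then show ?thesis using prime_complement_mult[OF us(2) vt(2)] p(8) by blast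
qed

lemma cong_at_scaled:
  assumes "c * x - c * y \<in> \<pp>" "c \<in> integers L - \<pp>"
  shows "cong_at L \<pp> x y"
proof -
  have "c \<noteq> 0" using assms prime_overD(2)[OF LI pp] by auto
  then have "x - y = (c * x - c * y) / c" by (simp add: field_simps)
  then show ?thesis using assms by (rule cong_atI)
qed

end

lemma equivariant_mapsD:
  assumes "g \<in> equivariant_maps L"
  shows "\<tau> \<in> gal L \<Longrightarrow> g \<tau> \<in> L" "\<sigma> \<in> gal L \<Longrightarrow> \<tau> \<in> gal L \<Longrightarrow>
    g (compose L (compose L \<sigma> \<tau>) (inv_into L \<sigma>)) = \<sigma> (g \<tau>)"
  using assms by (auto simp: equivariant_maps_def)

section \<open>The residue of an equivariant map at a Frobenius element\<close>

context
  fixes L :: "'k::{field,finite} poly fract alg_closure set" and P :: "'k poly"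
  assumes L: "finite_galois L" and good: "good_prime L P"
begin

lemma good_irreducible: "irreducible P"
  using good by (simp add: good_prime_def)

text \<open>Conjugating the Frobenius element \<open>\<phi>\<close> by itself gives
  \<open>\<phi>\<close>, so equivariance makes \<open>g \<phi>\<close> a fixed point of
  \<open>\<phi>\<close>. Hence y = c * \<open>g \<phi>\<close> is congruent to y^Q, and
  \<open>residue_product\<close> replaces y^Q - y by the product of the y - b, one of which lies in
  \<open>\<pp>\<close>.\<close>

lemma frobenius_fixed_residue:
  assumes pp: "prime_over L P \<pp>" and g: "g \<in> equivariant_maps L"
    and c: "of_R c * g (frobenius L P \<pp>) \<in> integers L"
  shows "\<exists>b. of_R c * g (frobenius L P \<pp>) - of_R b \<in> \<pp>"
proof -
  note LI = galois_intermediate[OF L]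
  note cl = integers_closed[OF LI] and p = prime_overD[OF LI pp]
  define \<phi> where "\<phi> = frobenius L P \<pp>"
  define Q where "Q = CARD('k) ^ degree P"
  have frob: "is_frobenius L P \<pp> \<phi>" unfolding \<phi>_def by (rule good_prime_frobenius[OF L good pp])
  then have \<phi>: "\<phi> \<in> gal L" by (simp add: is_frobenius_def)
  have "compose L (compose L \<phi> \<phi>) (inv_into L \<phi>) = \<phi>"
    using gal_inv_into[OF L \<phi>] by (intro gal_eqI[OF L gal_conj[OF L \<phi> \<phi>] \<phi>]) (simp add: compose_def)
  then have g_fixed: "\<phi> (g \<phi>) = g \<phi>" using equivariant_mapsD(2)[OF g \<phi> \<phi>] by simp
  define y where "y = of_R c * g \<phi>"
  have y: "y \<in> integers L" using c by (simp add: y_def \<phi>_def)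
  have "of_R c \<in> L" by (simp add: of_R_def intermediateD[OF LI])
  then have "\<phi> y = y"
    unfolding y_def using embedding_onD(5)[OF galD(1)[OF L \<phi>] LI] equivariant_mapsD(1)[OF g \<phi>] g_fixed
    by (simp add: gal_of_R[OF L \<phi>])
  then have yQ: "y - y ^ Q \<in> \<pp>" using frob y by (auto simp: is_frobenius_def Q_def)
  obtain H where H: "(\<Prod>b\<in>residues_mod P. [:- b, 1:]) - (monom 1 Q - [:0, 1:]) = [:P:] * H"
    using residue_product[OF good_irreducible] unfolding Q_def by (auto elim: dvdE)
  have "poly (map_poly of_R (\<Prod>b\<in>residues_mod P. [:- b, 1:])) y - (y ^ Q - y) =
     poly (map_poly of_R ((\<Prod>b\<in>residues_mod P. [:- b, 1:]) - (monom 1 Q - [:0, 1:]))) y"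
    by (simp add: map_of_R.hom_minus map_poly_monom poly_monom
        Polynomial.map_poly_pCons[where f = of_R, OF of_R.hom_zero])
  also have "\<dots> = of_R P * poly (map_poly of_R H) y"
    unfolding H map_of_R.hom_mult by (simp add: Polynomial.map_poly_pCons[where f = of_R, OF of_R.hom_zero])
  also have "\<dots> \<in> \<pp>" using y p(8) by (intro p(5) integers_poly[OF LI]) auto
  finally have "poly (map_poly of_R (\<Prod>b\<in>residues_mod P. [:- b, 1:])) y - (y ^ Q - y) - (y - y ^ Q) \<in> \<pp>"
    using yQ by (rule p(7))
  then have "(\<Prod>b\<in>residues_mod P. y - of_R b) \<in> \<pp>"
    by (simp add: map_of_R.hom_prod poly_prod of_R.hom_uminus
        Polynomial.map_poly_pCons[where f = of_R, OF of_R.hom_zero])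
  then have "\<exists>b\<in>residues_mod P. y - of_R b \<in> \<pp>"
    using y cl(1,7)
    by (intro prime_over_prod[OF LI pp residues_mod(1)[OF irreducible_degree_pos[OF good_irreducible]]]) auto
  then obtain b where "y - of_R b \<in> \<pp>" by blast
  then show ?thesis by (auto simp: y_def \<phi>_def)
qed

text \<open>For x in \<open>\<pp>'\<close> the product of its conjugates is, up to sign, an element
  of R in \<open>\<pp>'\<close>, thus divisible by P and in \<open>\<pp>\<close>; so some conjugate
  of x lies in \<open>\<pp>\<close>. The covering lemma makes the automorphism independent of
  x.\<close>

lemma primes_conjugate:
  assumes pp: "prime_over L P \<pp>" and pp': "prime_over L P \<pp>'"
  shows "\<exists>\<sigma>\<in>gal L. \<forall>x\<in>\<pp>'. \<sigma> x \<in> \<pp>"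
proof -
  note LI = galois_intermediate[OF L]
  note cl = integers_closed[OF LI] and p = prime_overD[OF LI pp] and p' = prime_overD[OF LI pp']
  define V where "V \<sigma> = {x \<in> \<pp>'. \<sigma> x \<in> \<pp>}" for \<sigma>
  have pL: "x \<in> L" if "x \<in> \<pp>'" for x using that p'(1) integers_subset by blast
  have RL: "of_R r \<in> L" for r by (simp add: of_R_def intermediateD[OF LI])
  have card: "card (gal L) \<le> CARD('k) ^ degree P" using good by (simp add: good_prime_def)
  have "\<exists>\<sigma>\<in>gal L. \<pp>' \<subseteq> V \<sigma>"
  proof (rule submodule_cover[OF good_irreducible gal_finite[OF L] card p'(2,3)])
    show sm: "of_R r * x \<in> \<pp>'" if "x \<in> \<pp>'" for r x using that cl(1) by (intro p'(4))
    fix \<sigma> assume s: "\<sigma> \<in> gal L"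
    note se = embedding_onD[OF galD(1)[OF L s] LI]
    show "x + y \<in> V \<sigma>" if "x \<in> V \<sigma>" "y \<in> V \<sigma>" for x y
      using that by (simp add: V_def se pL p(3) p'(3))
    show "of_R r * x \<in> V \<sigma>" if "x \<in> V \<sigma>" for r x
      using that by (simp add: V_def se pL RL gal_of_R[OF L s] p(4) sm cl)
    show "of_R P * x \<in> V \<sigma>" if x: "x \<in> \<pp>'" for x
      using x gal_integers[OF L s, of x] p'(1) p(8)[of P]
      by (auto simp: V_def se pL RL gal_of_R[OF L s] sm intro!: p(5))
  next
    show "\<pp>' \<subseteq> (\<Union>\<sigma>\<in>gal L. V \<sigma>)"
    proof
      fix x assume x: "x \<in> \<pp>'"
      then have xi: "x \<in> integers L" using p'(1) by blast
      obtain f where f: "map_poly of_R f = (\<Prod>\<sigma>\<in>gal L. [:- \<sigma> x, 1:])"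
        using conjugates_poly_over_R[OF L xi] by blast
      have "of_R (poly f 0) = poly (map_poly of_R f) (of_R 0)" by (simp only: of_R.poly_map_poly)
      also have "\<dots> = (\<Prod>\<sigma>\<in>gal L. - \<sigma> x)" by (simp add: f poly_prod)
      finally have N: "of_R (poly f 0) = (\<Prod>\<sigma>\<in>gal L. - \<sigma> x)" .
      define e where "e = (\<lambda>x\<in>L. x)"
      have e: "e \<in> gal L" "e x = x" using gal_id[OF L] pL[OF x] by (auto simp: e_def)
      have "(\<Prod>\<sigma>\<in>gal L. - \<sigma> x) = - x * (\<Prod>\<sigma>\<in>gal L - {e}. - \<sigma> x)"
        using prod.remove[OF gal_finite[OF L] e(1), of "\<lambda>\<sigma>. - \<sigma> x"] e(2) by simp
      also have "\<dots> \<in> \<pp>'"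
        using gal_integers[OF L _ xi] by (intro p'(5,6) x integers_prod[OF LI] cl(6)) auto
      finally have "P dvd poly f 0" using p'(8) N by metis
      then have "(\<Prod>\<sigma>\<in>gal L. - \<sigma> x) \<in> \<pp>" using p(8) N by metis
      then obtain \<sigma> where s: "\<sigma> \<in> gal L" "- \<sigma> x \<in> \<pp>"
        using prime_over_prod[OF LI pp gal_finite[OF L], of "\<lambda>\<sigma>. - \<sigma> x"] gal_integers[OF L _ xi] cl(6) by blast
      then have "\<sigma> x \<in> \<pp>" using p(6)[OF s(2)] by simp
      then show "x \<in> (\<Union>\<sigma>\<in>gal L. V \<sigma>)" using s(1) x by (auto simp: V_def)
    qed
  qed
  then show ?thesis by (auto simp: V_def)
qed

text \<open>An automorphism carrying \<open>\<pp>'\<close> into \<open>\<pp>\<close> conjugates the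
  Frobenius element at \<open>\<pp>'\<close> into one at \<open>\<pp>\<close>. By uniqueness this is
  the given one, and equivariance transports the value of g together with its residue.\<close>

lemma frobenius_residue_independent:
  assumes pp: "prime_over L P \<pp>" and pp': "prime_over L P \<pp>'" and g: "g \<in> equivariant_maps L"
    and b: "of_R c * g (frobenius L P \<pp>) - of_R b \<in> \<pp>" "of_R c * g (frobenius L P \<pp>') - of_R b' \<in> \<pp>'"
  shows "P dvd b - b'"
proof -
  note LI = galois_intermediate[OF L]
  note cl = integers_closed[OF LI] and p = prime_overD[OF LI pp] and p' = prime_overD[OF LI pp']
  obtain \<sigma> where s: "\<sigma> \<in> gal L" "\<And>x. x \<in> \<pp>' \<Longrightarrow> \<sigma> x \<in> \<pp>" using primes_conjugate[OF pp pp'] by blast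
  note se = embedding_onD[OF galD(1)[OF L s(1)] LI]
  define \<phi> \<phi>' where "\<phi> = frobenius L P \<pp>" and "\<phi>' = frobenius L P \<pp>'"
  define \<psi> where "\<psi> = compose L (compose L \<sigma> \<phi>') (inv_into L \<sigma>)"
  define Q where "Q = CARD('k) ^ degree P"
  have frob': "is_frobenius L P \<pp>' \<phi>'" unfolding \<phi>'_def by (rule good_prime_frobenius[OF L good pp'])
  then have \<phi>': "\<phi>' \<in> gal L" by (simp add: is_frobenius_def)
  have \<psi>: "\<psi> \<in> gal L" unfolding \<psi>_def by (rule gal_conj[OF L s(1) \<phi>'])
  have "\<psi> x - x ^ Q \<in> \<pp>" if x: "x \<in> integers L" for x
  proof -
    define z where "z = inv_into L \<sigma> x"
    have xL: "x \<in> L" using x integers_subset by blast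
    have "z = restrict (inv_into L \<sigma>) L x" using xL by (simp add: z_def)
    then have z: "z \<in> integers L" using gal_integers[OF L gal_inv[OF L s(1)] x] by simp
    have zL: "z \<in> L" "\<sigma> z = x" using gal_inv_into[OF L s(1) xL] by (auto simp: z_def)
    have "\<phi>' z - z ^ Q \<in> \<pp>'" using frob' z by (simp add: is_frobenius_def Q_def)
    then have "\<sigma> (\<phi>' z - z ^ Q) \<in> \<pp>" by (rule s(2))
    also have "\<sigma> (\<phi>' z - z ^ Q) = \<sigma> (\<phi>' z) - x ^ Q"
      using zL galD(5)[OF L \<phi>' zL(1)] by (simp add: se intermediateD[OF LI])
    also have "\<sigma> (\<phi>' z) = \<psi> x" using xL zL(1) by (simp add: \<psi>_def compose_def z_def)
    finally show ?thesis .
  qed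
  then have "is_frobenius L P \<pp> \<psi>" using \<psi> by (simp add: is_frobenius_def Q_def)
  then have "\<psi> = \<phi>" unfolding \<phi>_def by (rule good_prime_frobenius(2)[OF L good pp])
  then have g\<phi>: "g \<phi> = \<sigma> (g \<phi>')" using equivariant_mapsD(2)[OF g s(1) \<phi>'] by (simp add: \<psi>_def)
  have RL: "of_R r \<in> L" for r by (simp add: of_R_def intermediateD[OF LI])
  have "\<sigma> (of_R c * g \<phi>' - of_R b') = of_R c * g \<phi> - of_R b'"
    using equivariant_mapsD(1)[OF g \<phi>']
    by (simp add: se RL intermediateD[OF LI] gal_of_R[OF L s(1)] g\<phi>)
  then have "of_R c * g \<phi> - of_R b' \<in> \<pp>" using s(2) b(2) unfolding \<phi>'_def by metis
  then have "(of_R c * g \<phi> - of_R b') - (of_R c * g \<phi> - of_R b) \<in> \<pp>" using b(1) unfolding \<phi>_def by (rule p(7))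
  then have "of_R (b - b') \<in> \<pp>" by (simp add: of_R.hom_minus)
  then show ?thesis using p(8) by blast
qed

lemma ev_entry_exists:
  assumes g: "g \<in> equivariant_maps L" and c: "\<not> P dvd c" "\<And>\<tau>. \<tau> \<in> gal L \<Longrightarrow> of_R c * g \<tau> \<in> integers L"
  shows "\<exists>a. \<forall>\<pp>. prime_over L P \<pp> \<longrightarrow> cong_at L \<pp> (g (frobenius L P \<pp>)) (of_R a)"
proof -
  note LI = galois_intermediate[OF L]
  obtain \<pp>\<^sub>0 where pp0: "prime_over L P \<pp>\<^sub>0" using good_prime_prime_over[OF L good] by blast
  have fg: "frobenius L P \<pp> \<in> gal L" if "prime_over L P \<pp>" for \<pp>
    using good_prime_frobenius(1)[OF L good that] by (simp add: is_frobenius_def)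
  obtain b where b: "of_R c * g (frobenius L P \<pp>\<^sub>0) - of_R b \<in> \<pp>\<^sub>0"
    using frobenius_fixed_residue[OF pp0 g c(2)[OF fg[OF pp0]]] by blast
  obtain u v where uv: "u * P + v * c = 1" using irreducible_bezout[OF good_irreducible c(1)] by blast
  \<comment> \<open>As v inverts c modulo P, the factor v undoes the clearing of denominators; b
    stems from the single prime \<open>\<pp>\<^sub>0\<close>.\<close>
  have "cong_at L \<pp> (g (frobenius L P \<pp>)) (of_R (v * b))" if pp: "prime_over L P \<pp>" for \<pp>
  proof -
    note p = prime_overD[OF LI pp]
    obtain b' where b': "of_R c * g (frobenius L P \<pp>) - of_R b' \<in> \<pp>"
      using frobenius_fixed_residue[OF pp g c(2)[OF fg[OF pp]]] by blast
    have d1: "P dvd b' - b" by (rule frobenius_residue_independent[OF pp pp0 g b' b])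
    have "b - c * (v * b) = (u * P + v * c) * b - c * (v * b)" by (simp add: uv)
    also have "\<dots> = P * (u * b)" by (simp add: algebra_simps)
    finally have "P dvd (b' - b) + (b - c * (v * b))" using d1 by simp
    then have "of_R (b' - c * (v * b)) \<in> \<pp>" using p(8) by simp
    then have "of_R c * g (frobenius L P \<pp>) - of_R b' + of_R (b' - c * (v * b)) \<in> \<pp>" by (rule p(3)[OF b'])
    then have "of_R c * g (frobenius L P \<pp>) - of_R c * of_R (v * b) \<in> \<pp>"
      by (simp add: of_R.hom_minus of_R.hom_mult)
    moreover have "of_R c \<in> integers L - \<pp>" using p(8) c(1) integers_closed(1)[OF LI] by blast
    ultimately show ?thesis by (rule cong_at_scaled[OF LI pp])
  qed
  then show ?thesis by blast
qed

end

lemma common_denominator: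
  assumes "finite S"
  shows "\<exists>c\<noteq>0. \<forall>x\<in>S. integral (of_R c * x)"
  using assms
proof induction
  case empty
  show ?case by (intro exI[of _ 1]) simp
next
  case (insert x S)
  then obtain c where c: "c \<noteq> 0" "\<forall>x\<in>S. integral (of_R c * x)" by blast
  obtain d where d: "d \<noteq> 0" "integral (of_R d * x)" by (rule integral_denominator)
  have "integral (of_R (c * d) * y)" if "y \<in> insert x S" for y
  proof (cases "y = x")
    case True
    have "integral (of_R c * (of_R d * x))" by (intro integral_mult integral_of_R d)
    then show ?thesis using True by (simp add: of_R.hom_mult mult_ac)
  next
    case False
    then have "integral (of_R d * (of_R c * y))" using that c(2) by (auto intro: integral_mult[OF integral_of_R, of "of_R c * y"])
    then show ?thesis by (simp add: of_R.hom_mult mult_ac)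
  qed
  then show ?case using c(1) d(1) by (intro exI[of _ "c * d"]) auto
qed

text \<open>The choice inside \<open>ev\<close> is unfolded only here. Multiplication by a common
  denominator c makes the values of g integral, and the P dividing c are discarded.\<close>

lemma ev_represented:
  assumes L: "finite_galois L" and g: "g \<in> equivariant_maps L"
  shows "\<exists>\<alpha>. ev L g = abs_A\<^sub>K \<alpha> \<and> (\<forall>\<^sub>F P in primes_filter. good_prime L P \<and>
    (\<forall>\<pp>. prime_over L P \<pp> \<longrightarrow> cong_at L \<pp> (g (frobenius L P \<pp>)) (of_R (\<alpha> P))))"
proof -
  define \<alpha> where "\<alpha> P = (SOME a. \<forall>\<pp>. unramified_prime_over L P \<pp> \<longrightarrow>
     cong_at L \<pp> (g (frobenius L P \<pp>)) (of_R a))" for P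
  have "finite (g ` gal L)" using gal_finite[OF L] by simp
  from common_denominator[OF this] obtain c
    where c: "c \<noteq> 0" "\<And>x. x \<in> g ` gal L \<Longrightarrow> integral (of_R c * x)" by auto
  have cg: "of_R c * g \<tau> \<in> integers L" if "\<tau> \<in> gal L" for \<tau>
  proof -
    have "of_R c \<in> L" unfolding of_R_def by (rule intermediateD(1)[OF galois_intermediate[OF L]])
    then have "of_R c * g \<tau> \<in> L"
      using equivariant_mapsD(1)[OF g that] by (rule intermediateD(5)[OF galois_intermediate[OF L]])
    moreover have "integral (of_R c * g \<tau>)" using c(2) that by blast
    ultimately show ?thesis unfolding integers_altdef by blast
  qed
  from eventually_good_prime[OF L] eventually_not_dvd[OF c(1)]
  have "\<forall>\<^sub>F P in primes_filter. good_prime L P \<and>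
    (\<forall>\<pp>. prime_over L P \<pp> \<longrightarrow> cong_at L \<pp> (g (frobenius L P \<pp>)) (of_R (\<alpha> P)))"
  proof eventually_elim
    case (elim P)
    obtain a where "\<forall>\<pp>. prime_over L P \<pp> \<longrightarrow> cong_at L \<pp> (g (frobenius L P \<pp>)) (of_R a)"
      using ev_entry_exists[OF L elim(1) g elim(2) cg] by blast
    then have "\<forall>\<pp>. unramified_prime_over L P \<pp> \<longrightarrow> cong_at L \<pp> (g (frobenius L P \<pp>)) (of_R a)"
      by (simp add: unramified_prime_over_def)
    then have "\<forall>\<pp>. unramified_prime_over L P \<pp> \<longrightarrow> cong_at L \<pp> (g (frobenius L P \<pp>)) (of_R (\<alpha> P))"
      unfolding \<alpha>_def by (rule someI)
    then show ?case using elim(1) by (auto simp: good_prime_def)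
  qed
  moreover have "ev L g = abs_A\<^sub>K \<alpha>" unfolding ev_def \<alpha>_def ..
  ultimately show ?thesis by blast
qed

lemma abs_A\<^sub>K_eq_iff: "abs_A\<^sub>K a = abs_A\<^sub>K b \<longleftrightarrow> (\<forall>\<^sub>F P in primes_filter. P dvd a P - b P)"
  by (simp add: A\<^sub>K.abs_eq_iff eq_almost_all_iff)

text \<open>Residues are unique modulo P, so it suffices to test the congruence at one prime over
  each good P.\<close>

lemma ev_eqI:
  assumes L: "finite_galois L" and g: "g \<in> equivariant_maps L"
    and b: "\<forall>\<^sub>F P in primes_filter. good_prime L P \<longrightarrow>
      (\<exists>\<pp>. prime_over L P \<pp> \<and> cong_at L \<pp> (g (frobenius L P \<pp>)) (of_R (\<beta> P)))"
  shows "ev L g = abs_A\<^sub>K \<beta>"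
proof -
  obtain \<alpha> where a: "ev L g = abs_A\<^sub>K \<alpha>" "\<forall>\<^sub>F P in primes_filter. good_prime L P \<and>
    (\<forall>\<pp>. prime_over L P \<pp> \<longrightarrow> cong_at L \<pp> (g (frobenius L P \<pp>)) (of_R (\<alpha> P)))"
    using ev_represented[OF L g] by blast
  from a(2) b have "\<forall>\<^sub>F P in primes_filter. P dvd \<alpha> P - \<beta> P"
  proof eventually_elim
    case (elim P)
    then show ?case using cong_at_unique[OF galois_intermediate[OF L]] by blast
  qed
  then show ?thesis by (simp add: a(1) abs_A\<^sub>K_eq_iff)
qed

section \<open>The algebra of finite separable elements\<close>

lemma equivariant_restrict:
  assumes L: "finite_galois L" and M: "finite_galois M" and LM: "L \<subseteq> M" and g: "g \<in> equivariant_maps L"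
  shows "(\<lambda>\<sigma>\<in>gal M. g (restrict \<sigma> L)) \<in> equivariant_maps M"
proof -
  have "restrict (compose M (compose M \<sigma> \<tau>) (inv_into M \<sigma>)) L =
      compose L (compose L (restrict \<sigma> L) (restrict \<tau> L)) (inv_into L (restrict \<sigma> L))"
    if s: "\<sigma> \<in> gal M" and t: "\<tau> \<in> gal M" for \<sigma> \<tau>
  proof (rule extensionalityI[of _ L])
    fix x assume x: "x \<in> L"
    have s': "restrict \<sigma> L \<in> gal L" by (rule gal_restrict[OF L M LM s])
    have t': "restrict \<tau> L \<in> gal L" by (rule gal_restrict[OF L M LM t])
    define z where "z = inv_into L (restrict \<sigma> L) x"
    have z: "z \<in> L" "\<sigma> z = x" using gal_inv_into[OF L s' x] by (auto simp: z_def)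
    have "inv_into M \<sigma> x = z" using gal_inv_into(3)[OF M s, of z] z LM by auto
    moreover have "\<tau> z \<in> L" using galD(5)[OF L t' z(1)] z(1) by simp
    ultimately show "restrict (compose M (compose M \<sigma> \<tau>) (inv_into M \<sigma>)) L x =
      compose L (compose L (restrict \<sigma> L) (restrict \<tau> L)) (inv_into L (restrict \<sigma> L)) x"
      using x z LM by (auto simp: compose_def z_def[symmetric])
  qed (auto simp: compose_def)
  moreover have "g (restrict \<tau> L) \<in> L" if "\<tau> \<in> gal M" for \<tau>
    using equivariant_mapsD(1)[OF g gal_restrict[OF L M LM that]] .
  ultimately show ?thesis
    using LM equivariant_mapsD(2)[OF g gal_restrict[OF L M LM] gal_restrict[OF L M LM]]
    by (auto simp: equivariant_maps_def gal_conj[OF M])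
qed

text \<open>The Frobenius element at a prime \<open>\<qq>\<close> of M restricts to the one at the
  prime \<open>\<qq> \<inter> integers L\<close> of L.\<close>

lemma ev_restrict:
  assumes L: "finite_galois L" and M: "finite_galois M" and LM: "L \<subseteq> M" and g: "g \<in> equivariant_maps L"
  shows "ev M (\<lambda>\<sigma>\<in>gal M. g (restrict \<sigma> L)) = ev L g"
proof -
  note LI = galois_intermediate[OF L] and MI = galois_intermediate[OF M]
  obtain \<alpha> where a: "ev L g = abs_A\<^sub>K \<alpha>" "\<forall>\<^sub>F P in primes_filter. good_prime L P \<and>
    (\<forall>\<pp>. prime_over L P \<pp> \<longrightarrow> cong_at L \<pp> (g (frobenius L P \<pp>)) (of_R (\<alpha> P)))"
    using ev_represented[OF L g] by blast
  have sub: "integers L \<subseteq> integers M" using LM by (auto simp: integers_altdef)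
  have "ev M (\<lambda>\<sigma>\<in>gal M. g (restrict \<sigma> L)) = abs_A\<^sub>K \<alpha>"
  proof (rule ev_eqI[OF M equivariant_restrict[OF L M LM g]])
    show "\<forall>\<^sub>F P in primes_filter. good_prime M P \<longrightarrow>
      (\<exists>\<pp>. prime_over M P \<pp> \<and> cong_at M \<pp> ((\<lambda>\<sigma>\<in>gal M. g (restrict \<sigma> L)) (frobenius M P \<pp>)) (of_R (\<alpha> P)))"
      using a(2)
    proof eventually_elim
      case (elim P)
      show ?case
      proof
        assume good: "good_prime M P"
        obtain \<qq> where q: "prime_over M P \<qq>" using good_prime_prime_over[OF M good] by blast
        note qD = prime_overD[OF MI q]
        define \<pp> where "\<pp> = \<qq> \<inter> integers L"
        have pp: "prime_over L P \<pp>"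
        proof (rule prime_overI[OF LI])
          show "\<pp> \<subseteq> integers L" "0 \<in> \<pp>" "1 \<notin> \<pp>" "\<And>r. of_R r \<in> \<pp> \<longleftrightarrow> P dvd r"
            using qD(2,8,10) integers_closed(1,2)[OF LI] by (auto simp: \<pp>_def)
          show "x + y \<in> \<pp>" if "x \<in> \<pp>" "y \<in> \<pp>" for x y
            using that qD(3) integers_closed(4)[OF LI] by (simp add: \<pp>_def)
          show "x * y \<in> \<pp>" if "x \<in> integers L" "y \<in> \<pp>" for x y
            using that qD(4) integers_closed(5)[OF LI] sub by (auto simp: \<pp>_def)
          show "x \<in> \<pp> \<or> y \<in> \<pp>" if "x \<in> integers L" "y \<in> integers L" "x * y \<in> \<pp>" for x y
            using that qD(9)[of x y] sub by (auto simp: \<pp>_def)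
        qed
        define \<phi> where "\<phi> = frobenius M P \<qq>"
        have frob: "is_frobenius M P \<qq> \<phi>" unfolding \<phi>_def by (rule good_prime_frobenius[OF M good q])
        then have \<phi>: "\<phi> \<in> gal M" by (simp add: is_frobenius_def)
        have r: "restrict \<phi> L \<in> gal L" by (rule gal_restrict[OF L M LM \<phi>])
        have "is_frobenius L P \<pp> (restrict \<phi> L)"
          unfolding is_frobenius_def
        proof (intro conjI ballI r)
          fix x assume x: "x \<in> integers L"
          have "restrict \<phi> L x \<in> integers L" by (rule gal_integers[OF L r x])
          moreover have "restrict \<phi> L x = \<phi> x" using x integers_subset by auto
          ultimately show "restrict \<phi> L x - x ^ CARD('a) ^ degree P \<in> \<pp>"
            using frob x sub integers_closed(7)[OF LI _ integers_closed(8)[OF LI x]]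
            by (auto simp: is_frobenius_def \<pp>_def)
        qed
        then have "restrict \<phi> L = frobenius L P \<pp>" using good_prime_frobenius(2)[OF L _ pp] elim by blast
        then have "cong_at L \<pp> (g (restrict \<phi> L)) (of_R (\<alpha> P))" using elim pp by simp
        then have "cong_at M \<qq> (g (restrict \<phi> L)) (of_R (\<alpha> P))"
          using sub unfolding cong_at_def \<pp>_def by blast
        then show "\<exists>\<pp>. prime_over M P \<pp> \<and> cong_at M \<pp> ((\<lambda>\<sigma>\<in>gal M. g (restrict \<sigma> L)) (frobenius M P \<pp>)) (of_R (\<alpha> P))"
          using q \<phi> unfolding \<phi>_def by auto
      qed
    qed
  qed
  then show ?thesis by (simp add: a(1))
qed

text \<open>The choice in \<open>of_K\<close> may use any fraction for the same element, and a
  different one for each P. Cross-multiplication shows that the chosen entry satisfies the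
  congruence for the fixed fraction u / v at every P not dividing v.\<close>

lemma of_K_Fract:
  fixes u v :: "'k::{field,finite} poly"
  assumes v: "v \<noteq> 0"
  shows "of_K (Fraction_Field.Fract u v) = abs_A\<^sub>K a \<longleftrightarrow> (\<forall>\<^sub>F P in primes_filter. P dvd v * a P - u)"
proof -
  define R where "R P b \<longleftrightarrow> (\<exists>u' v'. Fraction_Field.Fract u v = Fraction_Field.Fract u' v' \<and> \<not> P dvd v' \<and> [v' * b = u'] (mod P))" for P b
  define \<alpha> where "\<alpha> P = (SOME b. R P b)" for P
  have a: "\<forall>\<^sub>F P in primes_filter. \<not> P dvd v \<and> irreducible P \<and> P dvd v * \<alpha> P - u"
    using eventually_not_dvd[OF v] eventually_irreducible
  proof eventually_elim
    case (elim P)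
    then have Pv: "\<not> P dvd v" and P: "irreducible P" by auto
    obtain s t where st: "s * P + t * v = 1" using irreducible_bezout[OF P Pv] by blast
    have "v * (t * u) - u = v * (t * u) - (s * P + t * v) * u" by (simp add: st)
    also have "\<dots> = P * (- (s * u))" by (simp add: algebra_simps)
    finally have "P dvd v * (t * u) - u" by simp
    then have "R P (t * u)" using Pv unfolding R_def cong_iff_dvd_diff by blast
    then have "R P (\<alpha> P)" unfolding \<alpha>_def by (rule someI)
    then obtain u' v' where uv': "Fraction_Field.Fract u v = Fraction_Field.Fract u' v'" "\<not> P dvd v'"
      "P dvd v' * \<alpha> P - u'" unfolding R_def cong_iff_dvd_diff by blast
    have "v' \<noteq> 0" using uv'(2) by auto
    then have e: "u * v' = u' * v" using uv'(1) v by (simp add: eq_fract)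
    have "v' * (v * \<alpha> P - u) = v * (v' * \<alpha> P - u') + (u' * v - u * v')" by (simp add: algebra_simps)
    then have "P dvd v' * (v * \<alpha> P - u)" using e uv'(3) by simp
    then show ?case using irreducible_dvd_mult[OF P] uv'(2) Pv P by blast
  qed
  have "of_K (Fraction_Field.Fract u v) = abs_A\<^sub>K \<alpha>" unfolding of_K_def \<alpha>_def R_def ..
  then have "of_K (Fraction_Field.Fract u v) = abs_A\<^sub>K a \<longleftrightarrow> (\<forall>\<^sub>F P in primes_filter. P dvd \<alpha> P - a P)"
    by (simp add: abs_A\<^sub>K_eq_iff)
  also have "\<dots> \<longleftrightarrow> (\<forall>\<^sub>F P in primes_filter. P dvd v * a P - u)"
    using a
  proof (rule eventually_subst[OF eventually_mono])
    fix P assume P: "\<not> P dvd v \<and> irreducible P \<and> P dvd v * \<alpha> P - u"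
    have "P dvd \<alpha> P - a P \<longleftrightarrow> P dvd v * (\<alpha> P - a P)"
      using P irreducible_dvd_mult[of P v "\<alpha> P - a P"] dvd_mult[of P "\<alpha> P - a P" v] by blast
    also have "v * (\<alpha> P - a P) = (v * \<alpha> P - u) - (v * a P - u)" by (simp add: algebra_simps)
    also have "P dvd (v * \<alpha> P - u) - (v * a P - u) \<longleftrightarrow> P dvd v * a P - u"
      using P dvd_diff_right_iff[of P "v * \<alpha> P - u"] by blast
    finally show "P dvd \<alpha> P - a P \<longleftrightarrow> P dvd v * a P - u" .
  qed
  finally show ?thesis .
qed

lemma abs_A\<^sub>K_surj: "\<exists>a. x = abs_A\<^sub>K a"
  by (rule exI[of _ "rep_A\<^sub>K x"]) (simp add: Quotient3_abs_rep[OF Quotient3_A\<^sub>K])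

lemma of_K_represented:
  fixes x :: "'k::{field,finite} poly fract"
  obtains u v a where "x = Fraction_Field.Fract u v" "v \<noteq> 0" "of_K x = abs_A\<^sub>K a"
    "\<forall>\<^sub>F P in primes_filter. P dvd v * a P - u"
proof -
  obtain u v where x: "x = Fraction_Field.Fract u v" "v \<noteq> 0" by (cases x) auto
  obtain a where a: "of_K x = abs_A\<^sub>K a" using abs_A\<^sub>K_surj by blast
  then have "\<forall>\<^sub>F P in primes_filter. P dvd v * a P - u" using of_K_Fract[OF x(2), of u a] x(1) by simp
  then show ?thesis using that x a by blast
qed

lemma of_K_to_fract: "of_K (to_fract r) = abs_A\<^sub>K (\<lambda>_. r :: 'k::{field,finite} poly)"
  using of_K_Fract[of 1 r "\<lambda>_. r"] by (simp add: to_fract_def)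

interpretation of_K: inj_comm_ring_hom "of_K :: 'k::{field,finite} poly fract \<Rightarrow> 'k A\<^sub>K"
proof
  fix x y :: "'k poly fract"
  obtain u v a where x: "x = Fraction_Field.Fract u v" "v \<noteq> 0" "of_K x = abs_A\<^sub>K a"
    "\<forall>\<^sub>F P in primes_filter. P dvd v * a P - u" by (rule of_K_represented)
  obtain s t b where y: "y = Fraction_Field.Fract s t" "t \<noteq> 0" "of_K y = abs_A\<^sub>K b"
    "\<forall>\<^sub>F P in primes_filter. P dvd t * b P - s" by (rule of_K_represented)
  have nz: "v * t \<noteq> 0" using x y by simp
  have "of_K (Fraction_Field.Fract (u * t + s * v) (v * t)) = abs_A\<^sub>K (\<lambda>P. a P + b P)"
    unfolding of_K_Fract[OF nz] using x(4) y(4)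
  proof eventually_elim
    case (elim P)
    have "v * t * (a P + b P) - (u * t + s * v) = t * (v * a P - u) + v * (t * b P - s)"
      by (simp add: algebra_simps)
    then show ?case using elim by simp
  qed
  then show "of_K (x + y) = of_K x + of_K y" using x y by (simp add: plus_A\<^sub>K.abs_eq)
  have "of_K (Fraction_Field.Fract (u * s) (v * t)) = abs_A\<^sub>K (\<lambda>P. a P * b P)"
    unfolding of_K_Fract[OF nz] using x(4) y(4)
  proof eventually_elim
    case (elim P)
    have "v * t * (a P * b P) - u * s = t * b P * (v * a P - u) + u * (t * b P - s)"
      by (simp add: algebra_simps)
    then show ?case using elim by simp
  qed
  then show "of_K (x * y) = of_K x * of_K y" using x y by (simp add: times_A\<^sub>K.abs_eq)
next
  show "of_K (1 :: 'k poly fract) = 1" using of_K_to_fract[of 1] by (simp add: one_A\<^sub>K_def)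
  show z: "of_K (0 :: 'k poly fract) = 0" using of_K_to_fract[of 0] by (simp add: zero_A\<^sub>K_def)
  \<comment> \<open>For the zero family, \<open>of_K_Fract\<close> says that almost all P divide the
    numerator.\<close>
  fix x :: "'k poly fract" assume "of_K x = 0"
  moreover obtain u v where x: "x = Fraction_Field.Fract u v" "v \<noteq> 0" by (cases x) auto
  ultimately have "\<forall>\<^sub>F P in primes_filter. P dvd v * 0 - u"
    using of_K_Fract[OF x(2), of u "\<lambda>_. 0"] by (simp add: zero_A\<^sub>K_def)
  then have "u = 0" using eventually_dvd_const[of u] by simp
  then show "x = 0" using x by (simp add: fract_collapse)
qed

lemma poly_of_K_to_fract:
  "poly (map_poly of_K (map_poly to_fract G)) (abs_A\<^sub>K a) = abs_A\<^sub>K (\<lambda>P. poly G (a P :: 'k::{field,finite} poly))"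
proof (induction G)
  case 0
  show ?case by (simp add: zero_A\<^sub>K_def)
next
  case (pCons c G)
  then show ?case
    by (simp add: Polynomial.map_poly_pCons[where f = to_fract, OF to_fract_0]
        Polynomial.map_poly_pCons[where f = of_K, OF of_K.hom_zero] of_K_to_fract plus_A\<^sub>K.abs_eq times_A\<^sub>K.abs_eq)
qed

text \<open>The factor d is invertible in the image of K, so it does not affect vanishing; over R,
  evaluation takes place entry by entry.\<close>

lemma poly_of_K_eq_0_iff:
  fixes f :: "'k::{field,finite} poly fract poly"
  assumes "map_poly to_fract G = Polynomial.smult (to_fract d) f" "d \<noteq> 0"
  shows "poly (map_poly of_K f) (abs_A\<^sub>K a) = 0 \<longleftrightarrow> (\<forall>\<^sub>F P in primes_filter. P dvd poly G (a P))"
proof -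
  let ?v = "poly (map_poly of_K f) (abs_A\<^sub>K a)"
  have inv: "of_K (inverse (to_fract d)) * of_K (to_fract d) = 1"
    using assms(2) by (simp flip: of_K.hom_mult)
  have "of_K (to_fract d) * ?v = poly (map_poly of_K (map_poly to_fract G)) (abs_A\<^sub>K a)"
    unfolding assms(1) by (simp add: of_K.map_poly_hom_smult)
  then have e: "of_K (to_fract d) * ?v = abs_A\<^sub>K (\<lambda>P. poly G (a P))" by (simp add: poly_of_K_to_fract)
  have "?v = 0 \<longleftrightarrow> of_K (to_fract d) * ?v = 0"
  proof
    assume "of_K (to_fract d) * ?v = 0"
    then have "of_K (inverse (to_fract d)) * (of_K (to_fract d) * ?v) = 0" by simp
    then show "?v = 0" unfolding mult.assoc[symmetric] inv by simp
  qed simp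
  then show ?thesis unfolding e by (simp add: zero_A\<^sub>K_def abs_A\<^sub>K_eq_iff)
qed

text \<open>Common form of addition and multiplication: f acts on L, commutes with the group, and
  reduces to f' on residues.\<close>

lemma ev_op:
  assumes L: "finite_galois L" and g: "g \<in> equivariant_maps L" "h \<in> equivariant_maps L"
    and op: "\<And>x y. x \<in> L \<Longrightarrow> y \<in> L \<Longrightarrow> f x y \<in> L"
      "\<And>\<sigma> x y. \<sigma> \<in> gal L \<Longrightarrow> x \<in> L \<Longrightarrow> y \<in> L \<Longrightarrow> \<sigma> (f x y) = f (\<sigma> x) (\<sigma> y)"
      "\<And>P \<pp> x y a b. prime_over L P \<pp> \<Longrightarrow> cong_at L \<pp> x (of_R a) \<Longrightarrow> cong_at L \<pp> y (of_R b) \<Longrightarrow>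
         cong_at L \<pp> (f x y) (of_R (f' a b))"
  shows "(\<lambda>\<sigma>\<in>gal L. f (g \<sigma>) (h \<sigma>)) \<in> equivariant_maps L"
    "\<exists>\<alpha> \<beta>. ev L g = abs_A\<^sub>K \<alpha> \<and> ev L h = abs_A\<^sub>K \<beta> \<and>
       ev L (\<lambda>\<sigma>\<in>gal L. f (g \<sigma>) (h \<sigma>)) = abs_A\<^sub>K (\<lambda>P. f' (\<alpha> P) (\<beta> P))"
proof -
  show eq: "(\<lambda>\<sigma>\<in>gal L. f (g \<sigma>) (h \<sigma>)) \<in> equivariant_maps L"
    using equivariant_mapsD[OF g(1)] equivariant_mapsD[OF g(2)] op(1,2) gal_conj[OF L]
    by (simp add: equivariant_maps_def)
  obtain \<alpha> where a: "ev L g = abs_A\<^sub>K \<alpha>" "\<forall>\<^sub>F P in primes_filter. good_prime L P \<and>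
    (\<forall>\<pp>. prime_over L P \<pp> \<longrightarrow> cong_at L \<pp> (g (frobenius L P \<pp>)) (of_R (\<alpha> P)))"
    using ev_represented[OF L g(1)] by blast
  obtain \<beta> where b: "ev L h = abs_A\<^sub>K \<beta>" "\<forall>\<^sub>F P in primes_filter. good_prime L P \<and>
    (\<forall>\<pp>. prime_over L P \<pp> \<longrightarrow> cong_at L \<pp> (h (frobenius L P \<pp>)) (of_R (\<beta> P)))"
    using ev_represented[OF L g(2)] by blast
  have "ev L (\<lambda>\<sigma>\<in>gal L. f (g \<sigma>) (h \<sigma>)) = abs_A\<^sub>K (\<lambda>P. f' (\<alpha> P) (\<beta> P))"
  proof (rule ev_eqI[OF L eq])
    show "\<forall>\<^sub>F P in primes_filter. good_prime L P \<longrightarrow> (\<exists>\<pp>. prime_over L P \<pp> \<and>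
      cong_at L \<pp> ((\<lambda>\<sigma>\<in>gal L. f (g \<sigma>) (h \<sigma>)) (frobenius L P \<pp>)) (of_R (f' (\<alpha> P) (\<beta> P))))"
      using a(2) b(2)
    proof eventually_elim
      case (elim P)
      then obtain \<pp> where pp: "prime_over L P \<pp>" using good_prime_prime_over[OF L] by blast
      have "frobenius L P \<pp> \<in> gal L"
        using good_prime_frobenius(1)[OF L _ pp] elim by (simp add: is_frobenius_def)
      then show ?case using op(3)[OF pp] elim pp by auto
    qed
  qed
  then show "\<exists>\<alpha> \<beta>. ev L g = abs_A\<^sub>K \<alpha> \<and> ev L h = abs_A\<^sub>K \<beta> \<and>
      ev L (\<lambda>\<sigma>\<in>gal L. f (g \<sigma>) (h \<sigma>)) = abs_A\<^sub>K (\<lambda>P. f' (\<alpha> P) (\<beta> P))"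
    using a(1) b(1) by blast
qed

lemma ev_add:
  assumes L: "finite_galois L" and g: "g \<in> equivariant_maps L" "h \<in> equivariant_maps L"
  shows "(\<lambda>\<sigma>\<in>gal L. g \<sigma> + h \<sigma>) \<in> equivariant_maps L"
    "ev L (\<lambda>\<sigma>\<in>gal L. g \<sigma> + h \<sigma>) = ev L g + ev L h"
proof -
  note LI = galois_intermediate[OF L]
  note op = intermediateD(4)[OF LI] embedding_onD(4)[OF galD(1)[OF L] LI]
    cong_at_add[OF LI, of _ _ _ "of_R _" _ "of_R _", folded of_R.hom_add]
  show "(\<lambda>\<sigma>\<in>gal L. g \<sigma> + h \<sigma>) \<in> equivariant_maps L" by (rule ev_op(1)[where f = "(+)" and f' = "(+)", OF L g op])
  have "\<exists>\<alpha> \<beta>. ev L g = abs_A\<^sub>K \<alpha> \<and> ev L h = abs_A\<^sub>K \<beta> \<and>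
      ev L (\<lambda>\<sigma>\<in>gal L. g \<sigma> + h \<sigma>) = abs_A\<^sub>K (\<lambda>P. \<alpha> P + \<beta> P)"
    by (rule ev_op(2)[where f = "(+)" and f' = "(+)", OF L g op])
  then show "ev L (\<lambda>\<sigma>\<in>gal L. g \<sigma> + h \<sigma>) = ev L g + ev L h"
    by (auto simp: plus_A\<^sub>K.abs_eq)
qed

lemma ev_mult:
  assumes L: "finite_galois L" and g: "g \<in> equivariant_maps L" "h \<in> equivariant_maps L"
  shows "(\<lambda>\<sigma>\<in>gal L. g \<sigma> * h \<sigma>) \<in> equivariant_maps L"
    "ev L (\<lambda>\<sigma>\<in>gal L. g \<sigma> * h \<sigma>) = ev L g * ev L h"
proof -
  note LI = galois_intermediate[OF L]
  note op = intermediateD(5)[OF LI] embedding_onD(5)[OF galD(1)[OF L] LI]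
    cong_at_mult[OF LI _ _ _ integers_closed(1,1)[OF LI], folded of_R.hom_mult]
  show "(\<lambda>\<sigma>\<in>gal L. g \<sigma> * h \<sigma>) \<in> equivariant_maps L" by (rule ev_op(1)[where f = "(*)" and f' = "(*)", OF L g op])
  have "\<exists>\<alpha> \<beta>. ev L g = abs_A\<^sub>K \<alpha> \<and> ev L h = abs_A\<^sub>K \<beta> \<and>
      ev L (\<lambda>\<sigma>\<in>gal L. g \<sigma> * h \<sigma>) = abs_A\<^sub>K (\<lambda>P. \<alpha> P * \<beta> P)"
    by (rule ev_op(2)[where f = "(*)" and f' = "(*)", OF L g op])
  then show "ev L (\<lambda>\<sigma>\<in>gal L. g \<sigma> * h \<sigma>) = ev L g * ev L h"
    by (auto simp: times_A\<^sub>K.abs_eq)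
qed

lemma ev_const:
  assumes L: "finite_galois L"
  shows "(\<lambda>\<sigma>\<in>gal L. to_ac x) \<in> equivariant_maps L" "ev L (\<lambda>\<sigma>\<in>gal L. to_ac x) = of_K x"
proof -
  note LI = galois_intermediate[OF L]
  show eq: "(\<lambda>\<sigma>\<in>gal L. to_ac x) \<in> equivariant_maps L"
    using intermediateD(1)[OF LI, of x] gal_conj[OF L]
    by (auto simp: equivariant_maps_def embedding_onD(1)[OF galD(1)[OF L] LI])
  obtain u v a where x: "x = Fraction_Field.Fract u v" "v \<noteq> 0" "of_K x = abs_A\<^sub>K a"
    "\<forall>\<^sub>F P in primes_filter. P dvd v * a P - u" by (rule of_K_represented)
  have vx: "of_R v * to_ac x = of_R u"
    using x(2) by (simp add: x(1) of_R_def Fract_conv_to_fract)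
  have "ev L (\<lambda>\<sigma>\<in>gal L. to_ac x) = abs_A\<^sub>K a"
  proof (rule ev_eqI[OF L eq])
    show "\<forall>\<^sub>F P in primes_filter. good_prime L P \<longrightarrow> (\<exists>\<pp>. prime_over L P \<pp> \<and>
      cong_at L \<pp> ((\<lambda>\<sigma>\<in>gal L. to_ac x) (frobenius L P \<pp>)) (of_R (a P)))"
      using x(4) eventually_not_dvd[OF x(2)]
    proof eventually_elim
      case (elim P)
      show ?case
      proof
        assume good: "good_prime L P"
        then obtain \<pp> where pp: "prime_over L P \<pp>" using good_prime_prime_over[OF L] by blast
        note p = prime_overD[OF LI pp]
        have f: "frobenius L P \<pp> \<in> gal L"
          using good_prime_frobenius(1)[OF L good pp] by (simp add: is_frobenius_def)
        have "of_R v * to_ac x - of_R v * of_R (a P) = of_R (- (v * a P - u))"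
          unfolding vx by (simp add: of_R.hom_minus of_R.hom_mult)
        also have "\<dots> \<in> \<pp>" using elim(1) p(8) by (metis dvd_minus_iff)
        finally have "cong_at L \<pp> (to_ac x) (of_R (a P))"
          using p(8) elim(2) integers_closed(1)[OF LI] by (intro cong_at_scaled[OF LI pp, of "of_R v"]) auto
        then show "\<exists>\<pp>. prime_over L P \<pp> \<and> cong_at L \<pp> ((\<lambda>\<sigma>\<in>gal L. to_ac x) (frobenius L P \<pp>)) (of_R (a P))"
          using pp f by auto
      qed
    qed
  qed
  then show "ev L (\<lambda>\<sigma>\<in>gal L. to_ac x) = of_K x" by (simp add: x(3))
qed

lemma finite_separable_elementsI:
  "finite_galois L \<Longrightarrow> g \<in> equivariant_maps L \<Longrightarrow> ev L g \<in> finite_separable_elements"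
  by (auto simp: finite_separable_elements_def)

lemma finite_separable_elements_common:
  assumes "\<alpha> \<in> finite_separable_elements" "\<beta> \<in> finite_separable_elements"
  obtains M g h where "finite_galois M" "g \<in> equivariant_maps M" "h \<in> equivariant_maps M"
    "\<alpha> = ev M g" "\<beta> = ev M h"
proof -
  obtain L g where L: "finite_galois L" "g \<in> equivariant_maps L" "\<alpha> = ev L g"
    using assms(1) by (auto simp: finite_separable_elements_def)
  obtain L' g' where L': "finite_galois L'" "g' \<in> equivariant_maps L'" "\<beta> = ev L' g'"
    using assms(2) by (auto simp: finite_separable_elements_def)
  obtain M where M: "finite_galois M" "L \<subseteq> M" "L' \<subseteq> M" by (rule galois_compositum[OF L(1) L'(1)])
  show ?thesis
    by (rule that[OF M(1) equivariant_restrict[OF L(1) M(1,2) L(2)] equivariant_restrict[OF L'(1) M(1,3) L'(2)]])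
      (simp_all add: L(3) L'(3) ev_restrict[OF L(1) M(1,2) L(2)] ev_restrict[OF L'(1) M(1,3) L'(2)])
qed

lemma range_of_K_subset: "range of_K \<subseteq> (finite_separable_elements :: 'k::{field,finite} A\<^sub>K set)"
proof -
  have "finite_galois (gen {} :: 'k poly fract alg_closure set)" by (rule finite_galois_gen) auto
  then show ?thesis using finite_separable_elementsI ev_const by (metis image_subsetI)
qed

lemma finite_separable_elements_closed:
  assumes "\<alpha> \<in> finite_separable_elements" "\<beta> \<in> finite_separable_elements"
  shows "\<alpha> + \<beta> \<in> finite_separable_elements" "\<alpha> * \<beta> \<in> finite_separable_elements"
proof -
  obtain M g h where M: "finite_galois M" "g \<in> equivariant_maps M" "h \<in> equivariant_maps M"
    "\<alpha> = ev M g" "\<beta> = ev M h" by (rule finite_separable_elements_common[OF assms])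
  show "\<alpha> + \<beta> \<in> finite_separable_elements"
    using finite_separable_elementsI[OF M(1) ev_add(1)[OF M(1-3)]] by (simp add: M ev_add(2)[OF M(1-3)])
  show "\<alpha> * \<beta> \<in> finite_separable_elements"
    using finite_separable_elementsI[OF M(1) ev_mult(1)[OF M(1-3)]] by (simp add: M ev_mult(2)[OF M(1-3)])
qed

lemma finite_separable_elements_uminus:
  assumes "\<alpha> \<in> finite_separable_elements"
  shows "- \<alpha> \<in> finite_separable_elements"
proof -
  have "of_K (- 1) * \<alpha> \<in> finite_separable_elements"
    using range_of_K_subset assms by (intro finite_separable_elements_closed) auto
  then show ?thesis by (simp add: of_K.hom_uminus)
qed

lemma finite_separable_elements_subring: "subring finite_separable_elements ring_of_type_algebra"
proof (rule subring_type_algebraI)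
  have "of_K 1 \<in> finite_separable_elements" using range_of_K_subset by blast
  then show "1 \<in> finite_separable_elements" by simp
qed (intro finite_separable_elements_closed finite_separable_elements_uminus; assumption)+

lemma finite_separable_elements_subalgebra:
  "subalgebra (range of_K) (finite_separable_elements :: 'k::{field,finite} A\<^sub>K set) ring_of_type_algebra"
proof (rule subalgebra.intro)
  show "subgroup (finite_separable_elements :: 'k A\<^sub>K set) (add_monoid ring_of_type_algebra)"
    by (rule subring.axioms(1)[OF finite_separable_elements_subring])
  show "subalgebra_axioms (range of_K) (finite_separable_elements :: 'k A\<^sub>K set) ring_of_type_algebra"
    using range_of_K_subset finite_separable_elements_closed(2) by unfold_locales auto
qed

section \<open>Separable algebraic elements\<close>

lemma cong_at_refl:
  assumes "intermediate L" "prime_over L P \<pp>"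
  shows "cong_at L \<pp> x x"
  using cong_at_scaled[OF assms, of 1 x x] prime_overD(2,10)[OF assms] integers_closed(3)[OF assms(1)] by simp

lemma cong_at_poly:
  assumes L: "intermediate L" and pp: "prime_over L P \<pp>" and x: "cong_at L \<pp> x (of_R a)"
  shows "cong_at L \<pp> (poly (map_poly of_R G) x) (of_R (poly G a))"
proof (induction G)
  case 0
  show ?case using cong_at_refl[OF L pp] by simp
next
  case (pCons c G)
  have "cong_at L \<pp> (of_R c + x * poly (map_poly of_R G) x) (of_R c + of_R a * of_R (poly G a))"
    by (intro cong_at_add[OF L pp] cong_at_refl[OF L pp] cong_at_mult[OF L pp] x pCons.IH integers_closed(1)[OF L])
  then show ?case
    by (simp add: Polynomial.map_poly_pCons[where f = of_R, OF of_R.hom_zero] of_R.hom_add of_R.hom_mult)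
qed

lemma finite_separable_subset_separably_algebraic:
  "(finite_separable_elements :: 'k::{field,finite} A\<^sub>K set) \<subseteq> separably_algebraic_elements"
proof
  fix x :: "'k A\<^sub>K" assume "x \<in> finite_separable_elements"
  then obtain L g where L: "finite_galois L" and g: "g \<in> equivariant_maps L" and x: "x = ev L g"
    by (auto simp: finite_separable_elements_def)
  note LI = galois_intermediate[OF L]
  obtain \<alpha> where a: "ev L g = abs_A\<^sub>K \<alpha>" "\<forall>\<^sub>F P in primes_filter. good_prime L P \<and>
    (\<forall>\<pp>. prime_over L P \<pp> \<longrightarrow> cong_at L \<pp> (g (frobenius L P \<pp>)) (of_R (\<alpha> P)))"
    using ev_represented[OF L g] by blast
  have "\<exists>f. irreducible f \<and> separable_poly f \<and> poly (map_poly to_ac f) (g \<tau>) = 0" if "\<tau> \<in> gal L" for \<tau>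
    using galois_element_root[OF L equivariant_mapsD(1)[OF g that]] by metis
  then obtain f where f: "\<And>\<tau>. \<tau> \<in> gal L \<Longrightarrow> irreducible (f \<tau>) \<and> separable_poly (f \<tau>) \<and>
    poly (map_poly to_ac (f \<tau>)) (g \<tau>) = 0" by metis
  obtain ts where ts: "set ts = gal L" using finite_list[OF gal_finite[OF L]] by blast
  define F where "F = prod_list (map f ts)"
  have F0: "F \<noteq> 0" using f ts by (auto simp: F_def prod_list_zero_iff irreducible_def)
  have Froot: "poly (map_poly to_ac F) (g \<tau>) = 0" if t: "\<tau> \<in> gal L" for \<tau>
  proof -
    have "f \<tau> dvd F" unfolding F_def using t ts by (intro prod_list_dvd) auto
    then obtain h where "F = f \<tau> * h" by (rule dvdE)
    then show ?thesis using f[OF t] by (simp add: hom_distribs)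
  qed
  \<comment> \<open>Coefficients in R allow the equation to be evaluated at the representatives
    \<open>\<alpha> P\<close>.\<close>
  obtain d G where dG: "d \<noteq> 0" "map_poly to_fract G = Polynomial.smult (to_fract d) F"
    using clear_denominators[of F] by auto
  have Groot: "poly (map_poly of_R G) (g \<tau>) = 0" if "\<tau> \<in> gal L" for \<tau>
    using Froot[OF that] by (simp add: map_poly_of_R dG(2) hom_distribs)
  have "\<forall>\<^sub>F P in primes_filter. P dvd poly G (\<alpha> P)"
    using a(2)
  proof eventually_elim
    case (elim P)
    then obtain \<pp> where pp: "prime_over L P \<pp>" using good_prime_prime_over[OF L] by blast
    have ph: "frobenius L P \<pp> \<in> gal L"
      using good_prime_frobenius(1)[OF L _ pp] elim by (simp add: is_frobenius_def)
    \<comment> \<open>G vanishes at every value of g, and evaluation of G respects congruences, so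
      its value at \<open>\<alpha> P\<close> is 0 modulo P.\<close>
    have "cong_at L \<pp> (g (frobenius L P \<pp>)) (of_R (\<alpha> P))" using elim pp by blast
    from cong_at_poly[OF LI pp this, of G] have "cong_at L \<pp> 0 (of_R (poly G (\<alpha> P)))"
      by (simp add: Groot[OF ph])
    moreover have "cong_at L \<pp> 0 (of_R 0)" using cong_at_refl[OF LI pp, of 0] by simp
    ultimately show ?case using cong_at_unique[OF LI pp] by fastforce
  qed
  then have "poly (map_poly of_K F) x = 0" unfolding x a(1) using poly_of_K_eq_0_iff[OF dG(2,1)] by blast
  moreover have "\<exists>fs. F = prod_list fs \<and> (\<forall>h\<in>set fs. separable_poly h)"
    using f ts by (intro exI[of _ "map f ts"]) (auto simp: F_def)
  ultimately show "x \<in> separably_algebraic_elements"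
    unfolding separably_algebraic_elements_def using F0 by blast
qed

section \<open>An idempotent that is not finite separable\<close>

lemma countable_poly: "countable (UNIV :: 'a set) \<Longrightarrow> countable (UNIV :: 'a::zero poly set)"
proof -
  assume "countable (UNIV :: 'a set)"
  then have "countable (lists (UNIV :: 'a set))" by (rule countable_lists)
  then have "countable (Poly ` lists (UNIV :: 'a set))" by (rule countable_image)
  moreover have "Poly ` lists (UNIV :: 'a set) = UNIV" by (auto intro!: image_eqI[of _ _ "coeffs _"])
  ultimately show ?thesis by simp
qed

lemma countable_alg_closure:
  assumes "countable (UNIV :: 'a::field set)"
  shows "countable (UNIV :: 'a alg_closure set)"
proof -
  have "countable (\<Union>p\<in>UNIV - {0 :: 'a poly}. {x. poly (map_poly to_ac p) x = 0})"
  proof (rule countable_UN)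
    show "countable (UNIV - {0 :: 'a poly})"
      using countable_poly[OF assms] by (rule countable_subset[rotated]) auto
    fix p :: "'a poly" assume "p \<in> UNIV - {0}"
    then have "map_poly to_ac p \<noteq> 0" by simp
    then show "countable {x. poly (map_poly to_ac p) x = 0}"
      by (intro countable_finite poly_roots_finite)
  qed
  moreover have "x \<in> (\<Union>p\<in>UNIV - {0 :: 'a poly}. {x. poly (map_poly to_ac p) x = 0})" for x
  proof -
    obtain p :: "'a poly" where "p \<noteq> 0" "poly (map_poly to_ac p) x = 0" by (rule alg_closure_algebraic)
    then show ?thesis by auto
  qed
  then have "(\<Union>p\<in>UNIV - {0 :: 'a poly}. {x. poly (map_poly to_ac p) x = 0}) = UNIV" by blast
  ultimately show ?thesis by simp
qed

lemma countable_fract: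
  assumes "countable (UNIV :: 'a::idom set)"
  shows "countable (UNIV :: 'a fract set)"
proof -
  have "countable ((\<lambda>(a, b). Fraction_Field.Fract a b) ` (UNIV \<times> (UNIV :: 'a set)))"
    using assms by (intro countable_image countable_SIGMA) auto
  moreover have "x \<in> (\<lambda>(a, b). Fraction_Field.Fract a b) ` (UNIV \<times> (UNIV :: 'a set))" for x
    by (cases x) auto
  then have "(\<lambda>(a, b). Fraction_Field.Fract a b) ` (UNIV \<times> (UNIV :: 'a set)) = UNIV" by blast
  ultimately show ?thesis by simp
qed

text \<open>The algebraic closure of K is countable; a field L is given by finitely many generators,
  and an equivariant map by the list of its values on the finite group.\<close>

lemma countable_finite_separable: "countable (finite_separable_elements :: 'k::{field,finite} A\<^sub>K set)"
proof -
  have \<Omega>: "countable (UNIV :: 'k poly fract alg_closure set)"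
    by (intro countable_alg_closure countable_fract countable_poly) simp
  have "{L :: 'k poly fract alg_closure set. finite_galois L} \<subseteq> gen ` {A. finite A \<and> A \<subseteq> UNIV}"
  proof
    fix L :: "'k poly fract alg_closure set" assume "L \<in> {L. finite_galois L}"
    then obtain A where "finite A" "L = gen A" using finite_galois_generators by blast
    then show "L \<in> gen ` {A. finite A \<and> A \<subseteq> UNIV}" by blast
  qed
  then have "countable {L :: 'k poly fract alg_closure set. finite_galois L}"
    using countable_image[OF countable_Collect_finite_subset[OF \<Omega>], of gen] countable_subset by blast
  moreover have "countable (ev L ` equivariant_maps L)" if L: "finite_galois L" for L :: "'k poly fract alg_closure set"
  proof -
    obtain ts where ts: "set ts = gal L" using finite_list[OF gal_finite[OF L]] by blast
    have "inj_on (\<lambda>g. map g ts) (equivariant_maps L)"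
    proof (rule inj_onI)
      fix g h assume gh: "g \<in> equivariant_maps L" "h \<in> equivariant_maps L" "map g ts = map h ts"
      show "g = h"
        using gh ts by (intro PiE_ext[of g "gal L" "\<lambda>_. L" h]) (auto simp: equivariant_maps_def)
    qed
    moreover have "countable ((\<lambda>g. map g ts) ` equivariant_maps L)"
      using countable_lists[OF \<Omega>] by (rule countable_subset[rotated]) simp
    ultimately show ?thesis using countable_image_inj_on countable_image by blast
  qed
  ultimately show ?thesis unfolding finite_separable_elements_def by (intro countable_UN) auto
qed

text \<open>A diagonal argument. Finitely many entries do not matter in the quotient, so a pairing
  function splits a sequence of primes into infinitely many infinite classes, and the idempotent
  differs from the n-th member of S on the whole n-th class.\<close>

lemma idempotent_avoiding:
  fixes S :: "'k::field A\<^sub>K set"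
  assumes "countable S"
  shows "\<exists>\<alpha>. \<alpha> * \<alpha> = \<alpha> \<and> \<alpha> \<notin> S"
proof (cases "S = {}")
  case True
  then show ?thesis by (intro exI[of _ 0]) simp
next
  case False
  define b where "b n = rep_A\<^sub>K (from_nat_into S n)" for n
  have Sb: "\<exists>n. x = abs_A\<^sub>K (b n)" if "x \<in> S" for x
    using from_nat_into_surj[OF assms that] Quotient3_abs_rep[OF Quotient3_A\<^sub>K] unfolding b_def by metis
  obtain e :: "nat \<Rightarrow> 'k poly" where e: "inj e" "range e \<subseteq> {P. monic_irreducible P}"
    using infinite_countable_subset[OF infinite_monic_irreducible] by blast
  \<comment> \<open>Of the values 0 and 1, one that is incongruent to the entry to be avoided: 1 if
    that entry is 0 modulo P, and 0 otherwise.\<close>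
  define \<alpha> where "\<alpha> P = (if P dvd b (fst (prod_decode (inv_into UNIV e P))) P then 1 else 0 :: 'k poly)" for P
  have "abs_A\<^sub>K \<alpha> * abs_A\<^sub>K \<alpha> = abs_A\<^sub>K \<alpha>"
    unfolding times_A\<^sub>K.abs_eq by (rule arg_cong[of _ _ abs_A\<^sub>K]) (auto simp: \<alpha>_def)
  moreover have "abs_A\<^sub>K \<alpha> \<notin> S"
  proof
    assume "abs_A\<^sub>K \<alpha> \<in> S"
    then obtain n where "abs_A\<^sub>K \<alpha> = abs_A\<^sub>K (b n)" using Sb by blast
    then have "finite {P. monic_irreducible P \<and> \<not> P dvd \<alpha> P - b n P}"
      by (simp add: abs_A\<^sub>K_eq_iff eventually_primes_filter)
    moreover have "range (\<lambda>j. e (prod_encode (n, j))) \<subseteq> {P. monic_irreducible P \<and> \<not> P dvd \<alpha> P - b n P}"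
    proof safe
      fix j
      define P where "P = e (prod_encode (n, j))"
      have P: "monic_irreducible P" using e(2) by (auto simp: P_def)
      then show "monic_irreducible (e (prod_encode (n, j)))" by (simp add: P_def)
      have \<alpha>P: "\<alpha> P = (if P dvd b n P then 1 else 0)" by (simp add: \<alpha>_def P_def inv_f_f[OF e(1)])
      assume "e (prod_encode (n, j)) dvd \<alpha> (e (prod_encode (n, j))) - b n (e (prod_encode (n, j)))"
      then have d: "P dvd \<alpha> P - b n P" by (simp add: P_def)
      show False
      proof (cases "P dvd b n P")
        case True
        then have "P dvd 1" using d \<alpha>P dvd_add[of P "1 - b n P" "b n P"] by simp
        then show False using P by (simp add: monic_irreducible_def irreducible_def)
      qed (use d \<alpha>P in simp)
    qed
    moreover have "infinite (range (\<lambda>j. e (prod_encode (n, j))))"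
    proof -
      have "inj (\<lambda>j. e (prod_encode (n, j)))"
        by (rule injI) (use e(1) in \<open>auto dest!: injD\<close>)
      then show ?thesis by (rule range_inj_infinite)
    qed
    ultimately show False using finite_subset by blast
  qed
  ultimately show ?thesis by blast
qed

lemma separable_linear: "separable_poly [:- c, 1:]"
proof -
  have "rsquarefree (\<Prod>y\<in>{to_ac c}. [:- y, 1:])" by (rule rsquarefree_prod_linear) simp
  then show ?thesis
    by (simp add: separable_poly_def Polynomial.map_poly_pCons[where f = to_ac, OF to_ac_0])
qed

lemma idempotent_separably_algebraic:
  fixes \<alpha> :: "'k::{field,finite} A\<^sub>K"
  assumes "\<alpha> * \<alpha> = \<alpha>"
  shows "\<alpha> \<in> separably_algebraic_elements"
proof -
  let ?fs = "[[:- 0, 1:], [:- 1, 1:]] :: 'k poly fract poly list"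
  have ne: "prod_list ?fs \<noteq> 0" by (simp del: mult_pCons_left mult_pCons_right)
  have sep: "\<forall>h\<in>set ?fs. separable_poly h" using separable_linear[of 0] separable_linear[of 1] by simp
  have "prod_list ?fs = [:0, -1, 1:]" by simp
  then have "poly (map_poly of_K (prod_list ?fs)) \<alpha> = \<alpha> * (\<alpha> - 1)"
    by (simp add: Polynomial.map_poly_pCons[where f = of_K, OF of_K.hom_zero] of_K.hom_uminus)
  also have "\<dots> = 0" using assms by (simp add: algebra_simps)
  finally show ?thesis unfolding separably_algebraic_elements_def using ne sep by blast
qed

lemma finite_separable_psubset:
  "(finite_separable_elements :: 'k::{field,finite} A\<^sub>K set) \<subset> separably_algebraic_elements"
  using finite_separable_subset_separably_algebraic idempotent_separably_algebraic
    idempotent_avoiding[OF countable_finite_separable] by blast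

section \<open>An inseparable algebraic element\<close>

text \<open>The shift by 1 permutes the field, so adding 1 to each of its q elements does not change
  their sum.\<close>

lemma of_nat_card_eq_0: "of_nat CARD('k) = (0 :: 'k::{field,finite})"
proof -
  have "(\<Sum>c\<in>UNIV. c) = (\<Sum>c\<in>UNIV. c + 1 :: 'k)"
    by (rule sum.reindex_bij_witness[of _ "\<lambda>c. c + 1" "\<lambda>c. c - 1"]) auto
  also have "\<dots> = (\<Sum>c\<in>UNIV. c) + of_nat CARD('k)" by (simp add: sum.distrib)
  finally show ?thesis by simp
qed

lemma rsquarefree_pderiv_nonzero:
  fixes p :: "'a::field poly"
  assumes "rsquarefree p" "poly p t = 0"
  shows "poly (pderiv p) t \<noteq> 0"
proof
  assume d: "poly (pderiv p) t = 0"
  obtain r where r: "p = [:- t, 1:] * r" using assms(2) by (metis dvdE poly_eq_0_iff_dvd)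
  have "poly (pderiv p) t = poly r t" unfolding r pderiv_mult by (simp add: pderiv_pCons)
  then obtain s where "r = [:- t, 1:] * s" using d by (metis dvdE poly_eq_0_iff_dvd)
  then have "[:- t, 1:] ^ 2 dvd p" using r by (simp add: power2_eq_square mult.assoc del: mult_pCons_left mult_pCons_right)
  moreover have "p \<noteq> 0" using assms(1) by (simp add: rsquarefree_def)
  ultimately have "order t p \<ge> 2" by (simp add: order_divides)
  then show False using assms(1) by (auto simp: rsquarefree_def dest: spec[of _ t])
qed

text \<open>The family \<open>\<theta>\<^bsup>q^(deg P - 1)\<^esup>\<close> is a \<open>q\<close>-th root of \<open>\<theta>\<close>. If it is annihilated by a product of
  separable polynomials, then one of the factors vanishes at a \<open>q\<close>-th root \<open>t\<close> of \<open>\<theta>\<close> in the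
  algebraic closure; differentiating \<open>h(t)\<^sup>q = 0\<close> with respect to \<open>\<theta>\<close> gives \<open>h'(t)\<^sup>q = 0\<close>.\<close>

lemma separably_algebraic_psubset:
  "(separably_algebraic_elements :: 'k::{field,finite} A\<^sub>K set) \<subset> algebraic_elements"
proof -
  define q where "q = CARD('k)"
  have q: "q > 1" using card_mono[of "UNIV :: 'k set" "{0, 1}"] by (simp add: q_def)
  define \<theta> :: "'k poly" where "\<theta> = [:0, 1:]"
  define a where "a P = \<theta> ^ (q ^ (degree P - 1))" for P :: "'k poly"
  have aq: "\<forall>\<^sub>F P in primes_filter. P dvd a P ^ q - \<theta>"
    using eventually_irreducible
  proof eventually_elim
    case (elim P)
    then have P: "irreducible P" by blast
    have "a P ^ q = \<theta> ^ (q ^ (degree P - 1) * q)" unfolding a_def by (simp add: power_mult)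
    also have "q ^ (degree P - 1) * q = q ^ degree P"
      using irreducible_degree_pos[OF P] by (metis One_nat_def Suc_pred power_Suc2)
    finally show ?case using residue_fermat[OF P, of \<theta>] by (simp add: q_def)
  qed
  have sub: "(separably_algebraic_elements :: 'k A\<^sub>K set) \<subseteq> algebraic_elements"
    unfolding separably_algebraic_elements_def algebraic_elements_def by blast
  have "abs_A\<^sub>K a \<in> algebraic_elements"
  proof -
    define G :: "'k poly poly" where "G = monom 1 q - [:\<theta>:]"
    have "coeff G q = 1" using q by (simp add: G_def coeff_eq_0)
    then have "map_poly to_fract G \<noteq> 0" by auto
    moreover have "poly (map_poly of_K (map_poly to_fract G)) (abs_A\<^sub>K a) = 0"
      using aq by (subst poly_of_K_eq_0_iff[of G 1]) (auto simp: G_def poly_monom)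
    ultimately show ?thesis unfolding algebraic_elements_def by blast
  qed
  moreover have "abs_A\<^sub>K a \<notin> separably_algebraic_elements"
  proof
    assume "abs_A\<^sub>K a \<in> separably_algebraic_elements"
    then obtain f fs where f: "f = prod_list fs" "\<And>h. h \<in> set fs \<Longrightarrow> separable_poly h"
      "poly (map_poly of_K f) (abs_A\<^sub>K a) = 0" unfolding separably_algebraic_elements_def by blast
    obtain t :: "'k poly fract alg_closure" where t: "t ^ q = of_R \<theta>"
      using nth_root_exists[of q] q by auto
    \<comment> \<open>The q-th power of G(t) as a polynomial in \<open>\<theta>\<close>; t drops out
      because t^q = \<open>\<theta>\<close>. The same expression is congruent modulo P to the q-th
      power of \<open>poly G (a P)\<close>, which links the entries with the algebraic
      closure.\<close>
    define tw where "tw G = (\<Sum>i\<le>degree G. coeff G i ^ q * \<theta> ^ i)" for G :: "'k poly poly"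
    have tw_t: "poly (map_poly of_R G) t ^ q = of_R (tw G)" for G
    proof -
      have "poly (map_poly of_R G) t ^ q = (\<Sum>i\<le>degree G. (of_R (coeff G i) * t ^ i) ^ q)"
        using power_card_power_sum[of "\<lambda>i. of_R (coeff G i) * t ^ i" "{..degree G}" 1]
        by (simp add: poly_altdef q_def)
      also have "\<dots> = of_R (tw G)"
        by (simp add: tw_def of_R.hom_sum of_R.hom_mult of_R.hom_power t[symmetric] power_mult_distrib
            power_mult[symmetric] mult.commute)
      finally show ?thesis .
    qed
    have add_q: "(x + y) ^ q = x ^ q + y ^ q" for x y :: "'k poly"
    proof -
      have "of_R ((x + y) ^ q) = of_R (x ^ q + y ^ q)"
        using power_card_add[of "of_R x" "of_R y"] by (simp add: q_def of_R.hom_add of_R.hom_power)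
      then show ?thesis by simp
    qed
    have sum_q: "(\<Sum>i\<in>I. g i) ^ q = (\<Sum>i\<in>I. g i ^ q)" for I :: "nat set" and g :: "nat \<Rightarrow> 'k poly"
      using q by (induction I rule: infinite_finite_induct) (auto simp: add_q)
    obtain d G where dG: "d \<noteq> 0" "map_poly to_fract G = Polynomial.smult (to_fract d) f"
      using clear_denominators[of f] by auto
    have "\<forall>\<^sub>F P in primes_filter. P dvd poly G (a P)"
      using f(3) poly_of_K_eq_0_iff[OF dG(2,1)] by blast
    with aq have "\<forall>\<^sub>F P in primes_filter. P dvd tw G"
    proof eventually_elim
      case (elim P)
      have "poly G (a P) ^ q = (\<Sum>i\<le>degree G. coeff G i ^ q * (a P ^ q) ^ i)"
        unfolding poly_altdef sum_q
        by (simp add: power_mult_distrib power_mult[symmetric] mult.commute)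
      moreover have "P dvd (\<Sum>i\<le>degree G. coeff G i ^ q * (a P ^ q) ^ i) - tw G"
        unfolding tw_def sum_subtractf[symmetric] right_diff_distrib[symmetric]
      proof (intro dvd_sum dvd_mult)
        fix i
        show "P dvd (a P ^ q) ^ i - \<theta> ^ i" using elim(1) cong_pow[of "a P ^ q" \<theta> P i] by (simp add: cong_iff_dvd_diff)
      qed
      moreover have "P dvd poly G (a P) ^ q" using dvd_trans[OF elim(2) dvd_power[of q]] q by simp
      ultimately have "P dvd poly G (a P) ^ q - (poly G (a P) ^ q - tw G)" by (metis dvd_diff)
      then show ?case by simp
    qed
    \<comment> \<open>\<open>tw G\<close> does not depend on P, so divisibility by almost all P
      makes it 0.\<close>
    then have "tw G = 0" by (rule eventually_dvd_const)
    then have "poly (map_poly of_R G) t = 0" using tw_t[of G] q by simp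
    then have "poly (map_poly to_ac f) t = 0"
      using dG by (simp add: map_poly_of_R hom_distribs)
    then have "poly (map_poly to_ac (prod_list fs)) t = 0" by (simp add: f(1))
    then have "\<exists>h\<in>set fs. poly (map_poly to_ac h) t = 0"
      by (induction fs) (auto simp: map_to_ac.hom_mult)
    then obtain h where h: "h \<in> set fs" "poly (map_poly to_ac h) t = 0" by blast
    obtain d H where dH: "d \<noteq> 0" "map_poly to_fract H = Polynomial.smult (to_fract d) h"
      using clear_denominators[of h] by auto
    have HR: "map_poly of_R H = Polynomial.smult (of_R d) (map_poly to_ac h)"
      by (simp add: map_poly_of_R dH(2) hom_distribs of_R_def)
    have "poly (map_poly of_R H) t = 0" using h(2) by (simp add: HR)
    then have "tw H = 0" using tw_t[of H] q by (simp add: power_0_left)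
    \<comment> \<open>As q-th powers have derivative 0, only the powers of \<open>\<theta>\<close>
      in \<open>tw H\<close> are differentiated. The result is \<open>tw (pderiv H)\<close>, because
      the integer factors equal their own q-th powers.\<close>
    have pd: "pderiv (coeff H i ^ q) = 0" for i
      by (simp add: pderiv_power q_def of_nat_card_eq_0)
    have nat_q: "of_nat n ^ q = (of_nat n :: 'k poly)" for n
      by (simp add: of_nat_poly poly_const_pow q_def finite_field_fermat)
    have "0 = pderiv (tw H)" using \<open>tw H = 0\<close> by simp
    also have "\<dots> = (\<Sum>i\<le>degree H. coeff H i ^ q * pderiv (\<theta> ^ i))"
      unfolding tw_def pderiv_sum by (simp add: pderiv_mult pd)
    also have "\<dots> = (\<Sum>i\<le>degree H. of_nat i * coeff H i ^ q * \<theta> ^ (i - 1))"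
      by (intro sum.cong refl) (simp add: pderiv_power \<theta>_def pderiv_pCons of_nat_poly)
    also have "\<dots> = (\<Sum>i\<le>Suc (degree H). of_nat i * coeff H i ^ q * \<theta> ^ (i - 1))"
      using q by (simp add: coeff_eq_0)
    also have "\<dots> = (\<Sum>i\<le>degree H. of_nat (Suc i) * coeff H (Suc i) ^ q * \<theta> ^ i)"
      by (subst sum.atMost_Suc_shift) simp
    also have "\<dots> = (\<Sum>i\<le>degree H. coeff (pderiv H) i ^ q * \<theta> ^ i)"
      by (intro sum.cong refl) (simp only: coeff_pderiv power_mult_distrib nat_q)
    also have "\<dots> = tw (pderiv H)"
      unfolding tw_def
    proof (rule sum.mono_neutral_right)
      show "{..degree (pderiv H)} \<subseteq> {..degree H}" using degree_pderiv_le[of H] by auto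
      show "\<forall>i\<in>{..degree H} - {..degree (pderiv H)}. coeff (pderiv H) i ^ q * \<theta> ^ i = 0"
        using q by (auto simp: coeff_eq_0 not_le simp del: coeff_pderiv)
    qed simp
    finally have "poly (map_poly of_R (pderiv H)) t = 0" using tw_t[of "pderiv H"] q by simp
    moreover have "map_poly of_R (pderiv H) = Polynomial.smult (of_R d) (pderiv (map_poly to_ac h))"
      unfolding of_R.map_poly_pderiv HR pderiv_smult ..
    ultimately have "poly (pderiv (map_poly to_ac h)) t = 0" using dH(1) by simp
    moreover have "rsquarefree (map_poly to_ac h)" using f(2)[OF h(1)] by (simp add: separable_poly_def)
    ultimately show False using rsquarefree_pderiv_nonzero h(2) by blast
  qed
  ultimately show ?thesis using sub by blast
qed

section \<open>A transcendental element\<close>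

text \<open>The degrees of the entries \<open>\<theta>\<^bsup>floor_sqrt (deg P)\<^esup>\<close> tend to infinity, but slower than any
  positive multiple of \<open>deg P\<close>.\<close>

lemma algebraic_psubset: "(algebraic_elements :: 'k::{field,finite} A\<^sub>K set) \<subset> UNIV"
proof -
  define \<theta> :: "'k poly" where "\<theta> = [:0, 1:]"
  define a where "a P = \<theta> ^ floor_sqrt (degree P)" for P :: "'k poly"
  have deg\<theta>: "degree (\<theta> ^ n) = n" for n by (simp add: \<theta>_def degree_linear_power[of 0, simplified])
  have \<theta>0: "\<theta> ^ n \<noteq> 0" for n by (simp add: \<theta>_def)
  have "abs_A\<^sub>K a \<notin> algebraic_elements"
  proof
    assume "abs_A\<^sub>K a \<in> algebraic_elements"
    then obtain f where f: "f \<noteq> 0" "poly (map_poly of_K f) (abs_A\<^sub>K a) = 0"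
      unfolding algebraic_elements_def by blast
    obtain d G where dG: "d \<noteq> 0" "map_poly to_fract G = Polynomial.smult (to_fract d) f"
      using clear_denominators[of f] by auto
    have G0: "G \<noteq> 0" using dG f(1) by auto
    have ev: "\<forall>\<^sub>F P in primes_filter. P dvd poly G (a P)"
      using f(2) poly_of_K_eq_0_iff[OF dG(2,1)] by blast
    define N where "N = degree G"
    define D where "D = (\<Sum>i\<le>N. degree (coeff G i))"
    have D: "degree (coeff G i) \<le> D" if "i \<le> N" for i
      unfolding D_def using that by (intro member_le_sum) auto
    \<comment> \<open>For n >= m the top term dominates when N > 0, as D + n * (N - 1) < n * N.
      Moreover D + n * N < n * m <= n^2 <= deg P, so that P cannot divide the nonzero value.\<close>
    define m where "m = Suc (D + N)"
    have "\<forall>\<^sub>F P :: 'k poly in primes_filter. False"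
      using ev eventually_degree_ge[of "m\<^sup>2"]
    proof eventually_elim
      case (elim P)
      define n where "n = floor_sqrt (degree P)"
      have "floor_sqrt (m\<^sup>2) \<le> n" unfolding n_def using elim(2) by (rule monoD[OF mono_floor_sqrt])
      then have nm: "n \<ge> m" by simp
      have nP: "n\<^sup>2 \<le> degree P" unfolding n_def by (rule floor_sqrt_power2_le)
      define lead where "lead = coeff G N * (\<theta> ^ n) ^ N"
      define rest where "rest = (\<Sum>i<N. coeff G i * (\<theta> ^ n) ^ i)"
      have pG: "poly G (a P) = lead + rest"
        by (simp add: poly_altdef N_def[symmetric] lead_def rest_def a_def n_def[symmetric]
            lessThan_Suc_atMost[symmetric] add.commute)
      have cN: "coeff G N \<noteq> 0" using G0 by (simp add: N_def)
      have lead0: "lead \<noteq> 0" using cN \<theta>0 by (simp add: lead_def)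
      have deg_t: "degree (coeff G i * (\<theta> ^ n) ^ i) \<le> D + n * i" if "i \<le> N" for i
      proof -
        have "degree (coeff G i * (\<theta> ^ n) ^ i) \<le> degree (coeff G i) + degree ((\<theta> ^ n) ^ i)"
          by (rule degree_mult_le)
        also have "degree ((\<theta> ^ n) ^ i) = n * i" by (simp only: power_mult[symmetric] deg\<theta>)
        finally show ?thesis using D[OF that] by simp
      qed
      have deg_lead: "degree lead = degree (coeff G N) + n * N"
        unfolding lead_def power_mult[symmetric] using cN \<theta>0 by (simp add: degree_mult_eq deg\<theta>)
      have ne: "lead + rest \<noteq> 0"
      proof (cases "N = 0")
        case False
        have "degree rest \<le> D + n * (N - 1)"
          unfolding rest_def
        proof (rule degree_sum_le)
          fix i assume "i \<in> {..<N}"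
          then have "degree (coeff G i * (\<theta> ^ n) ^ i) \<le> D + n * i" "n * i \<le> n * (N - 1)"
            using deg_t[of i] by auto
          then show "degree (coeff G i * (\<theta> ^ n) ^ i) \<le> D + n * (N - 1)" by linarith
        qed simp
        also have "\<dots> < n * N" using nm False by (cases N) (auto simp: m_def)
        finally have "degree rest < degree lead" using deg_lead by simp
        then have "degree (lead + rest) = degree lead" by (rule degree_add_eq_left)
        moreover have "degree lead > 0" using \<open>degree rest < degree lead\<close> by simp
        ultimately show ?thesis by (metis degree_0 less_irrefl)
      qed (use lead0 in \<open>simp add: rest_def\<close>)
      have "degree (lead + rest) \<le> D + n * N"
      proof (rule degree_add_le)
        show "degree lead \<le> D + n * N" unfolding lead_def by (rule deg_t) simp
        show "degree rest \<le> D + n * N" unfolding rest_def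
        proof (rule degree_sum_le)
          fix i assume "i \<in> {..<N}"
          then have "degree (coeff G i * (\<theta> ^ n) ^ i) \<le> D + n * i" "n * i \<le> n * N"
            using deg_t[of i] by auto
          then show "degree (coeff G i * (\<theta> ^ n) ^ i) \<le> D + n * N" by linarith
        qed simp
      qed
      also have "\<dots> < n * (D + 1) + n * N"
        using nm by (simp add: m_def)
      also have "\<dots> = n * m" by (simp add: m_def algebra_simps)
      also have "\<dots> \<le> n\<^sup>2" using nm by (simp add: power2_eq_square)
      finally have "degree (lead + rest) < degree P" using nP by linarith
      then show False using dvd_imp_degree_le[of P "lead + rest"] elim(1) pG ne by simp
    qed
    then show False using primes_filter_nontrivial[where 'k = 'k] by (simp add: trivial_limit_def)
  qed
  then show ?thesis by blast
qed

section \<open>A finite separable element outside the base field\<close>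

text \<open>The map sends both 0 and 1 to 0, so on a finite field it is not onto; this holds in
  every characteristic.\<close>

lemma artin_schreier_no_root: "\<exists>c :: 'k::{field,finite}. \<forall>x. x * x - x \<noteq> c"
proof (rule ccontr)
  assume "\<not> ?thesis"
  then have "surj (\<lambda>x :: 'k. x * x - x)" by (auto simp: surj_def) metis
  then have "inj (\<lambda>x :: 'k. x * x - x)" by (rule finite_UNIV_surj_inj[rotated]) simp
  then show False using injD[of "\<lambda>x :: 'k. x * x - x" 0 1] by simp
qed

text \<open>The degrees of the irreducible factors add up to the degree of f, so they are not all
  even.\<close>

lemma odd_degree_irreducible_factor:
  fixes f :: "'k::field poly"
  assumes "odd (degree f)"
  shows "\<exists>P. monic_irreducible P \<and> P dvd f \<and> odd (degree P)"
  using assms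
proof (induction "degree f" arbitrary: f rule: less_induct)
  case less
  have "degree f > 0" using less.prems by (cases "degree f") auto
  then obtain P where P: "monic_irreducible P" "P dvd f" using monic_irreducible_divisor_exists by blast
  show ?case
  proof (cases "odd (degree P)")
    case False
    obtain g where g: "f = P * g" using P(2) by (rule dvdE)
    have nz: "P \<noteq> 0" "g \<noteq> 0" using g \<open>degree f > 0\<close> by auto
    have deg: "degree f = degree P + degree g" using g nz by (simp add: degree_mult_eq)
    have "degree P > 0" using P(1) irreducible_degree_pos by (auto simp: monic_irreducible_def)
    then have "\<exists>P'. monic_irreducible P' \<and> P' dvd g \<and> odd (degree P')"
      using False less.prems deg by (intro less.hyps) auto
    then show ?thesis using g by auto
  qed (use P in blast)
qed

lemma frequently_odd_degree: "\<exists>\<^sub>F P :: 'k::field poly in primes_filter. odd (degree P)"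
  unfolding frequently_def
proof
  assume "\<forall>\<^sub>F P :: 'k poly in primes_filter. \<not> odd (degree P)"
  then have fin: "finite {P :: 'k poly. monic_irreducible P \<and> odd (degree P)}" (is "finite ?S")
    by (simp add: eventually_primes_filter)
  define D where "D = \<Prod>?S"
  have D0: "D \<noteq> 0" unfolding D_def using fin by (auto simp: prod_zero_iff monic_irreducible_def)
  \<comment> \<open>A multiple of all primes of odd degree, with the power of X chosen to make its
    own degree odd; then f + 1 has odd degree too, hence a new prime factor of odd degree.\<close>
  define f :: "'k poly" where "f = monom 1 (if odd (degree D) then 2 else 1) * D"
  have "degree f = (if odd (degree D) then 2 else 1) + degree D"
    unfolding f_def using D0 by (subst degree_mult_eq) (auto simp: degree_monom_eq)
  then have odd: "odd (degree f)" by auto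
  then have "degree (f + 1) = degree f" by (intro degree_add_eq_left) (cases "degree f", auto)
  then obtain P where P: "monic_irreducible P" "P dvd f + 1" "odd (degree P)"
    using odd_degree_irreducible_factor[of "f + 1"] odd by auto
  have "P dvd f" unfolding f_def D_def using fin P by (intro dvd_mult dvd_prodI) auto
  then have "P dvd 1" using P(2) by (simp add: dvd_add_right_iff)
  then show False using P(1) by (simp add: monic_irreducible_def irreducible_def)
qed

text \<open>X^q - X has at most q roots, and the q constants are roots already.\<close>

lemma power_card_fixed:
  fixes z :: "'k::{field,finite} poly fract alg_closure"
  assumes "z ^ CARD('k) = z"
  shows "\<exists>c. z = of_R [:c:]"
proof (rule ccontr)
  assume neg: "\<not> ?thesis"
  define q where "q = CARD('k)"
  have q: "q > 1" using card_mono[of "UNIV :: 'k set" "{0, 1}"] by (simp add: q_def)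
  let ?E = "monom 1 q - [:0, 1:] :: 'k poly fract alg_closure poly"
  have "coeff ?E q = 1" using q by (simp add: coeff_eq_0)
  then have E0: "?E \<noteq> 0" by (metis coeff_0 zero_neq_one)
  have inj: "inj (\<lambda>c :: 'k. of_R [:c:])" by (rule injI) simp
  have "insert z (range (\<lambda>c. of_R [:c:])) \<subseteq> {x. poly ?E x = 0}"
    using assms by (auto simp: poly_monom q_def poly_const_pow finite_field_fermat simp flip: of_R.hom_power)
  then have "card (insert z (range (\<lambda>c :: 'k. of_R [:c:]))) \<le> card {x. poly ?E x = 0}"
    by (rule card_mono[OF poly_roots_finite[OF E0]])
  also have "\<dots> \<le> degree ?E" by (rule card_poly_roots_bound[OF E0])
  also have "\<dots> \<le> q" using q by (intro degree_diff_le degree_monom_le) auto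
  finally show False using neg card_image[OF inj] by (auto simp: q_def image_iff)
qed

text \<open>With g the indicator of fixing \<open>\<omega>\<close>, a root of x^2 - x - c, the class
  \<open>ev L g\<close> is 1 at even and 0 at odd degrees. If it came from u / v, then u would have
  infinitely many prime divisors of odd degree and v - u infinitely many of even degree, forcing u =
  v = 0.\<close>

lemma range_of_K_psubset: "range of_K \<subset> (finite_separable_elements :: 'k::{field,finite} A\<^sub>K set)"
proof -
  define q where "q = CARD('k)"
  obtain c :: 'k where c: "\<And>x. x * x - x \<noteq> c" using artin_schreier_no_root by blast
  define \<kappa> where "\<kappa> = (of_R [:c:] :: 'k poly fract alg_closure)"
  have "degree [:- \<kappa>, - 1, 1:] > 0" by simp
  then obtain \<omega> where "poly [:- \<kappa>, - 1, 1:] \<omega> = 0" using alg_closed_imp_poly_has_root by blast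
  then have \<omega>: "\<omega> * \<omega> = \<omega> + \<kappa>" by (simp add: algebra_simps)
  have notk: "\<omega> \<noteq> of_R [:d:]" for d
  proof
    assume "\<omega> = of_R [:d:]"
    then have "of_R ([:d:] * [:d:]) = of_R ([:d:] + [:c:])"
      using \<omega> by (simp only: \<kappa>_def of_R.hom_mult of_R.hom_add)
    then have "[:d:] * [:d:] = [:d:] + [:c:]" by (simp only: of_R.eq_iff)
    then have "d * d - d = c" by simp
    then show False using c by blast
  qed
  \<comment> \<open>In characteristic 2 the equality would give 0 = 1; otherwise it would make
    \<open>\<omega>\<close> the constant 1/2.\<close>
  have ne: "\<omega> \<noteq> 1 - \<omega>"
  proof
    assume "\<omega> = 1 - \<omega>"
    then have "\<omega> + \<omega> = 1" by (metis diff_add_cancel)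
    moreover have "[:2 :: 'k:] = 1 + 1" by (simp add: one_pCons)
    then have "of_R [:2 :: 'k:] = 1 + 1" by (simp only: of_R.hom_add of_R.hom_one)
    ultimately have 2: "of_R [:2:] * \<omega> = 1" by (simp only: distrib_right mult_1)
    show False
    proof (cases "(2 :: 'k) = 0")
      case True
      then show False using 2 by simp
    next
      case False
      have "of_R [:inverse 2:] = of_R [:inverse 2:] * (of_R [:2:] * \<omega>)" using 2 by simp
      also have "\<dots> = of_R ([:inverse 2:] * [:2:]) * \<omega>" by (simp only: of_R.hom_mult mult.assoc)
      also have "[:inverse 2:] * [:2:] = (1 :: 'k poly)" using False by (simp add: one_pCons)
      finally show False using notk[of "inverse 2"] by simp
    qed
  qed
  have roots: "z * z = z + \<kappa> \<longleftrightarrow> z = \<omega> \<or> z = 1 - \<omega>" for z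
  proof -
    have "(z - \<omega>) * (z - (1 - \<omega>)) = z * z - (z + \<kappa>) - (\<omega> * \<omega> - (\<omega> + \<kappa>))"
      by (simp add: algebra_simps)
    then have "(z - \<omega>) * (z - (1 - \<omega>)) = 0 \<longleftrightarrow> z * z = z + \<kappa>" using \<omega> by simp
    then show ?thesis by simp
  qed
  define L where "L = gen {\<omega>, 1 - \<omega>}"
  define f where "f = [:- to_fract [:c:], - 1, 1:]"
  have mf: "map_poly to_ac f = (\<Prod>y\<in>{\<omega>, 1 - \<omega>}. [:- y, 1:])"
  proof -
    have "(\<omega> - 1) * \<omega> = \<kappa>" using \<omega> by (simp add: algebra_simps)
    then show ?thesis
      using ne by (simp add: f_def Polynomial.map_poly_pCons[where f = to_ac, OF to_ac_0] \<kappa>_def of_R_def)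
  qed
  have L: "finite_galois L"
    unfolding L_def
  proof (rule finite_galois_gen)
    fix a assume a: "a \<in> {\<omega>, 1 - \<omega>}"
    have "separable_poly f" unfolding separable_poly_def mf by (rule rsquarefree_prod_linear) simp
    moreover have "poly (map_poly to_ac f) z = 0 \<longleftrightarrow> z \<in> {\<omega>, 1 - \<omega>}" for z
      unfolding mf poly_prod by (subst prod_zero_iff) auto
    ultimately show "\<exists>f. separable_poly f \<and> poly (map_poly to_ac f) a = 0 \<and>
      {x. poly (map_poly to_ac f) x = 0} \<subseteq> {\<omega>, 1 - \<omega>}"
      using a by (intro exI[of _ f]) blast
  qed simp
  note LI = galois_intermediate[OF L]
  note cl = integers_closed[OF LI]
  have \<omega>L: "\<omega> \<in> L" "1 - \<omega> \<in> L" using gen_superset unfolding L_def by blast+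
  have m\<kappa>: "of_R [:- c:] = - \<kappa>" by (simp add: \<kappa>_def flip: of_R.hom_uminus)
  have "poly (map_poly of_R [:- [:c:], - 1, 1:]) \<omega> = 0"
    using \<omega> by (simp add: Polynomial.map_poly_pCons[where f = of_R, OF of_R.hom_zero] of_R.hom_uminus
        algebra_simps m\<kappa>)
  then have "integral \<omega>" unfolding integral_def by (intro exI[of _ "[:- [:c:], - 1, 1:]"]) simp
  then have \<omega>i: "\<omega> \<in> integers L" using \<omega>L by (simp add: integers_altdef)
  have conj: "\<sigma> \<omega> = \<omega> \<or> \<sigma> \<omega> = 1 - \<omega>" if s: "\<sigma> \<in> gal L" for \<sigma>
  proof -
    note se = embedding_onD[OF galD(1)[OF L s] LI]
    have "\<sigma> (\<omega> * \<omega>) = \<sigma> (\<omega> + \<kappa>)" by (simp add: \<omega>)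
    moreover have "\<kappa> \<in> L" "\<sigma> \<kappa> = \<kappa>" using gal_of_R[OF L s] intermediateD(1)[OF LI] by (auto simp: \<kappa>_def of_R_def)
    ultimately have "\<sigma> \<omega> * \<sigma> \<omega> = \<sigma> \<omega> + \<kappa>" using \<omega>L by (simp add: se)
    then show ?thesis by (simp add: roots)
  qed
  have \<kappa>q: "\<kappa> ^ q = \<kappa>"
    by (simp add: \<kappa>_def q_def poly_const_pow finite_field_fermat flip: of_R.hom_power)
  have "\<omega> ^ q * \<omega> ^ q = \<omega> ^ q + \<kappa>"
    using power_card_add[of \<omega> \<kappa>] \<omega> \<kappa>q by (simp add: q_def flip: power_mult_distrib)
  moreover have "\<omega> ^ q \<noteq> \<omega>" using power_card_fixed[of \<omega>] notk by (auto simp: q_def)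
  ultimately have \<omega>q: "\<omega> ^ q = 1 - \<omega>" using roots by blast
  have "(\<omega> + (1 - \<omega>)) ^ q = \<omega> ^ q + (1 - \<omega>) ^ q" unfolding q_def by (rule power_card_add)
  then have \<omega>q': "(1 - \<omega>) ^ q = \<omega>" by (simp add: \<omega>q)
  \<comment> \<open>The q-th power interchanges the two roots, so its n-fold iterate records the
    parity of n.\<close>
  have \<omega>qn: "\<omega> ^ (q ^ n) = (if even n then \<omega> else 1 - \<omega>)" for n
    by (induction n) (simp_all add: power_mult mult.commute[of q] \<omega>q \<omega>q' del: power_Suc add: power_Suc2)
  \<comment> \<open>Modulo a prime not containing \<open>\<delta>\<close> the two roots stay
    distinct, so that the parity can be read off.\<close>
  define \<delta> where "\<delta> = \<omega> - (1 - \<omega>)"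
  have \<delta>i: "\<delta> \<in> integers L" unfolding \<delta>_def by (intro cl(3,7) \<omega>i)
  have "\<delta> \<noteq> 0" using ne by (simp add: \<delta>_def)
  note ev\<delta> = eventually_notin_prime[OF L \<delta>i this]
  \<comment> \<open>Modulo a prime over a divisor P of u^2 - u - c, the element u, which is
    congruent to its Q-th power, is congruent to one of the two roots. Odd degree would interchange
    the roots and put \<open>\<delta>\<close> into that prime. Choosing u divisible by all
    exceptional P keeps the new P away from them, because c is nonzero.\<close>
  have feven: "\<exists>\<^sub>F P :: 'k poly in primes_filter. even (degree P)"
    unfolding frequently_def
  proof
    assume "\<forall>\<^sub>F P :: 'k poly in primes_filter. \<not> even (degree P)"
    from eventually_conj[OF this ev\<delta>]
    have fin: "finite {P :: 'k poly. monic_irreducible P \<and> \<not> (\<not> even (degree P) \<and> (\<forall>\<pp>. prime_over L P \<pp> \<longrightarrow> \<delta> \<notin> \<pp>))}"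
      (is "finite ?S") by (simp only: eventually_primes_filter)
    \<comment> \<open>The factor X keeps u nonconstant even if there are no exceptional
      primes.\<close>
    define u :: "'k poly" where "u = [:0, 1:] * \<Prod>?S"
    have "\<Prod>?S \<noteq> 0" using fin by (auto simp: prod_zero_iff monic_irreducible_def)
    then have du: "degree u > 0" unfolding u_def by (subst degree_mult_eq) auto
    then have "u \<noteq> 0" by auto
    have "degree (u * u) = degree u + degree u" using \<open>u \<noteq> 0\<close> by (simp add: degree_mult_eq)
    moreover have "degree (u + [:c:]) \<le> degree u" by (rule degree_add_le) auto
    ultimately have "degree (- (u + [:c:])) < degree (u * u)" unfolding degree_minus using du by linarith
    from degree_add_eq_left[OF this] have "degree (u * u - (u + [:c:])) = degree (u * u)"
      by (simp only: diff_conv_add_uminus)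
    then have "degree (u * u - (u + [:c:])) > 0" using du \<open>degree (u * u) = _\<close> by simp
    then obtain P where P: "monic_irreducible P" "P dvd u * u - (u + [:c:])"
      using monic_irreducible_divisor_exists by blast
    have Pi: "irreducible P" using P(1) by (simp add: monic_irreducible_def)
    have "P \<notin> ?S"
    proof
      assume "P \<in> ?S"
      then have "P dvd u" unfolding u_def using fin by (intro dvd_mult dvd_prodI) auto
      then have "P dvd u * u - u" by simp
      then have "P dvd (u * u - u) - (u * u - (u + [:c:]))" using P(2) by (rule dvd_diff)
      then have "P dvd [:c:]" by simp
      moreover have "c \<noteq> 0" using c[of 0] by auto
      then have "[:c:] dvd 1" by (simp add: is_unit_const_poly_iff dvd_field_iff)
      ultimately show False using Pi dvd_trans unfolding irreducible_def by blast
    qed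
    then have odd: "odd (degree P)" and \<delta>: "\<And>\<pp>. prime_over L P \<pp> \<Longrightarrow> \<delta> \<notin> \<pp>" using P(1) by auto
    obtain \<pp> where pp: "prime_over L P \<pp>" using prime_over_exists[OF LI Pi] by blast
    note p = prime_overD[OF LI pp]
    define Q where "Q = q ^ degree P"
    have Qq: "Q = CARD('k) ^ degree P" by (simp add: Q_def q_def)
    \<comment> \<open>If u is congruent to z, then z is congruent to z^Q, which puts the difference
      of the roots into \<open>\<pp>\<close>.\<close>
    have key: "\<delta> \<in> \<pp>" if z: "of_R u - z \<in> \<pp>" "z \<in> integers L" "z ^ Q - z = \<delta> \<or> z ^ Q - z = - \<delta>" for z
    proof -
      have "(of_R u - z) * (of_R u - z) ^ (Q - 1) \<in> \<pp>"
        using z cl by (intro p(5)) auto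
      moreover have "Q = Suc (Q - 1)" using Qq by simp
      ultimately have "(of_R u - z) ^ Q \<in> \<pp>" by (metis power_Suc)
      moreover have "(of_R u - z) ^ Q = of_R u ^ Q - z ^ Q"
      proof -
        have "((of_R u - z) + z) ^ Q = (of_R u - z) ^ Q + z ^ Q"
          unfolding Qq by (rule power_card_power_add)
        then show ?thesis by simp
      qed
      ultimately have u1: "of_R u ^ Q - z ^ Q \<in> \<pp>" by simp
      have "of_R (u ^ Q - u) \<in> \<pp>" using residue_fermat[OF Pi, of u] p(8) by (simp add: Qq)
      then have u2: "of_R u ^ Q - of_R u \<in> \<pp>" by (simp add: of_R.hom_minus of_R.hom_power)
      have "(of_R u - z) - ((of_R u ^ Q - z ^ Q) - (of_R u ^ Q - of_R u)) \<in> \<pp>"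
        by (rule p(7)[OF z(1) p(7)[OF u1 u2]])
      then have "z ^ Q - z \<in> \<pp>" by (simp add: algebra_simps)
      then show ?thesis using z(3) p(6)[of "- \<delta>"] by auto
    qed
    have "(of_R u - \<omega>) * (of_R u - (1 - \<omega>)) = of_R (u * u - (u + [:c:])) - (\<omega> * \<omega> - (\<omega> + \<kappa>))"
      by (simp add: of_R.hom_minus of_R.hom_mult of_R.hom_add \<kappa>_def algebra_simps)
    also have "\<dots> \<in> \<pp>" using P(2) p(8) \<omega> by simp
    finally have "of_R u - \<omega> \<in> \<pp> \<or> of_R u - (1 - \<omega>) \<in> \<pp>"
      using \<omega>i cl by (intro p(9)) auto
    moreover have "\<omega> ^ Q - \<omega> = - \<delta>" using \<omega>qn odd by (simp add: Q_def \<delta>_def)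
    moreover have "(1 - \<omega>) ^ Q - (1 - \<omega>) = \<delta>"
    proof -
      have "(\<omega> + (1 - \<omega>)) ^ Q = \<omega> ^ Q + (1 - \<omega>) ^ Q" unfolding Qq by (rule power_card_power_add)
      then have "(1 - \<omega>) ^ Q = 1 - \<omega> ^ Q" by (simp add: algebra_simps)
      then show ?thesis using \<omega>qn odd by (simp add: Q_def \<delta>_def)
    qed
    ultimately have "\<delta> \<in> \<pp>" using key[of \<omega>] key[of "1 - \<omega>"] \<omega>i cl(3,7) by blast
    then show False using \<delta> pp by blast
  qed
  define g where "g = (\<lambda>\<sigma>\<in>gal L. if \<sigma> \<omega> = \<omega> then 1 else 0 :: 'k poly fract alg_closure)"
  have g: "g \<in> equivariant_maps L"
  proof -
    \<comment> \<open>The preimage of \<open>\<omega>\<close> under \<open>\<sigma>\<close> is one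
      of the two roots; their sum is 1, so \<open>\<tau>\<close> fixes both or neither.\<close>
    have "compose L (compose L \<sigma> \<tau>) (inv_into L \<sigma>) \<omega> = \<omega> \<longleftrightarrow> \<tau> \<omega> = \<omega>" if s: "\<sigma> \<in> gal L" and t: "\<tau> \<in> gal L" for \<sigma> \<tau>
    proof -
      define z where "z = inv_into L \<sigma> \<omega>"
      have z: "z \<in> L" "\<sigma> z = \<omega>" using gal_inv_into[OF L s \<omega>L(1)] by (auto simp: z_def)
      have "z = restrict (inv_into L \<sigma>) L \<omega>" using \<omega>L by (simp add: z_def)
      then have z': "z = \<omega> \<or> z = 1 - \<omega>" using conj[OF gal_inv[OF L s]] by simp
      have cz: "compose L (compose L \<sigma> \<tau>) (inv_into L \<sigma>) \<omega> = \<sigma> (\<tau> z)"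
        using \<omega>L z(1) by (simp add: compose_def z_def)
      have sz: "\<sigma> (\<tau> z) = \<sigma> z \<longleftrightarrow> \<tau> z = z"
        using inj_on_eq_iff[OF galD(4)[OF L s] galD(5)[OF L t z(1)] z(1)] .
      have "\<tau> (1 - \<omega>) = 1 - \<tau> \<omega>"
        using embedding_onD(3,7)[OF galD(1)[OF L t] LI] intermediateD(3)[OF LI] \<omega>L(1) by simp
      then have "\<tau> z = z \<longleftrightarrow> \<tau> \<omega> = \<omega>" using z' by auto
      then show ?thesis unfolding cz using sz by (simp only: z(2))
    qed
    moreover have "(1 :: 'k poly fract alg_closure) \<in> L" "(0 :: 'k poly fract alg_closure) \<in> L"
      using intermediateD[OF LI] by auto
    moreover have "\<sigma> 1 = 1" "\<sigma> 0 = 0" if "\<sigma> \<in> gal L" for \<sigma>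
      using embedding_onD(2,3)[OF galD(1)[OF L that] LI] by auto
    ultimately show ?thesis using gal_conj[OF L] by (simp add: g_def equivariant_maps_def)
  qed
  obtain \<alpha> where a: "ev L g = abs_A\<^sub>K \<alpha>" "\<forall>\<^sub>F P in primes_filter. good_prime L P \<and>
    (\<forall>\<pp>. prime_over L P \<pp> \<longrightarrow> cong_at L \<pp> (g (frobenius L P \<pp>)) (of_R (\<alpha> P)))"
    using ev_represented[OF L g] by blast
  have par: "\<forall>\<^sub>F P in primes_filter. P dvd \<alpha> P - (if even (degree P) then 1 else 0)"
    using a(2) ev\<delta>
  proof eventually_elim
    case (elim P)
    then obtain \<pp> where pp: "prime_over L P \<pp>" using good_prime_prime_over[OF L] by blast
    note p = prime_overD[OF LI pp]
    define \<phi> where "\<phi> = frobenius L P \<pp>"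
    have "is_frobenius L P \<pp> \<phi>" unfolding \<phi>_def using good_prime_frobenius(1)[OF L _ pp] elim by blast
    then have \<phi>: "\<phi> \<in> gal L" "\<phi> \<omega> - \<omega> ^ (q ^ degree P) \<in> \<pp>"
      using \<omega>i by (auto simp: is_frobenius_def q_def)
    have \<delta>: "\<delta> \<notin> \<pp>" "- \<delta> \<notin> \<pp>" using elim(2) pp p(6)[of "- \<delta>"] by auto
    have "\<phi> \<omega> = \<omega> \<longleftrightarrow> even (degree P)"
      using \<phi>(2) conj[OF \<phi>(1)] \<delta> ne unfolding \<omega>qn by (auto simp: \<delta>_def split: if_splits)
    then have "g \<phi> = of_R (if even (degree P) then 1 else 0)" using \<phi>(1) by (simp add: g_def)
    then have "cong_at L \<pp> (g \<phi>) (of_R (if even (degree P) then 1 else 0))"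
      using cong_at_refl[OF LI pp] by metis
    moreover have "cong_at L \<pp> (g \<phi>) (of_R (\<alpha> P))" unfolding \<phi>_def using elim(1) pp by blast
    ultimately show ?case using cong_at_unique[OF LI pp] by blast
  qed
  have "ev L g \<notin> range of_K"
  proof
    assume "ev L g \<in> range of_K"
    then obtain x where x: "of_K x = abs_A\<^sub>K \<alpha>" using a(1) by auto
    obtain u v where uv: "x = Fraction_Field.Fract u v" "v \<noteq> 0" by (cases x) auto
    have "\<forall>\<^sub>F P in primes_filter. P dvd v * \<alpha> P - u" using of_K_Fract[OF uv(2)] x uv(1) by blast
    with par have E: "\<forall>\<^sub>F P in primes_filter. P dvd (if even (degree P) then v - u else u)"
    proof eventually_elim
      case (elim P)
      have "P dvd (v * \<alpha> P - u) - v * (\<alpha> P - (if even (degree P) then 1 else 0))"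
        by (rule dvd_diff[OF elim(2) dvd_mult[OF elim(1)]])
      then show ?case by (cases "even (degree P)") (auto simp: algebra_simps)
    qed
    have zero: "r = 0" if "\<exists>\<^sub>F P in primes_filter. P dvd r" for r :: "'k poly"
    proof (rule ccontr)
      assume "r \<noteq> 0"
      from eventually_not_dvd[OF this] that show False by (simp add: frequently_def)
    qed
    have "\<exists>\<^sub>F P in primes_filter. P dvd u"
      using frequently_eventually_frequently[OF frequently_odd_degree E]
      by (rule frequently_elim1) auto
    then have "u = 0" by (rule zero)
    have "\<exists>\<^sub>F P in primes_filter. P dvd v - u"
      using frequently_eventually_frequently[OF feven E] by (rule frequently_elim1) auto
    then have "v - u = 0" by (rule zero)
    then show False using uv(2) \<open>u = 0\<close> by simp
  qed
  then show ?thesis using range_of_K_subset finite_separable_elementsI[OF L g] by blast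
qed

theorem theorem1p16:
  shows "(subring (finite_separable_elements :: 'k::{field,finite} A\<^sub>K set) ring_of_type_algebra \<and>
          subalgebra (range of_K) (finite_separable_elements :: 'k A\<^sub>K set) ring_of_type_algebra) \<and>
         (range of_K \<subset> (finite_separable_elements :: 'k A\<^sub>K set) \<and>
          finite_separable_elements \<subset> (separably_algebraic_elements :: 'k A\<^sub>K set) \<and>
          separably_algebraic_elements \<subset> (algebraic_elements :: 'k A\<^sub>K set) \<and>
          algebraic_elements \<subset> (UNIV :: 'k A\<^sub>K set))"
  by (intro conjI finite_separable_elements_subring finite_separable_elements_subalgebra range_of_K_psubset
      finite_separable_psubset separably_algebraic_psubset algebraic_psubset)

end
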